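(* Let $A$, $A_{\rm rc}$, $\mathcal N$ satisfy the state-operator assumptions (i)–(iv) of the context and let $\lambda>0$. Suppose we can construct a sequence $(U_{\#\mathbb M_\sigma},E_{\mathbb M_\sigma})_{M}$ as in the context (with $\alpha_{\mathbb M_{\sigma+}}\to+\infty$ as $M\to+\infty$) such that $$\big|P_{U_{\#\mathbb M_\sigma}}^{E_{\mathbb M_\sigma}^\perp}\big|_{\mathcal L(H)}\le C_P\qquad\text{and}\qquad\frac{\alpha_{\mathbb M_\sigma}}{\alpha_{\mathbb M_{\sigma+}}}\le\Lambda,$$ with $C_P>0$ and $\Lambda>0$ both independent of $M$. Then, for arbitrary given $R>0$, we can find $M\in\mathbb N$ large enough and constants $C_5\ge 1$, $\mu_2>0$, with $(C_5,\mu_2,M)$ independent of $y_0$, such that for all $y_0\in V$ with $|y_0|_V<R$ the solution of $$\dot y+Ay+A_{\rm rc}(t)y+\mathcal N(t,y)-\mathfrak F(t,y)=0,\qquad y(0)=y_0,$$ with $$\mathfrak F(t,y)=P_{U_{\#\mathbb M_\sigma}}^{E_{\mathbb M_\sigma}^\perp}\Bigl(Ay+A_{\rm rc}(t)y+\mathcal N(t,y)-(A+\lambda\mathbf 1)P_{E_{\mathbb M_\sigma}}y\Bigr),$$ is defined for all $t\ge0$ and satisfies $$|y(t)|_V^2\le C_5\,\mathrm e^{-\mu_2t}|y_0|_V^2\qquad\text{for all }t\ge0.$$ That is, the system is semiglobally $(\mathbb F,V)$-exponentially stable, with the class $\mathbb F$ defined in the context.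
   Context: Notation: $\mathbb R_0=(0,+\infty)$, $\mathbb N=\{0,1,2,\dots\}$, $\mathbb N_0=\{1,2,\dots\}$; $\mathbf 1$ is the identity; $|\cdot|_X$ is the norm of $X$; $\mathcal L(X,Y)$ is the space of bounded linear operators, $\mathcal L(X)=\mathcal L(X,X)$. For normed spaces $X,Y$, $\mathcal C_{\rm b,i}(X,Y)$ is the set of continuous $f:X\to Y$ for which there is a continuous nondecreasing $\mathfrak n:[0,+\infty)\to\mathbb R$ with $\mathfrak n(0)=0$ and $|f(x)|_Y\le\mathfrak n(|x|_X)$ for all $x\in X$. State-operator assumptions. $H$ and $V\subseteq H$ are separable real Hilbert spaces, with $H$ as pivot space, $H'=H$. (i) $A\in\mathcal L(V,V')$ is a symmetric isomorphism from $V$ onto $V'$ and $(y,z)\mapsto\langle Ay,z\rangle_{V',V}$ is a complete scalar product on $V$; $V$ is endowed with this scalar product. (ii) The inclusion $V\subseteq H$ is continuous, dense and compact. Put $\mathrm D(A)=\{u\in V\mid Au\in H\}$, with $|u|_{\mathrm D(A)}=|Au|_H$. Then $A$ has a nondecreasing sequence of (repeated) eigenvalues $0<\alpha_1\le\alpha_2\le\dots\to+\infty$ and a corresponding complete orthonormal basis of eigenfunctions $(e_i)_{i\in\mathbb N_0}$ of $H$, $Ae_i=\alpha_ie_i$. (iii) For all $t>0$, $A_{\rm rc}(t)\in\mathcal L(V,H)$, and $|A_{\rm rc}|_{L^\infty(\mathbb R_0,\mathcal L(V,H))}\le C_{\rm rc}$ for a constant $C_{\rm rc}\ge0$. (iv)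 $\mathcal N(t,\cdot)\in\mathcal C_{\rm b,i}(\mathrm D(A),H)$ and there are $C_{\mathcal N}\ge0$, $n\in\mathbb N_0$, and nonnegative $\zeta_{1j},\zeta_{2j},\delta_{1j},\delta_{2j}$, $1\le j\le n$, with $\zeta_{2j}+\delta_{2j}<1$ and $\delta_{1j}+\delta_{2j}\ge1$, such that for all $t>0$ and all $y_1,y_2\in\mathrm D(A)$, $$|\mathcal N(t,y_1)-\mathcal N(t,y_2)|_H\le C_{\mathcal N}\sum_{j=1}^n\Bigl(|y_1|_V^{\zeta_{1j}}|y_1|_{\mathrm D(A)}^{\zeta_{2j}}+|y_2|_V^{\zeta_{1j}}|y_2|_{\mathrm D(A)}^{\zeta_{2j}}\Bigr)|y_1-y_2|_V^{\delta_{1j}}|y_1-y_2|_{\mathrm D(A)}^{\delta_{2j}}.$$ Eigenspaces, actuators, projections. For each $M\in\mathbb N_0$, $\mathbb M_\sigma\subset\mathbb N_0$ is a finite nonempty set (depending on $M$) with $\#\mathbb M_\sigma$ elements, $E_{\mathbb M_\sigma}=\mathrm{span}\{e_i\mid i\in\mathbb M_\sigma\}$, and $U_{\#\mathbb M_\sigma}\subset H$ is a $\#\mathbb M_\sigma$-dimensional subspace (depending on $M$) such that $H=U_{\#\mathbb M_\sigma}\oplus E_{\mathbb M_\sigma}^\perp$. Put $\alpha_{\mathbb M_\sigma}=\max\{\alpha_i\mid i\in\mathbb M_\sigma\}$ and $\alpha_{\mathbb M_{\sigma+}}=\min\{\alpha_i\mid i\in\mathbb N_0\setminus\mathbb M_\sigma\}$.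 If $H=F\oplus G$ with $F,G$ closed, $P_F^G$ is the (oblique) projection in $H$ onto $F$ along $G$; $P_F=P_F^{F^\perp}$ is the orthogonal projection. Class $\mathbb F$: the set of all operators $$(t,y)\mapsto P_{U_{\#\mathbb M_\sigma}}^{E_{\mathbb M_\sigma}^\perp}\bigl(Ay+A_{\rm rc}(t)y+\mathcal N(t,y)-\mathcal F_{\mathbb M_\sigma}(P_{E_{\mathbb M_\sigma}}y)\bigr)$$ where $\mathbb M_\sigma\subset\mathbb N_0$ is finite, $U_{\#\mathbb M_\sigma}$ is a $\#\mathbb M_\sigma$-dimensional subspace of $H$ (with $H=U_{\#\mathbb M_\sigma}\oplus E_{\mathbb M_\sigma}^\perp$), and $\mathcal F_{\mathbb M_\sigma}\in\mathcal C_{\rm b,i}(E_{\mathbb M_\sigma},E_{\mathbb M_\sigma})$. The system $\dot y+Ay+A_{\rm rc}(t)y+\mathcal N(t,y)-\mathfrak F(t,y)=0$, $y(0)=y_0$, is semiglobally $(\mathbb F,V)$-exponentially stable if for every $R>0$ there are $\mathfrak F\in\mathbb F$, $\mathfrak K\ge1$, $\mathfrak l>0$ such that for every $y_0\in V$ with $|y_0|_V<R$ the solution is defined for all $t\ge0$ and satisfies $|y(t)|_V^2\le\mathfrak K\mathrm e^{-\mathfrak lt}|y_0|_V^2$.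
   Formalization: It is additionally assumed that t ↦ N(t,y) is measurable on (0,∞) for each y in D(A); without this, assumption (iv) allows N(t,y)=g(t)y with g bounded and non-measurable, for which the equation has no solution. *)

theory Defs
  imports "HOL-Analysis.Analysis"
begin

text \<open>
  The pivot space \<open>H\<close> is a type \<open>'h\<close>, the space \<open>V\<close> is a type \<open>'v\<close> together with its
  inclusion \<open>\<iota>\<close> into \<open>H\<close>, and \<open>V'\<close> is the type \<open>'v \<Rightarrow>\<^sub>L real\<close>.
  Indices \<open>i\<close> and \<open>M\<close> range over the positive integers; values of
  sequences at \<open>0\<close>, and of time-dependent operators at \<open>t \<le> 0\<close>, are irrelevant.
\<close>

text \<open>With \<open>H' = H\<close> (Riesz), \<open>h \<in> H\<close> is identified with the functional \<open>v \<mapsto> (h, v)\<^sub>H\<close> in \<open>V'\<close>.\<close>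

definition pivot :: "('v::real_inner \<Rightarrow>\<^sub>L 'h::real_inner) \<Rightarrow> 'h \<Rightarrow> ('v \<Rightarrow>\<^sub>L real)" where
  "pivot \<iota> h = blinfun_inner_right h o\<^sub>L \<iota>"

definition domA ::
  "('v::real_inner \<Rightarrow>\<^sub>L 'h::real_inner) \<Rightarrow> ('v \<Rightarrow>\<^sub>L ('v \<Rightarrow>\<^sub>L real)) \<Rightarrow> 'v set" where
  "domA \<iota> A = {u. blinfun_apply A u \<in> range (pivot \<iota>)}"

text \<open>\<open>A u\<close> as an element of \<open>H\<close>, for \<open>u\<close> in the domain; it is unique because \<open>V\<close> is dense in \<open>H\<close>.\<close>

definition opA ::
  "('v::real_inner \<Rightarrow>\<^sub>L 'h::real_inner) \<Rightarrow> ('v \<Rightarrow>\<^sub>L ('v \<Rightarrow>\<^sub>L real)) \<Rightarrow> 'v \<Rightarrow> 'h" where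
  "opA \<iota> A u = (THE h. blinfun_apply A u = pivot \<iota> h)"

definition normDA ::
  "('v::real_inner \<Rightarrow>\<^sub>L 'h::real_inner) \<Rightarrow> ('v \<Rightarrow>\<^sub>L ('v \<Rightarrow>\<^sub>L real)) \<Rightarrow> 'v \<Rightarrow> real" where
  "normDA \<iota> A u = norm (opA \<iota> A u)"

text \<open>The class of continuous maps with a continuous nondecreasing modulus, for a normed space
  given by a subspace \<open>X\<close> with norm \<open>nX\<close>, and a subspace \<open>Y\<close> with the norm of its type.\<close>

definition Cbi ::
  "'a::real_vector set \<Rightarrow> ('a \<Rightarrow> real) \<Rightarrow> 'b::real_normed_vector set \<Rightarrow> ('a \<Rightarrow> 'b) set" where
  "Cbi X nX Y = {f. f \<in> X \<rightarrow> Y \<and>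
     (\<forall>x\<in>X. \<forall>\<epsilon>>0. \<exists>\<delta>>0. \<forall>x'\<in>X. nX (x' - x) < \<delta> \<longrightarrow> norm (f x' - f x) < \<epsilon>) \<and>
     (\<exists>m :: real \<Rightarrow> real. continuous_on {0..} m \<and> mono_on {0..} m \<and> m 0 = 0 \<and>
        (\<forall>x\<in>X. norm (f x) \<le> m (nX x)))}"

text \<open>Real powers of nonnegative numbers with the convention \<open>0\<^sup>0 = 1\<close>
  (whereas \<open>0 powr 0 = 0\<close> in the library).\<close>

definition rpow :: "real \<Rightarrow> real \<Rightarrow> real" where
  "rpow x a = (if a = 0 then 1 else x powr a)"

text \<open>
  In the assumptions below, the inner product of the type \<open>'v\<close> is the scalar product
  \<open>\<langle>Ay, z\<rangle>\<close> with which \<open>V\<close> is endowed; its completeness is the completeness of the type.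
  The eigenpairs \<open>(\<alpha>\<^sub>i, e\<^sub>i)\<close> are an arbitrary choice, with \<open>e\<^sub>i\<close> taken as elements of \<open>V\<close>.
  The measurability of \<open>Arc\<close> is part of its membership in \<open>L\<^sup>\<infinity>\<close> (in the weakest, pointwise form).
  The measurability of \<open>N\<close> in time is implicit in the evolution equation, whose terms have to be
  \<open>H\<close>-valued measurable functions of time.
\<close>

locale state_operator =
  fixes \<iota> :: "'v::{real_inner, banach, second_countable_topology} \<Rightarrow>\<^sub>L
                'h::{real_inner, banach, second_countable_topology}"
    and A :: "'v \<Rightarrow>\<^sub>L ('v \<Rightarrow>\<^sub>L real)"
    and \<alpha> :: "nat \<Rightarrow> real"
    and e :: "nat \<Rightarrow> 'v"
    and Arc :: "real \<Rightarrow> 'v \<Rightarrow>\<^sub>L 'h"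
    and N :: "real \<Rightarrow> 'v \<Rightarrow> 'h"
    and Crc CN :: real
    and n :: nat
    and \<zeta>1 \<zeta>2 \<delta>1 \<delta>2 :: "nat \<Rightarrow> real"
  assumes A_sym: "\<And>y z. blinfun_apply (A y) z = blinfun_apply (A z) y"
    and A_iso: "\<exists>B. A o\<^sub>L B = id_blinfun \<and> B o\<^sub>L A = id_blinfun"
    and A_inner: "\<And>y z. blinfun_apply (A y) z = y \<bullet> z"
    and incl_inj: "inj (blinfun_apply \<iota>)"
    and incl_dense: "closure (range (blinfun_apply \<iota>)) = UNIV"
    and incl_compact: "\<And>B. bounded B \<Longrightarrow> compact (closure (blinfun_apply \<iota> ` B))"
    and eigenvalues_pos: "0 < \<alpha> 1"
    and eigenvalues_mono: "mono_on {1..} \<alpha>"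
    and eigenvalues_unbounded: "filterlim \<alpha> at_top sequentially"
    and eigenfunctions: "\<And>i. i \<ge> 1 \<Longrightarrow> e i \<in> domA \<iota> A \<and> opA \<iota> A (e i) = \<alpha> i *\<^sub>R \<iota> (e i)"
    and orthonormal: "\<And>i j. i \<ge> 1 \<Longrightarrow> j \<ge> 1 \<Longrightarrow> \<iota> (e i) \<bullet> \<iota> (e j) = (if i = j then 1 else 0)"
    and complete_basis: "closure (span ((\<lambda>i. \<iota> (e i)) ` {1..})) = UNIV"
    and Arc_meas: "\<And>v. (\<lambda>t. blinfun_apply (Arc t) v) \<in> borel_measurable (lebesgue_on {0<..})"
    and Crc_nonneg: "0 \<le> Crc"
    and Arc_bound: "AE t in lebesgue_on {0<..}. norm (Arc t) \<le> Crc"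
    and N_meas: "\<And>y. y \<in> domA \<iota> A \<Longrightarrow> (\<lambda>t. N t y) \<in> borel_measurable (lebesgue_on {0<..})"
    and N_Cbi: "\<And>t. t > 0 \<Longrightarrow> N t \<in> Cbi (domA \<iota> A) (normDA \<iota> A) UNIV"
    and CN_nonneg: "0 \<le> CN"
    and n_pos: "1 \<le> n"
    and exponents_nonneg:
      "\<And>j. j \<in> {1..n} \<Longrightarrow> 0 \<le> \<zeta>1 j \<and> 0 \<le> \<zeta>2 j \<and> 0 \<le> \<delta>1 j \<and> 0 \<le> \<delta>2 j"
    and exponents: "\<And>j. j \<in> {1..n} \<Longrightarrow> \<zeta>2 j + \<delta>2 j < 1 \<and> \<delta>1 j + \<delta>2 j \<ge> 1"
    and N_bound: "\<And>t y1 y2. t > 0 \<Longrightarrow> y1 \<in> domA \<iota> A \<Longrightarrow> y2 \<in> domA \<iota> A \<Longrightarrow>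
      norm (N t y1 - N t y2) \<le> CN * (\<Sum>j=1..n.
        (rpow (norm y1) (\<zeta>1 j) * rpow (normDA \<iota> A y1) (\<zeta>2 j)
          + rpow (norm y2) (\<zeta>1 j) * rpow (normDA \<iota> A y2) (\<zeta>2 j))
        * rpow (norm (y1 - y2)) (\<delta>1 j) * rpow (normDA \<iota> A (y1 - y2)) (\<delta>2 j))"

definition direct_sum :: "'h::real_vector set \<Rightarrow> 'h set \<Rightarrow> bool" where
  "direct_sum F G \<longleftrightarrow> subspace F \<and> subspace G \<and> F \<inter> G = {0} \<and> (\<forall>h. \<exists>f\<in>F. \<exists>g\<in>G. h = f + g)"

definition oblique_proj :: "'h::real_vector set \<Rightarrow> 'h set \<Rightarrow> 'h \<Rightarrow> 'h" where
  "oblique_proj F G h = (THE f. f \<in> F \<and> h - f \<in> G)"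

definition orth_proj :: "'h::real_inner set \<Rightarrow> 'h \<Rightarrow> 'h" where
  "orth_proj F = oblique_proj F (orthogonal_comp F)"

definition Esp ::
  "('v::real_inner \<Rightarrow>\<^sub>L 'h::real_inner) \<Rightarrow> (nat \<Rightarrow> 'v) \<Rightarrow> nat set \<Rightarrow> 'h set" where
  "Esp \<iota> e S = span ((\<lambda>i. \<iota> (e i)) ` S)"

definition alpha_max :: "(nat \<Rightarrow> real) \<Rightarrow> nat set \<Rightarrow> real" where
  "alpha_max \<alpha> S = Max (\<alpha> ` S)"

text \<open>The infimum is attained, since the eigenvalues tend to infinity.\<close>

definition alpha_plus :: "(nat \<Rightarrow> real) \<Rightarrow> nat set \<Rightarrow> real" where
  "alpha_plus \<alpha> S = Inf (\<alpha> ` ({1..} - S))"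

definition admissible_pair ::
  "('v::real_inner \<Rightarrow>\<^sub>L 'h::real_inner) \<Rightarrow> (nat \<Rightarrow> 'v) \<Rightarrow> nat set \<Rightarrow> 'h set \<Rightarrow> bool" where
  "admissible_pair \<iota> e S U \<longleftrightarrow> finite S \<and> S \<subseteq> {1..} \<and> subspace U \<and> dim U = card S
     \<and> direct_sum U (orthogonal_comp (Esp \<iota> e S))"

definition feedback ::
  "('v::real_inner \<Rightarrow>\<^sub>L 'h::real_inner) \<Rightarrow> ('v \<Rightarrow>\<^sub>L ('v \<Rightarrow>\<^sub>L real)) \<Rightarrow> (nat \<Rightarrow> 'v)
    \<Rightarrow> (real \<Rightarrow> 'v \<Rightarrow>\<^sub>L 'h) \<Rightarrow> (real \<Rightarrow> 'v \<Rightarrow> 'h) \<Rightarrow> nat set \<Rightarrow> 'h set \<Rightarrow> ('h \<Rightarrow> 'h)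
    \<Rightarrow> real \<Rightarrow> 'v \<Rightarrow> 'h" where
  "feedback \<iota> A e Arc N S U FM t y =
     oblique_proj U (orthogonal_comp (Esp \<iota> e S))
       (opA \<iota> A y + blinfun_apply (Arc t) y + N t y - FM (orth_proj (Esp \<iota> e S) (\<iota> y)))"

definition feedback_class ::
  "('v::real_inner \<Rightarrow>\<^sub>L 'h::real_inner) \<Rightarrow> ('v \<Rightarrow>\<^sub>L ('v \<Rightarrow>\<^sub>L real)) \<Rightarrow> (nat \<Rightarrow> 'v)
    \<Rightarrow> (real \<Rightarrow> 'v \<Rightarrow>\<^sub>L 'h) \<Rightarrow> (real \<Rightarrow> 'v \<Rightarrow> 'h) \<Rightarrow> (real \<Rightarrow> 'v \<Rightarrow> 'h) set" where
  "feedback_class \<iota> A e Arc N =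
     {feedback \<iota> A e Arc N S U FM | S U FM.
        admissible_pair \<iota> e S U \<and> FM \<in> Cbi (Esp \<iota> e S) norm (Esp \<iota> e S)}"

text \<open>The map \<open>A + \<lambda>\<one>\<close> on elements of \<open>H\<close> that belong to \<open>D(A)\<close>, in particular on \<open>E\<close>.\<close>

definition A_shift ::
  "('v::real_inner \<Rightarrow>\<^sub>L 'h::real_inner) \<Rightarrow> ('v \<Rightarrow>\<^sub>L ('v \<Rightarrow>\<^sub>L real)) \<Rightarrow> real \<Rightarrow> 'h \<Rightarrow> 'h" where
  "A_shift \<iota> A lam x = opA \<iota> A (inv (blinfun_apply \<iota>) x) + lam *\<^sub>R x"

definition L2_on :: "real \<Rightarrow> (real \<Rightarrow> 'h::real_normed_vector) \<Rightarrow> bool" where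
  "L2_on T f \<longleftrightarrow> f \<in> borel_measurable (lebesgue_on {0<..<T}) \<and>
     integrable (lebesgue_on {0<..<T}) (\<lambda>t. (norm (f t))\<^sup>2)"

text \<open>
  Strong solutions on \<open>[0, T]\<close>: \<open>y \<in> L\<^sup>2((0,T), D(A))\<close> with weak derivative
  \<open>w \<in> L\<^sup>2((0,T), H)\<close>, \<open>y \<in> C([0,T], V)\<close>, and the equation holds in \<open>H\<close> almost everywhere.
\<close>

definition strong_solution ::
  "('v::{real_inner, banach, second_countable_topology} \<Rightarrow>\<^sub>L
      'h::{real_inner, banach, second_countable_topology})
    \<Rightarrow> ('v \<Rightarrow>\<^sub>L ('v \<Rightarrow>\<^sub>L real)) \<Rightarrow> (real \<Rightarrow> 'v \<Rightarrow>\<^sub>L 'h) \<Rightarrow> (real \<Rightarrow> 'v \<Rightarrow> 'h)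
    \<Rightarrow> (real \<Rightarrow> 'v \<Rightarrow> 'h) \<Rightarrow> 'v \<Rightarrow> real \<Rightarrow> (real \<Rightarrow> 'v) \<Rightarrow> bool" where
  "strong_solution \<iota> A Arc N F y0 T y \<longleftrightarrow>
     continuous_on {0..T} y \<and> y 0 = y0 \<and>
     (AE t in lebesgue_on {0<..<T}. y t \<in> domA \<iota> A) \<and> L2_on T (\<lambda>t. opA \<iota> A (y t)) \<and>
     (\<exists>w. L2_on T w \<and>
        (\<forall>t\<in>{0..T}. \<iota> (y t) = \<iota> y0 + (LINT s|lebesgue_on {0<..<t}. w s)) \<and>
        (AE t in lebesgue_on {0<..<T}.
           w t + opA \<iota> A (y t) + blinfun_apply (Arc t) (y t) + N t (y t) - F t (y t) = 0))"

text \<open>The solution issued from \<open>y0\<close> is defined for all \<open>t \<ge> 0\<close> (it exists globally, and every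
  solution on a bounded interval is its restriction), and decays exponentially in \<open>V\<close>.\<close>

definition solution_decays ::
  "('v::{real_inner, banach, second_countable_topology} \<Rightarrow>\<^sub>L
      'h::{real_inner, banach, second_countable_topology})
    \<Rightarrow> ('v \<Rightarrow>\<^sub>L ('v \<Rightarrow>\<^sub>L real)) \<Rightarrow> (real \<Rightarrow> 'v \<Rightarrow>\<^sub>L 'h) \<Rightarrow> (real \<Rightarrow> 'v \<Rightarrow> 'h)
    \<Rightarrow> (real \<Rightarrow> 'v \<Rightarrow> 'h) \<Rightarrow> real \<Rightarrow> real \<Rightarrow> 'v \<Rightarrow> bool" where
  "solution_decays \<iota> A Arc N F K l y0 \<longleftrightarrow>
     (\<exists>y. (\<forall>T>0. strong_solution \<iota> A Arc N F y0 T y) \<and>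
          (\<forall>T>0. \<forall>z. strong_solution \<iota> A Arc N F y0 T z \<longrightarrow> (\<forall>t\<in>{0..T}. z t = y t)) \<and>
          (\<forall>t\<ge>0. (norm (y t))\<^sup>2 \<le> K * exp (- l * t) * (norm y0)\<^sup>2))"

definition semiglobally_exp_stable ::
  "('v::{real_inner, banach, second_countable_topology} \<Rightarrow>\<^sub>L
      'h::{real_inner, banach, second_countable_topology})
    \<Rightarrow> ('v \<Rightarrow>\<^sub>L ('v \<Rightarrow>\<^sub>L real)) \<Rightarrow> (real \<Rightarrow> 'v \<Rightarrow>\<^sub>L 'h) \<Rightarrow> (real \<Rightarrow> 'v \<Rightarrow> 'h)
    \<Rightarrow> (real \<Rightarrow> 'v \<Rightarrow> 'h) set \<Rightarrow> bool" where
  "semiglobally_exp_stable \<iota> A Arc N \<F> \<longleftrightarrow>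
     (\<forall>R>0. \<exists>F\<in>\<F>. \<exists>K\<ge>1. \<exists>l>0. \<forall>y0. norm y0 < R \<longrightarrow> solution_decays \<iota> A Arc N F K l y0)"

end

theory Submission
  imports Defs
begin

text \<open>
  On the domain of \<open>A\<close> the feedback turns the equation into
  \<open>y' + A y + (1 - P) (Arc y + N (t, y)) + lam P y = 0\<close>, with \<open>P\<close> the oblique projection. The modes of
  \<open>y\<close> in \<open>S\<close> decouple, \<open>y\<^sub>i' = - (\<alpha>\<^sub>i + lam) y\<^sub>i\<close>, and the remaining ones are damped at a rate of at
  least \<open>alpha_plus\<close>. The equation is solved globally in time as a fixed point in the space of
  functions for which \<open>|y(t)|\<^sub>V\<^sup>2\<close> and \<open>\<integral>\<^sub>0\<^sup>t exp (- \<beta> (t - s)) |A y(s)|\<^sub>H\<^sup>2 ds\<close> are bounded by a multiple of \<open>exp (- \<alpha>\<^sub>1 t)\<close>.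
  For a forcing without components in \<open>S\<close>, the linear problem is solved in this space for
  \<open>2 \<beta> \<le> alpha_plus\<close> with constants independent of \<open>\<beta>\<close>, while \<open>\<zeta>2 + \<delta>2 < 1\<close> makes the Lipschitz
  constant of \<open>N\<close> on a given ball tend to \<open>0\<close> as \<open>\<beta>\<close> grows. Since \<open>\<delta>1 + \<delta>2 \<ge> 1\<close> this
  constant does not deteriorate for small data, so the solution is bounded by a multiple of \<open>|y\<^sub>0|\<^sub>V\<close>,
  and the decay is built into the norm. Uniqueness among all strong solutions follows from
  maximal regularity and Gronwall's lemma with an integrable kernel.
\<close>

section \<open>Orthonormal bases\<close>

text \<open>Two properties of the oblique projection carry the argument. The range of
  \<open>1 - P\<close> is orthogonal to the eigenspace, so the perturbation never excites a mode in
  \<open>S\<close>, however small its eigenvalue. And \<open>P\<close> sees only the orthogonal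
  projection onto the eigenspace, so \<open>lam * P y\<close> involves only modes that are known
  explicitly; in the iteration it can be treated as a given forcing. The obstacle is the order of
  the choices: \<open>R\<close> fixes the radius of the ball, the radius fixes the Lipschitz bounds
  and through them \<open>\<beta>\<close>, and only then can \<open>M\<close> be taken so large that
  \<open>2 * \<beta> \<le> alpha_plus\<close>. No constant chosen before \<open>M\<close> may depend
  on it; this is where the uniform bound \<open>CP\<close> enters. The linear estimates are made
  mode by mode with constants that do not depend on the eigenvalue, and are summed by Parseval.
  Membership in the domain of \<open>A\<close> is available only at almost every time; therefore
  energies are extended nonnegative integrals, and their finiteness yields the membership.\<close>

locale hilbert_basis =
  fixes b :: "nat \<Rightarrow> 'a::{real_inner, banach}"
  assumes orthonormal_b: "b i \<bullet> b j = (if i = j then 1 else 0)"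
    and total_b: "(\<And>i. x \<bullet> b i = 0) \<Longrightarrow> x = 0"
begin

lemma ext_b: "(\<And>i. x \<bullet> b i = y \<bullet> b i) \<Longrightarrow> x = y"
  using total_b[of "x - y"] by (simp add: inner_diff_left)

lemma inner_sum_b:
  "finite I \<Longrightarrow> (\<Sum>i\<in>I. c i *\<^sub>R b i) \<bullet> b j = (if j \<in> I then c j else 0)"
  by (simp add: inner_sum_left orthonormal_b if_distrib cong: if_cong)

lemma norm_sum_b: "finite I \<Longrightarrow> (norm (\<Sum>i\<in>I. c i *\<^sub>R b i))^2 = (\<Sum>i\<in>I. (c i)^2)"
  by (simp add: power2_norm_eq_inner inner_sum_b inner_sum_right) (simp add: power2_eq_square)

lemma summable_b:
  assumes "summable (\<lambda>i. (c i)^2)"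
  shows "summable (\<lambda>i. c i *\<^sub>R b i)"
  unfolding summable_Cauchy
proof (intro allI impI)
  fix \<epsilon> :: real assume "\<epsilon> > 0"
  then obtain M where M: "\<And>m n. m \<ge> M \<Longrightarrow> norm (\<Sum>i=m..<n. (c i)^2) < \<epsilon>^2"
    using assms unfolding summable_Cauchy by (meson zero_less_power)
  have "norm (\<Sum>i=m..<n. c i *\<^sub>R b i) < \<epsilon>" if "m \<ge> M" for m n
  proof -
    have "(norm (\<Sum>i=m..<n. c i *\<^sub>R b i))^2 < \<epsilon>^2"
      using M[OF that, of n] by (simp add: norm_sum_b)
    then show ?thesis using \<open>\<epsilon> > 0\<close> by (simp add: power_less_imp_less_base)
  qed
  then show "\<exists>M. \<forall>m\<ge>M. \<forall>n. norm (\<Sum>i=m..<n. c i *\<^sub>R b i) < \<epsilon>" by blast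
qed

lemma inner_suminf_b:
  assumes "summable (\<lambda>i. (c i)^2)"
  shows "(\<Sum>i. c i *\<^sub>R b i) \<bullet> b j = c j"
proof -
  have "(\<lambda>i. (c i *\<^sub>R b i) \<bullet> b j) sums ((\<Sum>i. c i *\<^sub>R b i) \<bullet> b j)"
    using bounded_linear.sums[OF bounded_linear_inner_left summable_sums[OF summable_b[OF assms]]] .
  moreover have "(\<lambda>i. (c i *\<^sub>R b i) \<bullet> b j) = (\<lambda>i. if i = j then c j else 0)"
    by (auto simp: orthonormal_b)
  moreover have "(\<lambda>i. if i = j then c j else 0) sums c j"
    using sums_single[of j "\<lambda>_. c j"] by simp
  ultimately show ?thesis using sums_unique2 by metis
qed

lemma bessel: "finite I \<Longrightarrow> (\<Sum>i\<in>I. (x \<bullet> b i)^2) \<le> (norm x)^2"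
proof -
  assume I: "finite I"
  let ?s = "\<Sum>i\<in>I. (x \<bullet> b i) *\<^sub>R b i"
  have "x \<bullet> ?s = (\<Sum>i\<in>I. (x \<bullet> b i)^2)" by (simp add: inner_sum_right power2_eq_square)
  moreover have "?s \<bullet> ?s = (\<Sum>i\<in>I. (x \<bullet> b i)^2)"
    using norm_sum_b[OF I, of "\<lambda>i. x \<bullet> b i"] by (simp add: power2_norm_eq_inner)
  moreover have "0 \<le> (x - ?s) \<bullet> (x - ?s)" by simp
  ultimately show ?thesis
    by (simp add: power2_norm_eq_inner inner_diff_left inner_diff_right inner_commute)
qed

lemma summable_coeffs: "summable (\<lambda>i. (x \<bullet> b i)^2)"
  using bessel[of "{..<n}" x for n]
  by (intro summableI_nonneg_bounded[where x = "(norm x)^2"]) auto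

lemma expansion_b: "(\<lambda>i. (x \<bullet> b i) *\<^sub>R b i) sums x"
proof -
  have "(\<Sum>i. (x \<bullet> b i) *\<^sub>R b i) = x"
    by (rule ext_b) (simp add: inner_suminf_b summable_coeffs)
  then show ?thesis using summable_sums[OF summable_b[OF summable_coeffs[of x]]] by simp
qed

lemma parseval_inner: "(\<lambda>i. (x \<bullet> b i) * (y \<bullet> b i)) sums (x \<bullet> y)"
  using bounded_linear.sums[OF bounded_linear_inner_left[of y] expansion_b[of x]]
  by (simp add: inner_commute)

lemma parseval: "(\<lambda>i. (x \<bullet> b i)^2) sums (norm x)^2"
  using parseval_inner[of x x] by (simp add: power2_norm_eq_inner) (simp add: power2_eq_square)

lemma ex_coeffs: "summable (\<lambda>i. (c i)^2) \<Longrightarrow> \<exists>x. \<forall>i. x \<bullet> b i = c i"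
  using inner_suminf_b by blast

lemma ennreal_parseval: "(\<Sum>i. ennreal ((x \<bullet> b i)^2)) = ennreal ((norm x)^2)"
  using parseval[of x] by (intro suminf_ennreal_eq) auto

end

section \<open>Convolution with an exponential\<close>

abbreviation Lo :: "real \<Rightarrow> real measure" where
  "Lo t \<equiv> lebesgue_on {0<..<t}"

abbreviation wsq :: "real \<Rightarrow> (real \<Rightarrow> 'b::real_normed_vector) \<Rightarrow> real \<Rightarrow> ennreal" where
  "wsq \<beta> f t \<equiv> \<integral>\<^sup>+ s. ennreal (exp (\<beta> * s) * (norm (f s))^2) \<partial>Lo t"

abbreviation BM :: "real \<Rightarrow> (real \<Rightarrow> 'b::topological_space) set" where
  "BM t \<equiv> borel_measurable (Lo t)"

lemmas LINT_cong = Bochner_Integration.integral_cong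
lemmas LINT_cmult = Bochner_Integration.integral_mult_right_zero
lemmas L1_bound = Bochner_Integration.integrable_bound

lemma lmeasurable_ioo [simp]: "{x<..<y::real} \<in> lmeasurable"
  by (rule bounded_set_imp_lmeasurable) auto

lemma finite_measure_Lo: "finite_measure (Lo t)"
  by (rule finite_measure_lebesgue_on) simp

lemma measurable_ident_lebesgue_on [measurable]:
  "(\<lambda>x. x) \<in> borel_measurable (lebesgue_on S)" for S :: "real set"
  using id_borel_measurable_lebesgue_on[of S] by (simp add: id_def)

lemma borel_measurable_lebesgue_onI:
  "f \<in> borel_measurable borel \<Longrightarrow> f \<in> borel_measurable (lebesgue_on S)" for f :: "real \<Rightarrow> 'b::topological_space"
  by (rule measurable_compose[OF measurable_ident_lebesgue_on])

lemma Lo_restrict: "s \<le> t \<Longrightarrow> Lo s = restrict_space (Lo t) {..<s}"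
  by (subst restrict_restrict_space) (auto intro!: arg_cong[where f = lebesgue_on])

lemma integral_Lo_restrict:
  fixes f :: "real \<Rightarrow> 'b::{banach, second_countable_topology}"
  assumes "s \<le> t"
  shows "(LINT r|Lo s. f r) = (LINT r|Lo t. (if r < s then f r else 0))"
proof -
  have "(LINT r|Lo s. f r) = (LINT r|Lo t. indicator {..<s} r *\<^sub>R f r)"
    unfolding Lo_restrict[OF assms] by (rule integral_restrict_space) (auto simp: sets_restrict_space_iff)
  also have "\<dots> = (LINT r|Lo t. (if r < s then f r else 0))"
    by (intro LINT_cong) (auto simp: indicator_def)
  finally show ?thesis .
qed

lemma nn_integral_Lo_restrict:
  assumes "s \<le> t"
  shows "(\<integral>\<^sup>+ r. f r \<partial>Lo s) = (\<integral>\<^sup>+ r. (if r < s then f r else 0) \<partial>Lo t)"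
proof -
  have "(\<integral>\<^sup>+ r. f r \<partial>Lo s) = (\<integral>\<^sup>+ r. f r * indicator {..<s} r \<partial>Lo t)"
    unfolding Lo_restrict[OF assms] by (rule nn_integral_restrict_space) (auto simp: sets_restrict_space_iff)
  also have "\<dots> = (\<integral>\<^sup>+ r. (if r < s then f r else 0) \<partial>Lo t)"
    by (intro nn_integral_cong) (auto simp: indicator_def)
  finally show ?thesis .
qed

lemma nn_integral_Lo_mono: "s \<le> t \<Longrightarrow> (\<integral>\<^sup>+ r. f r \<partial>Lo s) \<le> (\<integral>\<^sup>+ r. f r \<partial>Lo t)"
  by (subst nn_integral_Lo_restrict, assumption) (auto intro!: nn_integral_mono)

lemma integrable_Lo_mono:
  fixes f :: "real \<Rightarrow> 'b::{banach, second_countable_topology}"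
  assumes "s \<le> t" and f: "integrable (Lo t) f"
  shows "integrable (Lo s) f"
proof -
  have [measurable]: "f \<in> BM t" using f by simp
  have "integrable (Lo t) (\<lambda>r. indicator {..<s} r *\<^sub>R f r)"
    by (rule L1_bound[OF f]) (auto simp: indicator_def)
  then show ?thesis
    unfolding Lo_restrict[OF \<open>s \<le> t\<close>]
    by (subst integrable_restrict_space) (auto simp: sets_restrict_space_iff)
qed

lemma measurable_Lo_mono:
  "s \<le> t \<Longrightarrow> f \<in> BM t \<Longrightarrow> f \<in> BM s"
  unfolding Lo_restrict[of s t] by (rule measurable_restrict_space1)

lemma AE_Lo_mono: "s \<le> t \<Longrightarrow> AE r in Lo t. P r \<Longrightarrow> AE r in Lo s. P r"
  by (subst Lo_restrict, assumption) (subst AE_restrict_space_iff, auto simp: sets_restrict_space_iff)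

lemma nn_integral_exp:
  fixes x y k :: real
  assumes "k \<noteq> 0" "x \<le> y"
  shows "(\<integral>\<^sup>+ s. ennreal (exp (k * s)) \<partial>lebesgue_on {x<..<y}) = ennreal ((exp (k * y) - exp (k * x)) / k)"
proof -
  have "(\<integral>\<^sup>+ s. ennreal (exp (k * s)) \<partial>lebesgue_on {x<..<y})
      = (\<integral>\<^sup>+ s. ennreal (exp (k * s)) * indicator {x<..<y} s \<partial>lborel)"
    by (subst nn_integral_restrict_space) (auto simp: nn_integral_completion)
  also have "\<dots> = (\<integral>\<^sup>+ s. ennreal (exp (k * s)) * indicator {x..y} s \<partial>lborel)"
    by (intro nn_integral_cong_AE eventually_mono[OF AE_conjI[OF AE_lborel_singleton[of x] AE_lborel_singleton[of y]]])
       (auto simp: indicator_def)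
  also have "\<dots> = ennreal (exp (k * y) / k - exp (k * x) / k)"
    using assms by (intro nn_integral_FTC_Icc) (auto intro!: derivative_eq_intros)
  finally show ?thesis by (simp add: diff_divide_distrib)
qed

lemma exp_div_mono: "k \<noteq> 0 \<Longrightarrow> x \<le> y \<Longrightarrow> 0 \<le> (exp (k * y) - exp (k * x)) / (k::real)"
  by (cases "k > 0") (auto intro!: divide_nonneg_pos divide_nonpos_neg)

lemma integral_exp:
  fixes x y k :: real
  assumes "x \<le> y"
  shows "integrable (lebesgue_on {x<..<y}) (\<lambda>s. k * exp (k * s))"
    and "(LINT s|lebesgue_on {x<..<y}. k * exp (k * s)) = exp (k * y) - exp (k * x)"
proof -
  have "integrable (lebesgue_on {x<..<y}) (\<lambda>s. k * exp (k * s))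
      \<and> (LINT s|lebesgue_on {x<..<y}. k * exp (k * s)) = exp (k * y) - exp (k * x)"
  proof (cases "k = 0")
    case False
    have *: "has_bochner_integral (lebesgue_on {x<..<y}) (\<lambda>s. exp (k * s)) ((exp (k * y) - exp (k * x)) / k)"
      using exp_div_mono[OF False assms]
      by (intro has_bochner_integral_nn_integral nn_integral_exp False assms)
         (auto intro!: borel_measurable_lebesgue_onI)
    show ?thesis
      using has_bochner_integral_mult_right[OF *, of k] False
      by (auto simp: has_bochner_integral_iff)
  qed auto
  then show "integrable (lebesgue_on {x<..<y}) (\<lambda>s. k * exp (k * s))"
    and "(LINT s|lebesgue_on {x<..<y}. k * exp (k * s)) = exp (k * y) - exp (k * x)" by auto
qed

lemma integrable_mult_exp:
  fixes g :: "real \<Rightarrow> real"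
  assumes g: "integrable (Lo t) g"
  shows "integrable (Lo t) (\<lambda>s. exp (c * s) * g s)"
proof (rule L1_bound)
  show "integrable (Lo t) (\<lambda>s. exp (\<bar>c\<bar> * t) * g s)" using g by simp
  show "(\<lambda>s. exp (c * s) * g s) \<in> BM t"
    using borel_measurable_integrable[OF g] by measurable
  have "c * s \<le> \<bar>c\<bar> * t" if "0 < s" "s < t" for s
    using that by (intro order_trans[OF mult_right_mono[of c "\<bar>c\<bar>" s]] mult_left_mono) auto
  then show "AE s in Lo t. norm (exp (c * s) * g s) \<le> norm (exp (\<bar>c\<bar> * t) * g s)"
    by (intro AE_I2) (auto simp: abs_mult mult_right_mono)
qed

lemma continuous_on_integral_Lo:
  fixes f :: "real \<Rightarrow> real"
  assumes "integrable (Lo T) f"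
  shows "continuous_on {0..T} (\<lambda>t. LINT s|Lo t. f s)"
proof -
  have "f integrable_on {0..T}"
    using integrable_on_lebesgue_on[OF assms] by (simp add: integrable_on_open_interval_real)
  then have "continuous_on {0..T} (\<lambda>t. integral {0..t} f)"
    by (rule indefinite_integral_continuous_1)
  then show ?thesis
  proof (rule continuous_on_eq)
    fix t assume "t \<in> {0..T}"
    then show "integral {0..t} f = (LINT s|Lo t. f s)"
      using lebesgue_integral_eq_integral[OF integrable_Lo_mono[OF _ assms, of t]]
      by (simp add: integral_open_interval_real)
  qed
qed

lemma integrable_continuous_Lo:
  fixes f :: "real \<Rightarrow> 'b::{banach, second_countable_topology}"
  assumes "continuous_on {0..T} f"
  shows "integrable (Lo T) f"
proof -
  interpret finite_measure "Lo T" by (rule finite_measure_Lo)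
  have "bounded (f ` {0..T})"
    using assms by (intro compact_imp_bounded compact_continuous_image) auto
  then obtain B where "\<forall>x\<in>f ` {0..T}. norm x \<le> B"
    unfolding bounded_iff ..
  then have B: "norm (f t) \<le> B" if "t \<in> {0..T}" for t using that by blast
  have "f \<in> BM T"
  proof -
    have "continuous_on {0<..<T} f" by (rule continuous_on_subset[OF assms]) auto
    then have "(\<lambda>x. indicator {0<..<T} x *\<^sub>R f x) \<in> borel_measurable borel"
      by (intro borel_measurable_continuous_on_indicator) auto
    from borel_measurable_lebesgue_onI[OF this, of "{0<..<T}"]
    show ?thesis by (rule measurable_cong[THEN iffD1, rotated]) auto
  qed
  then show ?thesis
    by (intro integrable_const_bound[where B = B] AE_I2) (auto intro: B)
qed

lemma pair_sigma_finite_Lo: "pair_sigma_finite (Lo s) (Lo t)"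
  using finite_measure_Lo[of s] finite_measure_Lo[of t]
  by (auto simp: pair_sigma_finite_def finite_measure_def)

text \<open>Integration by parts for the primitive of a function that is merely integrable;
  differentiation is replaced by Fubini on the triangle \<open>r < s < t\<close>.\<close>

lemma exp_mult_integral:
  fixes g :: "real \<Rightarrow> real"
  assumes g: "integrable (Lo t) g" and t: "0 \<le> t"
  shows "exp (c * t) * (LINT s|Lo t. g s)
    = (LINT s|Lo t. exp (c * s) * g s + c * exp (c * s) * (LINT r|Lo s. g r))"
proof -
  interpret M: finite_measure "Lo t" by (rule finite_measure_Lo)
  \<comment> \<open>Cut off outside the triangle, so that both iterated integrals run over the full
    interval. Integrating in \<open>s\<close> first gives the boundary term, integrating in
    \<open>r\<close> first gives the primitive of \<open>g\<close>.\<close>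
  define K where "K s r = (if r < s then c * exp (c * s) * g r else 0)" for s r :: real
  have [measurable]: "g \<in> BM t" using g by simp
  have Kr: "(LINT r|Lo t. K s r) = c * exp (c * s) * (LINT r|Lo s. g r)" if "s \<le> t" for s
    unfolding K_def integral_Lo_restrict[OF that, of g] LINT_cmult[symmetric]
    by (intro LINT_cong) auto
  have Ks: "(LINT s|Lo t. K s r) = (exp (c * t) - exp (c * r)) * g r" if r: "r \<in> {0<..<t}" for r
  proof -
    have "(LINT s|Lo t. K s r) = (LINT s|Lo t. indicator {r<..} s *\<^sub>R (c * exp (c * s))) * g r"
      unfolding K_def Bochner_Integration.integral_mult_left_zero[symmetric]
      by (intro LINT_cong) (auto simp: indicator_def)
    also have "(LINT s|Lo t. indicator {r<..} s *\<^sub>R (c * exp (c * s)))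
        = (LINT s|restrict_space (Lo t) {r<..}. c * exp (c * s))"
      by (rule integral_restrict_space[symmetric]) (auto simp: sets_restrict_space_iff)
    also have "restrict_space (Lo t) {r<..} = lebesgue_on {r<..<t}"
      using r by (subst restrict_restrict_space) (auto intro!: arg_cong[where f = lebesgue_on])
    finally show ?thesis using integral_exp(2)[of r t c] r by simp
  qed
  have meas: "case_prod K \<in> borel_measurable (Lo t \<Otimes>\<^sub>M Lo t)"
    unfolding K_def by measurable
  have "integrable (Lo t \<Otimes>\<^sub>M Lo t) (case_prod K)"
  proof (rule pair_sigma_finite.Fubini_integrable[OF pair_sigma_finite_Lo meas])
    have int: "integrable (Lo t) (\<lambda>r. K s r)" for s
      by (rule L1_bound[where f = "\<lambda>r. c * exp (c * s) * g r"])
         (use g in \<open>auto simp: K_def\<close>)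
    then show "AE s in Lo t. integrable (Lo t) (\<lambda>r. case (s, r) of (s, r) \<Rightarrow> K s r)" by simp
    have "norm (LINT r|Lo t. norm (K s r)) \<le> \<bar>c\<bar> * exp (\<bar>c\<bar> * t) * (LINT r|Lo t. \<bar>g r\<bar>)"
      if s: "s \<in> {0<..<t}" for s
    proof -
      have "c * s \<le> \<bar>c\<bar> * t"
        using s by (intro order_trans[OF mult_right_mono[of c "\<bar>c\<bar>" s]] mult_left_mono) auto
      then have "(LINT r|Lo t. norm (K s r)) \<le> (LINT r|Lo t. \<bar>c\<bar> * exp (\<bar>c\<bar> * t) * \<bar>g r\<bar>)"
        using g int[of s]
        by (intro integral_mono integrable_norm integrable_mult_right integrable_abs)
           (auto simp: K_def abs_mult intro!: mult_right_mono mult_left_mono)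
      then show ?thesis by simp
    qed
    then show "integrable (Lo t) (\<lambda>s. LINT r|Lo t. norm (case (s, r) of (s, r) \<Rightarrow> K s r))"
      using meas
      by (intro M.integrable_const_bound[where B = "\<bar>c\<bar> * exp (\<bar>c\<bar> * t) * (LINT r|Lo t. \<bar>g r\<bar>)"] AE_I2) auto
  qed
  then have "(LINT r|Lo t. LINT s|Lo t. K s r) = (LINT s|Lo t. LINT r|Lo t. K s r)"
    by (rule pair_sigma_finite.Fubini_integral[OF pair_sigma_finite_Lo])
  moreover have "(LINT r|Lo t. LINT s|Lo t. K s r) = (LINT r|Lo t. (exp (c * t) - exp (c * r)) * g r)"
    by (intro LINT_cong) (auto simp: Ks)
  moreover have "(LINT s|Lo t. LINT r|Lo t. K s r) = (LINT s|Lo t. c * exp (c * s) * (LINT r|Lo s. g r))"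
    by (intro LINT_cong) (auto simp: Kr)
  moreover have "(LINT r|Lo t. (exp (c * t) - exp (c * r)) * g r)
      = exp (c * t) * (LINT r|Lo t. g r) - (LINT r|Lo t. exp (c * r) * g r)"
    using g integrable_mult_exp[OF g, of c] by (simp add: left_diff_distrib)
  moreover have "integrable (Lo t) (\<lambda>s. c * exp (c * s) * (LINT r|Lo s. g r))"
    by (intro integrable_continuous_Lo continuous_intros continuous_on_integral_Lo g)
  ultimately show ?thesis
    using Bochner_Integration.integral_add[OF integrable_mult_exp[OF g, of c],
        of "\<lambda>s. c * exp (c * s) * (LINT r|Lo s. g r)"] by linarith
qed

lemma integrable_const_Lo [simp]: "integrable (Lo t) (\<lambda>s. c)"
  for c :: "'b::{banach, second_countable_topology}"
  by (rule finite_measure.integrable_const[OF finite_measure_Lo])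

text \<open>The Duhamel formula is \<open>exp (- a * s)\<close> times a primitive, and
  \<open>exp_mult_integral\<close> with rate \<open>- a\<close> is the product rule for it in
  integrated form.\<close>

lemma variation_of_constants:
  fixes f :: "real \<Rightarrow> real"
  assumes f: "integrable (Lo t) f" and t: "0 \<le> t"
    and u: "\<And>s. s \<in> {0..t} \<Longrightarrow> u s = exp (- a * s) * u0 + (LINT r|Lo s. exp (- a * (s - r)) * f r)"
  shows "u t = u0 + (LINT s|Lo t. f s - a * u s)"
proof -
  define G where "G s = (LINT r|Lo s. exp (a * r) * f r)" for s
  have g: "integrable (Lo t) (\<lambda>s. exp (a * s) * f s)" by (rule integrable_mult_exp[OF f])
  have uG: "u s = exp (- a * s) * u0 + exp (- a * s) * G s" if "s \<in> {0..t}" for s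
    unfolding u[OF that] G_def LINT_cmult[symmetric]
    by (intro arg_cong2[where f = "(+)"] refl LINT_cong)
       (simp_all add: exp_diff exp_minus right_diff_distrib field_simps)
  have "exp (- a * t) * G t = (LINT s|Lo t. exp (- a * s) * (exp (a * s) * f s) + - a * exp (- a * s) * G s)"
    unfolding G_def by (rule exp_mult_integral[OF g t])
  also have "\<dots> = (LINT s|Lo t. (f s - a * u s) + u0 * (a * exp (- a * s)))"
    by (intro LINT_cong) (auto simp: uG exp_minus algebra_simps)
  also have "\<dots> = (LINT s|Lo t. f s - a * u s) + (LINT s|Lo t. u0 * (a * exp (- a * s)))"
  proof (rule Bochner_Integration.integral_add)
    have "continuous_on {0..t} (\<lambda>s. exp (- a * s) * u0 + exp (- a * s) * G s)"
      unfolding G_def by (intro continuous_intros continuous_on_integral_Lo g)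
    then have "integrable (Lo t) (\<lambda>s. exp (- a * s) * u0 + exp (- a * s) * G s)"
      by (rule integrable_continuous_Lo)
    then have "integrable (Lo t) u"
      by (subst Bochner_Integration.integrable_cong[OF refl, of _ u]) (auto simp: uG)
    then show "integrable (Lo t) (\<lambda>s. f s - a * u s)" using f by simp
    show "integrable (Lo t) (\<lambda>s. u0 * (a * exp (- a * s)))"
      by (intro integrable_continuous_Lo continuous_intros)
  qed
  also have "(LINT s|Lo t. u0 * (a * exp (- a * s))) = u0 * (1 - exp (- a * t))"
    using integral_exp(2)[of 0 t "- a"] t by simp
  finally show ?thesis using uG[of t] t by (simp add: algebra_simps)
qed

text \<open>Uniqueness for the scalar linear equation: after multiplication by the integrating
  factor \<open>exp (a * t)\<close> the terms with \<open>u\<close> cancel under the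
  integral.\<close>

lemma variation_of_constants_converse:
  fixes f :: "real \<Rightarrow> real"
  assumes f: "integrable (Lo t) f" and u: "integrable (Lo t) u" and t: "0 \<le> t"
    and eq: "\<And>s. s \<in> {0..t} \<Longrightarrow> u s = u0 + (LINT r|Lo s. f r - a * u r)"
  shows "u t = exp (- a * t) * u0 + (LINT r|Lo t. exp (- a * (t - r)) * f r)"
proof -
  have w: "integrable (Lo t) (\<lambda>r. f r - a * u r)" using f u by simp
  have "exp (a * t) * (u t - u0)
      = (LINT s|Lo t. exp (a * s) * (f s - a * u s) + a * exp (a * s) * (LINT r|Lo s. f r - a * u r))"
    using exp_mult_integral[OF w t, of a] eq[of t] t by simp
  also have "\<dots> = (LINT s|Lo t. exp (a * s) * f s - u0 * (a * exp (a * s)))"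
  proof (intro LINT_cong refl)
    fix s assume "s \<in> space (Lo t)"
    then have "(LINT r|Lo s. f r - a * u r) = u s - u0" using eq[of s] by simp
    then show "exp (a * s) * (f s - a * u s) + a * exp (a * s) * (LINT r|Lo s. f r - a * u r)
        = exp (a * s) * f s - u0 * (a * exp (a * s))"
      by (simp only:) (simp add: algebra_simps)
  qed
  also have "\<dots> = (LINT s|Lo t. exp (a * s) * f s) - (LINT s|Lo t. u0 * (a * exp (a * s)))"
    by (intro Bochner_Integration.integral_diff integrable_mult_exp f integrable_continuous_Lo continuous_intros)
  also have "(LINT s|Lo t. u0 * (a * exp (a * s))) = u0 * (exp (a * t) - 1)"
    using integral_exp(2)[of 0 t a] t by simp
  finally have "exp (a * t) * u t = u0 + (LINT s|Lo t. exp (a * s) * f s)"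
    by (simp add: algebra_simps)
  then have "exp (- a * t) * (exp (a * t) * u t) = exp (- a * t) * u0 + exp (- a * t) * (LINT s|Lo t. exp (a * s) * f s)"
    by (simp only: distrib_left)
  also have "exp (- a * t) * (exp (a * t) * u t) = u t" by (simp add: exp_minus)
  also have "exp (- a * t) * (LINT s|Lo t. exp (a * s) * f s) = (LINT r|Lo t. exp (- a * (t - r)) * f r)"
    unfolding LINT_cmult[symmetric]
    by (intro LINT_cong refl)
       (simp add: exp_diff exp_minus right_diff_distrib field_simps)
  finally show ?thesis .
qed

section \<open>Scalar convolution estimates with exponential weights\<close>

lemma nn_Cauchy_Schwarz_weighted:
  fixes f k :: "'a \<Rightarrow> real"
  assumes [measurable]: "f \<in> borel_measurable M" "k \<in> borel_measurable M" and k: "\<And>x. 0 \<le> k x"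
  shows "(\<integral>\<^sup>+ x. ennreal (k x * \<bar>f x\<bar>) \<partial>M)^2
    \<le> (\<integral>\<^sup>+ x. ennreal (k x) \<partial>M) * (\<integral>\<^sup>+ x. ennreal (k x * (f x)^2) \<partial>M)"
proof -
  have 1: "ennreal (sqrt (k x)) * ennreal (sqrt (k x) * \<bar>f x\<bar>) = ennreal (k x * \<bar>f x\<bar>)"
    "(ennreal (sqrt (k x)))^2 = ennreal (k x)"
    "(ennreal (sqrt (k x) * \<bar>f x\<bar>))^2 = ennreal (k x * (f x)^2)" for x
    using k[of x] by (simp_all add: ennreal_mult[symmetric] ennreal_power power_mult_distrib flip: mult.assoc)
  show ?thesis
    using Cauchy_Schwarz_nn_integral[of "\<lambda>x. ennreal (sqrt (k x))" M "\<lambda>x. ennreal (sqrt (k x) * \<bar>f x\<bar>)"]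
    by (simp add: 1)
qed

text \<open>Integrability is not assumed: the Bochner integral of a function that is not integrable
  is 0.\<close>

lemma norm_integral_le_nn_integral:
  fixes f :: "'a \<Rightarrow> real"
  shows "ennreal \<bar>LINT x|M. f x\<bar> \<le> (\<integral>\<^sup>+ x. ennreal \<bar>f x\<bar> \<partial>M)"
proof (cases "integrable M f")
  case True
  then show ?thesis using integral_norm_bound_ennreal[of M f] by simp
qed (simp add: not_integrable_integral_eq)

text \<open>Cauchy-Schwarz with the weight \<open>exp (- b * (t - s))\<close>, whose total mass is
  at most \<open>1 / b\<close>; the remaining factor \<open>exp ((b - a) * (t - s))\<close> stays
  with \<open>f\<close>.\<close>

lemma convolution_sq_bound:
  fixes f :: "real \<Rightarrow> real"
  assumes [measurable]: "f \<in> BM t" and t: "0 \<le> t" and a: "0 < a"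
    and u: "u = (LINT s|Lo t. exp (- a * (t - s)) * f s)" and b: "0 < b"
  shows "ennreal (b * u^2) \<le> (\<integral>\<^sup>+ s. ennreal (exp ((b - 2 * a) * (t - s)) * (f s)^2) \<partial>Lo t)"
proof -
  have e1: "exp (- a * x) = exp (- b * x) * exp ((b - a) * x)" for x
    unfolding mult_exp_exp by (simp add: algebra_simps)
  have "exp (- b * x) * (exp ((b - a) * x))^2 = exp ((b - 2 * a) * x)" for x
    unfolding exp_double[symmetric] mult_exp_exp by (simp add: algebra_simps)
  then have e2: "exp (- b * x) * (exp ((b - a) * x) * y)^2 = exp ((b - 2 * a) * x) * y^2" for x y
    unfolding power_mult_distrib mult.assoc[symmetric] by simp
  have e3: "exp (- b * (t - s)) = exp (- b * t) * exp (b * s)" for s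
    unfolding mult_exp_exp by (simp add: algebra_simps)
  have "ennreal (u^2) = (ennreal \<bar>u\<bar>)^2" by (simp add: ennreal_power)
  also have "\<dots> \<le> (\<integral>\<^sup>+ s. ennreal \<bar>exp (- a * (t - s)) * f s\<bar> \<partial>Lo t)^2"
    unfolding u by (intro power_mono norm_integral_le_nn_integral) auto
  also have "\<dots> = (\<integral>\<^sup>+ s. ennreal (exp (- b * (t - s)) * \<bar>exp ((b - a) * (t - s)) * f s\<bar>) \<partial>Lo t)^2"
    by (intro arg_cong[where f = "\<lambda>x. x^2"] nn_integral_cong arg_cong[where f = ennreal])
       (simp only: e1 abs_mult abs_exp_cancel mult.assoc)
  also have "\<dots> \<le> (\<integral>\<^sup>+ s. ennreal (exp (- b * (t - s))) \<partial>Lo t)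
      * (\<integral>\<^sup>+ s. ennreal (exp (- b * (t - s)) * (exp ((b - a) * (t - s)) * f s)^2) \<partial>Lo t)"
    by (rule nn_Cauchy_Schwarz_weighted) auto
  also have "(\<integral>\<^sup>+ s. ennreal (exp (- b * (t - s)) * (exp ((b - a) * (t - s)) * f s)^2) \<partial>Lo t)
      = (\<integral>\<^sup>+ s. ennreal (exp ((b - 2 * a) * (t - s)) * (f s)^2) \<partial>Lo t)"
    by (simp only: e2)
  also have "(\<integral>\<^sup>+ s. ennreal (exp (- b * (t - s))) \<partial>Lo t)
      = (\<integral>\<^sup>+ s. ennreal (exp (- b * t)) * ennreal (exp (b * s)) \<partial>Lo t)"
    unfolding e3 by (simp add: ennreal_mult)
  also have "\<dots> = ennreal (exp (- b * t)) * ennreal ((exp (b * t) - 1) / b)"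
    using nn_integral_exp[of b 0 t] b t by (subst nn_integral_cmult) auto
  also have "\<dots> = ennreal ((1 - exp (- b * t)) / b)"
  proof -
    have "exp (- b * t) * ((exp (b * t) - 1) / b) = (1 - exp (- b * t)) / b"
      unfolding times_divide_eq_right right_diff_distrib mult_exp_exp by simp
    then show ?thesis using b t by (simp add: ennreal_mult[symmetric] del: times_divide_eq_right)
  qed
  also have "\<dots> \<le> ennreal (1 / b)"
    using b by (intro ennreal_leI divide_right_mono) auto
  finally have "ennreal (u^2) \<le> ennreal (1 / b) * (\<integral>\<^sup>+ s. ennreal (exp ((b - 2 * a) * (t - s)) * (f s)^2) \<partial>Lo t)"
    by (simp add: mult_right_mono)
  from mult_left_mono[OF this, of "ennreal b"]
  show ?thesis using b by (simp add: ennreal_mult[symmetric] mult.assoc[symmetric])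
qed

text \<open>Maximal regularity of a single mode. The pointwise bound with \<open>b = a\<close> and
  Fubini reduce it to \<open>a\<close> times the integral of
  \<open>exp ((\<beta> - a) * (s - r))\<close> over \<open>s > r\<close>, which is at most
  \<open>a / (a - \<beta>)\<close> and hence at most 2. Since 2 depends neither on \<open>a\<close>
  nor on \<open>\<beta>\<close>, the modes can be summed and \<open>\<beta>\<close> can be taken
  large.\<close>

lemma convolution_energy_bound:
  fixes f u :: "real \<Rightarrow> real"
  assumes f [measurable]: "f \<in> BM t" and t: "0 \<le> t" and a: "0 < a"
    and u: "\<And>s. s \<in> {0<..<t} \<Longrightarrow> u s = (LINT r|Lo s. exp (- a * (s - r)) * f r)"
    and \<beta>: "2 * \<beta> \<le> a"
  shows "(\<integral>\<^sup>+ s. ennreal (exp (\<beta> * s) * (a * u s)^2) \<partial>Lo t)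
    \<le> 2 * (\<integral>\<^sup>+ s. ennreal (exp (\<beta> * s) * (f s)^2) \<partial>Lo t)"
proof -
  define k where "k s r = (if r < s then ennreal (exp (\<beta> * s) * a * exp (- a * (s - r)) * (f r)^2) else 0)" for s r
  have [measurable]: "(\<lambda>(x, y). ennreal (exp (\<beta> * x) * a * exp (- a * (x - y)) * (f y)^2)) \<in> borel_measurable (Lo t \<Otimes>\<^sub>M Lo t)"
    by measurable
  have "ennreal (exp (\<beta> * s) * (a * u s)^2)
      \<le> (\<integral>\<^sup>+ r. k s r \<partial>Lo t)"
    if s: "s \<in> {0<..<t}" for s
  proof -
    have [measurable]: "f \<in> BM s"
      using measurable_Lo_mono[of s t f] s by simp
    have "ennreal (a * (u s)^2) \<le> (\<integral>\<^sup>+ r. ennreal (exp ((a - 2 * a) * (s - r)) * (f r)^2) \<partial>Lo s)"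
      using s a by (intro convolution_sq_bound u) auto
    then have "ennreal (exp (\<beta> * s) * a) * ennreal (a * (u s)^2)
        \<le> ennreal (exp (\<beta> * s) * a) * (\<integral>\<^sup>+ r. ennreal (exp ((a - 2 * a) * (s - r)) * (f r)^2) \<partial>Lo s)"
      by (rule mult_left_mono) simp
    also have "\<dots> = (\<integral>\<^sup>+ r. ennreal (exp (\<beta> * s) * a * exp (- a * (s - r)) * (f r)^2) \<partial>Lo s)"
      using a by (subst nn_integral_cmult[symmetric]) (auto simp: ennreal_mult[symmetric] mult.assoc)
    also have "\<dots> = (\<integral>\<^sup>+ r. k s r \<partial>Lo t)"
      unfolding k_def using s by (intro nn_integral_Lo_restrict) auto
    also have "ennreal (exp (\<beta> * s) * a) * ennreal (a * (u s)^2) = ennreal (exp (\<beta> * s) * (a * u s)^2)"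
      using a by (simp add: ennreal_mult[symmetric] power2_eq_square mult_ac)
    finally show ?thesis .
  qed
  then have "(\<integral>\<^sup>+ s. ennreal (exp (\<beta> * s) * (a * u s)^2) \<partial>Lo t)
      \<le> (\<integral>\<^sup>+ s. \<integral>\<^sup>+ r. k s r \<partial>Lo t \<partial>Lo t)"
    by (intro nn_integral_mono) auto
  also have "\<dots> = (\<integral>\<^sup>+ r. \<integral>\<^sup>+ s. k s r \<partial>Lo t \<partial>Lo t)"
    by (rule pair_sigma_finite.Fubini'[OF pair_sigma_finite_Lo, symmetric]) (unfold k_def, measurable)
  also have "\<dots> \<le> (\<integral>\<^sup>+ r. 2 * ennreal (exp (\<beta> * r) * (f r)^2) \<partial>Lo t)"
  proof (rule nn_integral_mono)
    fix r assume "r \<in> space (Lo t)"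
    then have r: "0 < r" "r < t" by auto
    have e: "exp (\<beta> * s) * a * exp (- a * (s - r)) * (f r)^2 = (a * exp (a * r) * (f r)^2) * exp ((\<beta> - a) * s)" for s
    proof -
      have "exp (\<beta> * s) * exp (- a * (s - r)) = exp (a * r) * exp ((\<beta> - a) * s)"
        unfolding mult_exp_exp by (simp add: algebra_simps)
      then show ?thesis by (simp add: mult_ac)
    qed
    have "(\<integral>\<^sup>+ s. k s r \<partial>Lo t)
        = (\<integral>\<^sup>+ s. ennreal (a * exp (a * r) * (f r)^2) * (if r < s then ennreal (exp ((\<beta> - a) * s)) else 0) \<partial>Lo t)"
      unfolding k_def e using a by (intro nn_integral_cong) (auto simp: ennreal_mult)
    also have "\<dots> = ennreal (a * exp (a * r) * (f r)^2) * (\<integral>\<^sup>+ s. (if r < s then ennreal (exp ((\<beta> - a) * s)) else 0) \<partial>Lo t)"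
      by (rule nn_integral_cmult) measurable
    also have "(\<integral>\<^sup>+ s. (if r < s then ennreal (exp ((\<beta> - a) * s)) else 0) \<partial>Lo t)
        = (\<integral>\<^sup>+ s. ennreal (exp ((\<beta> - a) * s)) * indicator {r<..} s \<partial>Lo t)"
      by (intro nn_integral_cong) (auto simp: indicator_def)
    also have "\<dots> = (\<integral>\<^sup>+ s. ennreal (exp ((\<beta> - a) * s)) \<partial>restrict_space (Lo t) {r<..})"
      by (rule nn_integral_restrict_space[symmetric]) (auto simp: sets_restrict_space_iff)
    also have "restrict_space (Lo t) {r<..} = lebesgue_on {r<..<t}"
      using r by (subst restrict_restrict_space) (auto intro!: arg_cong[where f = lebesgue_on])
    also have "(\<integral>\<^sup>+ s. ennreal (exp ((\<beta> - a) * s)) \<partial>lebesgue_on {r<..<t})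
        = ennreal ((exp ((\<beta> - a) * t) - exp ((\<beta> - a) * r)) / (\<beta> - a))"
      using r \<beta> a by (intro nn_integral_exp) auto
    also have "(exp ((\<beta> - a) * t) - exp ((\<beta> - a) * r)) / (\<beta> - a) \<le> 2 / a * exp ((\<beta> - a) * r)"
    proof -
      have "(exp ((\<beta> - a) * t) - exp ((\<beta> - a) * r)) / (\<beta> - a) = (exp ((\<beta> - a) * r) - exp ((\<beta> - a) * t)) / (a - \<beta>)"
        using minus_divide_divide[of "exp ((\<beta> - a) * r) - exp ((\<beta> - a) * t)" "a - \<beta>"] by simp
      also have "\<dots> \<le> exp ((\<beta> - a) * r) / (a / 2)"
        using \<beta> a by (intro frac_le) auto
      finally show ?thesis by (simp add: mult.commute)
    qed
    also have "ennreal (a * exp (a * r) * (f r)^2) * ennreal (2 / a * exp ((\<beta> - a) * r))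
        = 2 * ennreal (exp (\<beta> * r) * (f r)^2)"
    proof -
      have "(a * exp (a * r) * (f r)^2) * (2 / a * exp ((\<beta> - a) * r)) = 2 * ((exp (a * r) * exp ((\<beta> - a) * r)) * (f r)^2)"
        using a by simp
      also have "exp (a * r) * exp ((\<beta> - a) * r) = exp (\<beta> * r)"
        unfolding mult_exp_exp by (simp add: algebra_simps)
      finally have "ennreal ((a * exp (a * r) * (f r)^2) * (2 / a * exp ((\<beta> - a) * r))) = ennreal (2 * (exp (\<beta> * r) * (f r)^2))"
        by (rule arg_cong)
      then show ?thesis using a by (simp add: ennreal_mult del: times_divide_eq_left times_divide_eq_right)
    qed
    finally show "(\<integral>\<^sup>+ s. k s r \<partial>Lo t)
        \<le> 2 * ennreal (exp (\<beta> * r) * (f r)^2)"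
      by (simp add: ennreal_leI mult_left_mono)
  qed
  also have "\<dots> = 2 * (\<integral>\<^sup>+ s. ennreal (exp (\<beta> * s) * (f s)^2) \<partial>Lo t)"
    by (rule nn_integral_cmult) measurable
  finally show ?thesis .
qed

section \<open>The operator and its eigenfunctions\<close>

context state_operator begin

abbreviation "DA \<equiv> domA \<iota> A"

abbreviation "Aop \<equiv> opA \<iota> A"

abbreviation "NDA \<equiv> normDA \<iota> A"

definition evl :: "nat \<Rightarrow> real" where "evl i = \<alpha> (Suc i)"

definition ef :: "nat \<Rightarrow> 'h" where "ef i = \<iota> (e (Suc i))"

definition cf :: "nat \<Rightarrow> 'v \<Rightarrow> real" where "cf i v = \<iota> v \<bullet> ef i"

abbreviation decay :: "real \<Rightarrow> real" where "decay t \<equiv> exp (- (evl 0 / 2) * t)"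

text \<open>Chosen so that \<open>wsq \<beta> f t \<le> r^2 * grow \<beta> t\<close>, multiplied by
  \<open>exp (- \<beta> * t)\<close>, says that the integral of
  \<open>exp (- \<beta> * (t - s)) * (norm (f s))^2\<close> is at most
  \<open>r^2 * exp (- evl 0 * t)\<close>.\<close>

abbreviation grow :: "real \<Rightarrow> real \<Rightarrow> real" where "grow \<beta> t \<equiv> exp ((\<beta> - evl 0) * t)"

lemma evl_ge: "evl 0 \<le> evl i"
  unfolding evl_def by (rule mono_onD[OF eigenvalues_mono]) auto

lemma evl_pos [simp]: "0 < evl i"
  using evl_ge[of i] eigenvalues_pos by (simp add: evl_def)

lemma evl_nonneg [simp]: "0 \<le> evl i" by (rule less_imp_le[OF evl_pos])

lemma evl_neq_0 [simp]: "evl i \<noteq> 0" using evl_pos[of i] by linarith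

lemma orthogonal_range_zero: "(\<And>v. h \<bullet> \<iota> v = 0) \<Longrightarrow> h = 0"
proof -
  assume h: "\<And>v. h \<bullet> \<iota> v = 0"
  have "closed {x. h \<bullet> x = 0}" by (intro closed_Collect_eq continuous_intros)
  then have "closure (range (blinfun_apply \<iota>)) \<subseteq> {x. h \<bullet> x = 0}"
    using h by (intro closure_minimal) auto
  then have "h \<bullet> h = 0" using incl_dense by blast
  then show "h = 0" by simp
qed

lemma A_eq_pivot_iff: "A u = pivot \<iota> h \<longleftrightarrow> (\<forall>v. u \<bullet> v = h \<bullet> \<iota> v)"
proof
  assume *: "A u = pivot \<iota> h"
  show "\<forall>v. u \<bullet> v = h \<bullet> \<iota> v"
    unfolding A_inner[symmetric] * by (simp add: pivot_def)
next
  assume *: "\<forall>v. u \<bullet> v = h \<bullet> \<iota> v"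
  show "A u = pivot \<iota> h"
    by (rule blinfun_eqI) (simp add: A_inner pivot_def *)
qed

lemma opA_eqI:
  assumes "\<And>v. u \<bullet> v = h \<bullet> \<iota> v"
  shows "u \<in> DA" "Aop u = h"
proof -
  have *: "A u = pivot \<iota> h" using assms by (simp add: A_eq_pivot_iff)
  then show "u \<in> DA" by (auto simp: domA_def)
  show "Aop u = h"
    unfolding opA_def
  proof (rule the_equality)
    show "A u = pivot \<iota> h" by (rule *)
    fix h' assume "A u = pivot \<iota> h'"
    then have "(h' - h) \<bullet> \<iota> v = 0" for v
      using assms by (simp add: A_eq_pivot_iff inner_diff_left)
    then show "h' = h" using orthogonal_range_zero[of "h' - h"] by simp
  qed
qed

lemma inner_opA:
  assumes "u \<in> DA" shows "Aop u \<bullet> \<iota> v = u \<bullet> v"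
proof -
  from assms obtain h where "A u = pivot \<iota> h" by (auto simp: domA_def)
  then have *: "\<And>v. u \<bullet> v = h \<bullet> \<iota> v" by (simp add: A_eq_pivot_iff)
  show ?thesis using opA_eqI(2)[OF *] *[of v] by simp
qed

lemma domA_scaleR:
  assumes "u \<in> DA"
  shows "c *\<^sub>R u \<in> DA" "Aop (c *\<^sub>R u) = c *\<^sub>R Aop u"
proof -
  have "(c *\<^sub>R u) \<bullet> x = (c *\<^sub>R Aop u) \<bullet> \<iota> x" for x
    using assms by (simp add: inner_opA)
  from opA_eqI[OF this] show "c *\<^sub>R u \<in> DA" "Aop (c *\<^sub>R u) = c *\<^sub>R Aop u" .
qed

lemma domA_add:
  assumes "u \<in> DA" "v \<in> DA"
  shows "u + v \<in> DA" "Aop (u + v) = Aop u + Aop v"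
proof -
  have "(u + v) \<bullet> x = (Aop u + Aop v) \<bullet> \<iota> x" for x
    using assms by (simp add: inner_opA inner_add_left)
  from opA_eqI[OF this] show "u + v \<in> DA" "Aop (u + v) = Aop u + Aop v" .
qed

lemma domA_diff:
  assumes "u \<in> DA" "v \<in> DA"
  shows "u - v \<in> DA" "Aop (u - v) = Aop u - Aop v"
  using domA_add[OF assms(1) domA_scaleR(1)[OF assms(2), of "-1"]] domA_scaleR(2)[OF assms(2), of "-1"]
  by simp_all

lemma domA_0 [simp]: "0 \<in> DA" "Aop 0 = 0"
  using opA_eqI[of 0 0] by auto

lemma e_domA: "e (Suc i) \<in> DA" "Aop (e (Suc i)) = evl i *\<^sub>R ef i"
  using eigenfunctions[of "Suc i"] by (auto simp: evl_def ef_def)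

lemma inner_ef: "ef i \<bullet> ef j = (if i = j then 1 else 0)"
  unfolding ef_def using orthonormal[of "Suc i" "Suc j"] by simp

lemma inner_e: "v \<bullet> e (Suc i) = evl i * cf i v"
  using inner_opA[OF e_domA(1)[of i], of v] by (simp add: e_domA(2) cf_def inner_commute)

sublocale H: hilbert_basis ef
proof
    show "ef i \<bullet> ef j = (if i = j then 1 else 0)" for i j by (rule inner_ef)
    fix x assume x: "\<And>i. x \<bullet> ef i = 0"
    have "span ((\<lambda>i. \<iota> (e i)) ` {1..}) \<subseteq> {y. x \<bullet> y = 0}"
    proof (rule span_minimal)
      show "(\<lambda>i. \<iota> (e i)) ` {1..} \<subseteq> {y. x \<bullet> y = 0}"
      proof clarsimp
        fix i :: nat assume "Suc 0 \<le> i"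
        then show "x \<bullet> \<iota> (e i) = 0" using x[of "i - 1"] by (simp add: ef_def)
      qed
      show "subspace {y. x \<bullet> y = 0}" by (auto simp: subspace_def inner_add_right)
    qed
    then have "closure (span ((\<lambda>i. \<iota> (e i)) ` {1..})) \<subseteq> {y. x \<bullet> y = 0}"
      by (intro closure_minimal closed_Collect_eq continuous_intros)
    then have "x \<bullet> x = 0" using complete_basis by blast
    then show "x = 0" by simp
qed

text \<open>The eigenfunctions are also orthogonal in \<open>V\<close>, where
  \<open>e (Suc i)\<close> has norm \<open>sqrt (evl i)\<close>.\<close>

definition eb :: "nat \<Rightarrow> 'v" where "eb i = (1 / sqrt (evl i)) *\<^sub>R e (Suc i)"

lemma inner_eb: "v \<bullet> eb i = sqrt (evl i) * cf i v"
proof -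
  have "v \<bullet> eb i = (evl i / sqrt (evl i)) * cf i v" by (simp add: eb_def inner_e)
  also have "evl i / sqrt (evl i) = sqrt (evl i)" by (simp add: real_div_sqrt)
  finally show ?thesis .
qed

lemma cf_e: "cf j (e (Suc i)) = (if i = j then 1 else 0)"
  by (simp add: cf_def ef_def[symmetric] inner_ef)

lemma cf_ext: "(\<And>i. cf i u = cf i v) \<Longrightarrow> u = v"
  using H.ext_b[of "\<iota> u" "\<iota> v"] incl_inj by (auto simp: cf_def inj_def)

lemma cf_linear [simp]:
  "cf i (u + v) = cf i u + cf i v" "cf i (u - v) = cf i u - cf i v"
  "cf i (c *\<^sub>R u) = c * cf i u" "cf i 0 = 0"
  by (simp_all add: cf_def blinfun.add_right blinfun.diff_right blinfun.scaleR_right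
      inner_add_left inner_diff_left blinfun.zero_right)

sublocale V: hilbert_basis eb
proof
    show "eb i \<bullet> eb j = (if i = j then 1 else 0)" for i j
      unfolding inner_eb by (simp add: eb_def cf_e)
    fix x assume x: "\<And>i. x \<bullet> eb i = 0"
    have "cf i x = cf i 0" for i using x[of i] evl_pos[of i] by (simp add: inner_eb)
    then show "x = 0" by (rule cf_ext)
qed

lemma norm_V_sums: "(\<lambda>i. evl i * (cf i v)^2) sums (norm v)^2"
  using V.parseval[of v] by (simp add: inner_eb power_mult_distrib)

lemma norm_V_suminf: "(\<Sum>i. ennreal (evl i * (cf i v)^2)) = ennreal ((norm v)^2)"
  using norm_V_sums by (intro suminf_ennreal_eq) auto

lemma ex_cf:
  assumes "summable (\<lambda>i. evl i * (c i)^2)"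
  shows "\<exists>v. \<forall>i. cf i v = c i"
proof -
  have "summable (\<lambda>i. (sqrt (evl i) * c i)^2)" using assms by (simp add: power_mult_distrib)
  from V.ex_coeffs[OF this] obtain v where v: "\<forall>i. v \<bullet> eb i = sqrt (evl i) * c i" ..
  have "cf i v = c i" for i using v[rule_format, of i] evl_pos[of i] by (simp add: inner_eb)
  then show ?thesis by blast
qed

lemma opA_coeff: "u \<in> DA \<Longrightarrow> Aop u \<bullet> ef i = evl i * cf i u"
  using inner_opA[of u "e (Suc i)"] inner_e[of u i] by (simp add: ef_def)

lemma ex_opA: "\<exists>u\<in>DA. Aop u = h"
proof -
  obtain B where "A o\<^sub>L B = id_blinfun" using A_iso by blast
  then have "A (B (pivot \<iota> h)) = pivot \<iota> h" by (metis blinfun_apply_blinfun_compose id_blinfun.rep_eq)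
  then show ?thesis using opA_eqI[of "B (pivot \<iota> h)" h] by (auto simp: A_eq_pivot_iff)
qed

text \<open>For the converse, Riesz-Fischer supplies a candidate for \<open>A v\<close> in
  \<open>H\<close>; \<open>A\<close> is onto, and the preimage of the candidate has the same
  coefficients as \<open>v\<close>.\<close>

lemma domA_iff: "v \<in> DA \<longleftrightarrow> summable (\<lambda>i. (evl i * cf i v)^2)"
proof
  assume "v \<in> DA"
  then show "summable (\<lambda>i. (evl i * cf i v)^2)"
    using H.summable_coeffs[of "Aop v"] by (simp add: opA_coeff)
next
  assume "summable (\<lambda>i. (evl i * cf i v)^2)"
  from H.ex_coeffs[OF this] obtain h where h: "\<forall>i. h \<bullet> ef i = evl i * cf i v" ..
  obtain u where u: "u \<in> DA" "Aop u = h" using ex_opA by blast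
  have "cf i u = cf i v" for i
    using opA_coeff[OF u(1), of i] h u(2) evl_pos[of i] by simp
  then show "v \<in> DA" using cf_ext u(1) by metis
qed

lemma norm_opA_suminf: "u \<in> DA \<Longrightarrow> (\<Sum>i. ennreal ((evl i * cf i u)^2)) = ennreal ((norm (Aop u))^2)"
  using H.ennreal_parseval[of "Aop u"] by (simp add: opA_coeff)

lemma domA_iff_ennreal: "v \<in> DA \<longleftrightarrow> (\<Sum>i. ennreal ((evl i * cf i v)^2)) < top"
  unfolding domA_iff less_top[symmetric]
proof
  assume "summable (\<lambda>i. (evl i * cf i v)^2)"
  then show "(\<Sum>i. ennreal ((evl i * cf i v)^2)) \<noteq> top" by (rule ennreal_suminf_neq_top) simp
next
  assume "(\<Sum>i. ennreal ((evl i * cf i v)^2)) \<noteq> top"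
  then show "summable (\<lambda>i. (evl i * cf i v)^2)" by (rule summable_suminf_not_top[rotated]) simp
qed

lemma continuous_cf: "continuous_on UNIV (cf i)"
  unfolding cf_def by (intro continuous_intros)

lemma measurable_cf [measurable]: "cf i \<in> borel_measurable borel"
  by (rule borel_measurable_continuous_onI[OF continuous_cf])

lemma sets_domA [measurable]: "DA \<in> sets borel"
proof -
  have "{v \<in> space borel. (\<Sum>i. ennreal ((evl i * cf i v)^2)) < top} \<in> sets borel" by measurable
  then show ?thesis by (simp add: domA_iff_ennreal[symmetric])
qed

text \<open>\<open>Aop\<close> is not continuous in the norm of \<open>V\<close>, but on its domain
  it is the pointwise limit of continuous maps of finite rank. Off the domain no \<open>h\<close>
  satisfies the description, so its value there is one fixed vector.\<close>

lemma measurable_opA [measurable]: "Aop \<in> borel_measurable borel"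
proof -
  have "Aop v = (if v \<in> DA then lim (\<lambda>n. \<Sum>i<n. (evl i * cf i v) *\<^sub>R ef i) else (THE h. False))" for v
  proof (cases "v \<in> DA")
    case True
    have "(\<lambda>i. (evl i * cf i v) *\<^sub>R ef i) sums Aop v"
      using H.expansion_b[of "Aop v"] by (simp add: opA_coeff[OF True])
    then show ?thesis using True by (simp add: sums_def limI)
  next
    case False
    then have "(\<lambda>h. A v = pivot \<iota> h) = (\<lambda>h. False)" by (auto simp: domA_def)
    then show ?thesis using False by (simp add: opA_def)
  qed
  then have "Aop = (\<lambda>v. if v \<in> DA then lim (\<lambda>n. \<Sum>i<n. (evl i * cf i v) *\<^sub>R ef i) else (THE h. False))"
    by blast
  also have "\<dots> \<in> borel_measurable borel" by measurable
  finally show ?thesis .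
qed

lemma norm_incl: "norm (\<iota> v) \<le> norm \<iota> * norm v"
  by (rule norm_blinfun)

lemma norm_le_normDA:
  assumes "u \<in> DA" shows "norm u \<le> norm \<iota> * NDA u"
proof (cases "u = 0")
  case False
  have "norm u * norm u = Aop u \<bullet> \<iota> u"
    using inner_opA[OF assms, of u] by (simp add: dot_square_norm power2_eq_square)
  also have "\<dots> \<le> norm (Aop u) * (norm \<iota> * norm u)"
    by (intro order_trans[OF norm_cauchy_schwarz] mult_left_mono norm_incl) auto
  finally show ?thesis using False by (simp add: normDA_def mult_ac)
qed (simp add: normDA_def)

definition invA :: "'h \<Rightarrow> 'v" where "invA h = (SOME u. u \<in> DA \<and> Aop u = h)"

lemma invA: "invA h \<in> DA" "Aop (invA h) = h"
  using someI_ex[of "\<lambda>u. u \<in> DA \<and> Aop u = h"] ex_opA[of h] by (auto simp: invA_def)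

lemma opA_inj: "u \<in> DA \<Longrightarrow> v \<in> DA \<Longrightarrow> Aop u = Aop v \<Longrightarrow> u = v"
  using norm_le_normDA[of "u - v"] by (simp add: domA_diff normDA_def)

lemma invA_opA: "u \<in> DA \<Longrightarrow> invA (Aop u) = u"
  using opA_inj invA by blast

text \<open>This is the closedness of \<open>A\<close>: convergence of \<open>A u\<close> in
  \<open>H\<close> forces convergence of \<open>u\<close> in \<open>V\<close>, with the limit in the
  domain.\<close>

lemma bounded_linear_invA: "bounded_linear invA"
proof (rule bounded_linear_intro[where K = "norm \<iota>"])
  show "invA (x + y) = invA x + invA y" for x y
    by (rule opA_inj) (simp_all add: invA domA_add domA_scaleR)
  show "invA (r *\<^sub>R x) = r *\<^sub>R invA x" for r x
    by (rule opA_inj) (simp_all add: invA domA_add domA_scaleR)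
  show "norm (invA x) \<le> norm x * norm \<iota>" for x
    using norm_le_normDA[OF invA(1)[of x]] by (simp add: normDA_def invA mult.commute)
qed

end

section \<open>The linear equation\<close>

lemma L2_on_iff_nn:
  "L2_on T f \<longleftrightarrow> f \<in> BM T \<and> (\<integral>\<^sup>+ s. ennreal ((norm (f s))^2) \<partial>Lo T) < \<infinity>"
  unfolding L2_on_def by (auto simp: integrable_iff_bounded)

lemma L2_on_mono: "s \<le> t \<Longrightarrow> L2_on t f \<Longrightarrow> L2_on s f"
  unfolding L2_on_iff_nn
  using measurable_Lo_mono[of s t f] le_less_trans[OF nn_integral_Lo_mono[of s t]] by blast

lemma L2_on_integrable:
  fixes f :: "real \<Rightarrow> 'h::{banach, second_countable_topology}"
  assumes "L2_on T f" shows "integrable (Lo T) f"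
proof (rule L1_bound)
  show "integrable (Lo T) (\<lambda>s. 1 + (norm (f s))^2)"
    using assms by (simp add: L2_on_def)
  show "f \<in> BM T" using assms by (simp add: L2_on_def)
  have "x \<le> 1 + x^2" for x :: real
    using zero_le_power2[of "x - 1/2"] by (simp add: power2_eq_square algebra_simps)
  then show "AE s in Lo T. norm (f s) \<le> norm (1 + (norm (f s))^2)" by simp
qed

lemma norm_add_sq_le: "(norm (x + y))^2 \<le> 2 * (norm x)^2 + 2 * (norm y)^2"
  for x y :: "'a::real_normed_vector"
proof -
  have "(norm (x + y))^2 \<le> (norm x + norm y)^2" by (intro power_mono norm_triangle_ineq) simp
  also have "\<dots> \<le> 2 * (norm x)^2 + 2 * (norm y)^2"
    using zero_le_power2[of "norm x - norm y"] by (simp add: power2_eq_square algebra_simps)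
  finally show ?thesis .
qed

lemma norm_diff_sq_le: "(norm (x - y))^2 \<le> 2 * (norm x)^2 + 2 * (norm y)^2"
  for x y :: "'a::real_normed_vector"
  using norm_add_sq_le[of x "- y"] by simp

lemma nn_integral_sq_le:
  fixes f g h :: "'a \<Rightarrow> 'b::{real_normed_vector, second_countable_topology}"
  assumes [measurable]: "g \<in> borel_measurable M" "h \<in> borel_measurable M" "k \<in> borel_measurable M"
    and k: "\<And>x. 0 \<le> k x"
    and le: "AE x in M. (norm (f x))^2 \<le> 2 * (norm (g x))^2 + 2 * (norm (h x))^2"
  shows "(\<integral>\<^sup>+ x. ennreal (k x * (norm (f x))^2) \<partial>M)
    \<le> 2 * (\<integral>\<^sup>+ x. ennreal (k x * (norm (g x))^2) \<partial>M) + 2 * (\<integral>\<^sup>+ x. ennreal (k x * (norm (h x))^2) \<partial>M)"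
proof -
  have "(\<integral>\<^sup>+ x. ennreal (k x * (norm (f x))^2) \<partial>M)
      \<le> (\<integral>\<^sup>+ x. 2 * ennreal (k x * (norm (g x))^2) + 2 * ennreal (k x * (norm (h x))^2) \<partial>M)"
  proof (rule nn_integral_mono_AE, use le in eventually_elim)
    fix x assume "(norm (f x))^2 \<le> 2 * (norm (g x))^2 + 2 * (norm (h x))^2"
    from mult_left_mono[OF this k[of x]]
    have "ennreal (k x * (norm (f x))^2) \<le> ennreal (2 * (k x * (norm (g x))^2) + 2 * (k x * (norm (h x))^2))"
      by (intro ennreal_leI) (simp add: algebra_simps)
    also have "\<dots> = 2 * ennreal (k x * (norm (g x))^2) + 2 * ennreal (k x * (norm (h x))^2)"
      using k[of x] by (subst ennreal_plus) (auto simp: ennreal_mult)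
    finally show "ennreal (k x * (norm (f x))^2)
      \<le> 2 * ennreal (k x * (norm (g x))^2) + 2 * ennreal (k x * (norm (h x))^2)" .
  qed
  also have "\<dots> = 2 * (\<integral>\<^sup>+ x. ennreal (k x * (norm (g x))^2) \<partial>M) + 2 * (\<integral>\<^sup>+ x. ennreal (k x * (norm (h x))^2) \<partial>M)"
    by (subst nn_integral_add) (auto simp: nn_integral_cmult)
  finally show ?thesis .
qed

lemma L2_on_diff:
  fixes f g :: "real \<Rightarrow> 'h::{real_normed_vector, second_countable_topology}"
  assumes f: "L2_on T f" and g: "L2_on T g"
  shows "L2_on T (\<lambda>s. f s - g s)"
proof -
  have [measurable]: "f \<in> BM T" "g \<in> BM T"
    using f g by (auto simp: L2_on_def)
  have "(\<integral>\<^sup>+ x. ennreal (1 * (norm (f x - g x))^2) \<partial>Lo T)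
      \<le> 2 * (\<integral>\<^sup>+ x. ennreal (1 * (norm (f x))^2) \<partial>Lo T) + 2 * (\<integral>\<^sup>+ x. ennreal (1 * (norm (g x))^2) \<partial>Lo T)"
    by (rule nn_integral_sq_le) (auto simp: norm_diff_sq_le)
  also have "\<dots> < \<infinity>" using f g by (auto simp: L2_on_iff_nn ennreal_mult_less_top)
  finally show ?thesis by (simp add: L2_on_iff_nn)
qed

lemma L2_on_add:
  fixes f g :: "real \<Rightarrow> 'h::{real_normed_vector, second_countable_topology}"
  assumes f: "L2_on T f" and g: "L2_on T g"
  shows "L2_on T (\<lambda>s. f s + g s)"
proof -
  have "L2_on T (\<lambda>s. - g s)" using g by (simp add: L2_on_def)
  from L2_on_diff[OF f this] show ?thesis by simp
qed

section \<open>Energy estimates, mode by mode\<close>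

context state_operator begin

text \<open>Weierstrass test in \<open>V\<close>: the partial sums of the expansion are continuous,
  and the tail of the summable majorant bounds their distance to \<open>y\<close> uniformly in
  time.\<close>

lemma continuous_V_by_coeffs:
  fixes y :: "real \<Rightarrow> 'v"
  assumes c: "\<And>i. continuous_on {0..T} (\<lambda>t. cf i (y t))"
    and B: "\<And>i t. t \<in> {0..T} \<Longrightarrow> evl i * (cf i (y t))^2 \<le> B i" and sB: "summable B"
  shows "continuous_on {0..T} y"
proof (cases "T \<ge> 0")
  case True
  define yn where "yn n t = (\<Sum>i<n. cf i (y t) *\<^sub>R e (Suc i))" for n t
  have cfyn: "cf i (yn n t) = (if i < n then cf i (y t) else 0)" for i n t
  proof -
    have "cf i (yn n t) = (\<Sum>j<n. cf j (y t) * cf i (e (Suc j)))"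
      unfolding yn_def by (induction n) auto
    then show ?thesis by (simp add: cf_e if_distrib cong: if_cong)
  qed
  have tail: "(norm (yn n t - y t))^2 \<le> suminf B - (\<Sum>i<n. B i)" if t: "t \<in> {0..T}" for n t
  proof -
    have "(\<lambda>i. if i < n then B i else 0) sums (\<Sum>i<n. B i)"
      using sums_If_finite_set[of "{..<n}" B] by simp
    from sums_diff[OF summable_sums[OF sB] this]
    have "(\<lambda>i. B i - (if i < n then B i else 0)) sums (suminf B - (\<Sum>i<n. B i))" .
    from sums_le[OF _ norm_V_sums[of "yn n t - y t"] this]
    show ?thesis using B[OF t] by (simp add: cfyn)
  qed
  have "uniform_limit {0..T} yn y sequentially"
  proof (rule uniform_limitI)
    fix \<epsilon> :: real assume "\<epsilon> > 0"
    have "(\<lambda>n. suminf B - (\<Sum>i<n. B i)) \<longlonglongrightarrow> suminf B - suminf B"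
      by (intro tendsto_intros summable_LIMSEQ sB)
    then have "\<forall>\<^sub>F n in sequentially. suminf B - (\<Sum>i<n. B i) < \<epsilon>^2"
      using \<open>\<epsilon> > 0\<close> by (intro order_tendstoD(2)) auto
    then show "\<forall>\<^sub>F n in sequentially. \<forall>t\<in>{0..T}. dist (yn n t) (y t) < \<epsilon>"
    proof eventually_elim
      case (elim n)
      show ?case
      proof
        fix t assume "t \<in> {0..T}"
        from tail[OF this, of n] elim have "(norm (yn n t - y t))^2 < \<epsilon>^2" by linarith
        then show "dist (yn n t) (y t) < \<epsilon>"
          using \<open>\<epsilon> > 0\<close> by (simp add: dist_norm power_less_imp_less_base)
      qed
    qed
  qed
  moreover have "\<forall>\<^sub>F n in sequentially. continuous_on {0..T} (yn n)"
    unfolding yn_def by (intro always_eventually allI continuous_intros c)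
  ultimately show ?thesis
    by (intro uniform_limit_theorem[where F = sequentially and f = yn]) auto
next
  case False
  then have "{0..T} = {}" by simp
  then show ?thesis by simp
qed

abbreviation duhamel :: "nat \<Rightarrow> (real \<Rightarrow> 'h) \<Rightarrow> real \<Rightarrow> real" where
  "duhamel i f t \<equiv> LINT s|Lo t. exp (- evl i * (t - s)) * (f s \<bullet> ef i)"

abbreviation msq :: "real \<Rightarrow> (real \<Rightarrow> real) \<Rightarrow> real \<Rightarrow> ennreal" where
  "msq \<beta> f t \<equiv> \<integral>\<^sup>+ s. ennreal (exp (\<beta> * s)) * ennreal ((f s)^2) \<partial>Lo t"

text \<open>Each mode obeys \<open>convolution_sq_bound\<close> with \<open>b = evl i\<close>, and
  \<open>exp (\<beta> * t) * exp (- evl i * (t - s)) \<le> exp (\<beta> * s)\<close> because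
  \<open>\<beta> \<le> evl i\<close>. A mode without forcing is zero, so its eigenvalue may be
  arbitrarily small compared with \<open>\<beta>\<close>.\<close>

lemma energy_bound_V:
  assumes [measurable]: "f \<in> BM t" and t: "0 \<le> t"
    and d: "\<And>i. cf i d = duhamel i f t"
    and \<beta>: "\<And>i. 2 * \<beta> \<le> evl i \<or> (\<forall>s. f s \<bullet> ef i = 0)"
  shows "ennreal (exp (\<beta> * t) * (norm d)^2) \<le> wsq \<beta> f t"
proof -
  have mode: "ennreal (exp (\<beta> * t)) * ennreal (evl i * (cf i d)^2)
      \<le> msq \<beta> (\<lambda>s. f s \<bullet> ef i) t" for i
  proof (cases "\<forall>s. f s \<bullet> ef i = 0")
    case True
    then show ?thesis using d[of i] by simp
  next
    case False
    then have \<beta>i: "2 * \<beta> \<le> evl i" using \<beta> by blast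
    have "ennreal (evl i * (cf i d)^2)
        \<le> (\<integral>\<^sup>+ s. ennreal (exp ((evl i - 2 * evl i) * (t - s)) * (f s \<bullet> ef i)^2) \<partial>Lo t)"
      by (rule convolution_sq_bound[OF _ t evl_pos d]) auto
    then have "ennreal (exp (\<beta> * t)) * ennreal (evl i * (cf i d)^2)
        \<le> ennreal (exp (\<beta> * t)) * (\<integral>\<^sup>+ s. ennreal (exp ((evl i - 2 * evl i) * (t - s)) * (f s \<bullet> ef i)^2) \<partial>Lo t)"
      by (rule mult_left_mono) simp
    also have "\<dots> = (\<integral>\<^sup>+ s. ennreal (exp (\<beta> * t)) * ennreal (exp ((evl i - 2 * evl i) * (t - s)) * (f s \<bullet> ef i)^2) \<partial>Lo t)"
      by (rule nn_integral_cmult[symmetric]) measurable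
    also have "\<dots> \<le> msq \<beta> (\<lambda>s. f s \<bullet> ef i) t"
    proof (rule nn_integral_mono)
      fix s assume "s \<in> space (Lo t)"
      then have s: "0 < s" "s < t" by auto
      have "(\<beta> - evl i) * (t - s) \<le> 0"
        using \<beta>i s less_imp_le[OF evl_pos[of i]] by (intro mult_nonpos_nonneg; linarith)
      then have "exp (\<beta> * t) * exp ((evl i - 2 * evl i) * (t - s)) \<le> exp (\<beta> * s)"
        unfolding mult_exp_exp by (simp add: algebra_simps)
      then have "exp (\<beta> * t) * exp ((evl i - 2 * evl i) * (t - s)) * (f s \<bullet> ef i)^2 \<le> exp (\<beta> * s) * (f s \<bullet> ef i)^2"
        by (rule mult_right_mono) simp
      then show "ennreal (exp (\<beta> * t)) * ennreal (exp ((evl i - 2 * evl i) * (t - s)) * (f s \<bullet> ef i)^2)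
          \<le> ennreal (exp (\<beta> * s)) * ennreal ((f s \<bullet> ef i)^2)"
        by (simp add: ennreal_mult[symmetric] mult.assoc ennreal_leI)
    qed
    finally show ?thesis .
  qed
  have "ennreal (exp (\<beta> * t) * (norm d)^2) = (\<Sum>i. ennreal (exp (\<beta> * t)) * ennreal (evl i * (cf i d)^2))"
    by (simp only: ennreal_suminf_cmult norm_V_suminf) (simp add: ennreal_mult)
  also have "\<dots> \<le> (\<Sum>i. msq \<beta> (\<lambda>s. f s \<bullet> ef i) t)"
    by (intro suminf_le mode) auto
  also have "\<dots> = (\<integral>\<^sup>+ s. (\<Sum>i. ennreal (exp (\<beta> * s)) * ennreal ((f s \<bullet> ef i)^2)) \<partial>Lo t)"
    by (rule nn_integral_suminf[symmetric]) measurable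
  also have "\<dots> = wsq \<beta> f t"
    by (simp only: ennreal_suminf_cmult H.ennreal_parseval) (simp add: ennreal_mult)
  finally show ?thesis .
qed

text \<open>The sum of the integrals over the modes is the integral of the sum, so the sum is finite
  at almost every time, and there its finiteness is membership in the domain.\<close>

lemma AE_domA_energy:
  assumes d [measurable]: "d \<in> BM t"
    and fin: "(\<Sum>i. msq \<beta> (\<lambda>s. evl i * cf i (d s)) t) \<le> C" and "C < \<infinity>"
  shows "AE s in Lo t. d s \<in> DA"
    and "wsq \<beta> (\<lambda>s. Aop (d s)) t \<le> C"
proof -
  have *: "(\<integral>\<^sup>+ s. (\<Sum>i. ennreal (exp (\<beta> * s)) * ennreal ((evl i * cf i (d s))^2)) \<partial>Lo t) \<le> C"
    using fin by (subst nn_integral_suminf) auto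
  have "AE s in Lo t. (\<Sum>i. ennreal (exp (\<beta> * s)) * ennreal ((evl i * cf i (d s))^2)) \<noteq> \<infinity>"
    using * \<open>C < \<infinity>\<close> by (intro nn_integral_noteq_infinite) auto
  then show dom: "AE s in Lo t. d s \<in> DA"
  proof eventually_elim
    case (elim s)
    then have "(\<Sum>i. ennreal ((evl i * cf i (d s))^2)) \<noteq> top"
      by (auto simp: ennreal_mult_eq_top_iff)
    then show ?case unfolding domA_iff_ennreal less_top[symmetric] .
  qed
  have "wsq \<beta> (\<lambda>s. Aop (d s)) t
      = (\<integral>\<^sup>+ s. (\<Sum>i. ennreal (exp (\<beta> * s)) * ennreal ((evl i * cf i (d s))^2)) \<partial>Lo t)"
    by (rule nn_integral_cong_AE, use dom in eventually_elim)
       (simp only: ennreal_suminf_cmult norm_opA_suminf, simp add: ennreal_mult)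
  with * show "wsq \<beta> (\<lambda>s. Aop (d s)) t \<le> C" by simp
qed

lemma energy_bound_DA:
  assumes [measurable]: "f \<in> BM t" "d \<in> BM t" and t: "0 \<le> t"
    and d: "\<And>i s. s \<in> {0<..<t} \<Longrightarrow> cf i (d s) = duhamel i f s"
    and \<beta>: "\<And>i. 2 * \<beta> \<le> evl i \<or> (\<forall>s. f s \<bullet> ef i = 0)"
    and fin: "wsq \<beta> f t < \<infinity>"
  shows "AE s in Lo t. d s \<in> DA"
    and "wsq \<beta> (\<lambda>s. Aop (d s)) t
      \<le> 2 * wsq \<beta> f t"
proof -
  have mode: "msq \<beta> (\<lambda>s. evl i * cf i (d s)) t
      \<le> 2 * msq \<beta> (\<lambda>s. f s \<bullet> ef i) t" for i
  proof (cases "\<forall>s. f s \<bullet> ef i = 0")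
    case True
    then have "cf i (d s) = 0" if "s \<in> {0<..<t}" for s using d[OF that, of i] by simp
    then have "msq \<beta> (\<lambda>s. evl i * cf i (d s)) t = (\<integral>\<^sup>+ s. 0 \<partial>Lo t)"
      by (intro nn_integral_cong) auto
    then show ?thesis by simp
  next
    case False
    then have "2 * \<beta> \<le> evl i" using \<beta> by blast
    from convolution_energy_bound[OF _ t evl_pos d this]
    show ?thesis by (simp add: ennreal_mult)
  qed
  have "(\<Sum>i. msq \<beta> (\<lambda>s. evl i * cf i (d s)) t)
      \<le> (\<Sum>i. 2 * msq \<beta> (\<lambda>s. f s \<bullet> ef i) t)"
    by (intro suminf_le mode) auto
  also have "\<dots> = 2 * (\<integral>\<^sup>+ s. (\<Sum>i. ennreal (exp (\<beta> * s)) * ennreal ((f s \<bullet> ef i)^2)) \<partial>Lo t)"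
    by (subst nn_integral_suminf) (auto simp: ennreal_suminf_cmult)
  also have "\<dots> = 2 * wsq \<beta> f t"
    by (simp only: ennreal_suminf_cmult H.ennreal_parseval) (simp add: ennreal_mult)
  finally have *: "(\<Sum>i. msq \<beta> (\<lambda>s. evl i * cf i (d s)) t)
      \<le> 2 * wsq \<beta> f t" .
  have **: "2 * wsq \<beta> f t < \<infinity>"
    using fin by (simp add: ennreal_mult_less_top)
  show "AE s in Lo t. d s \<in> DA"
    and "wsq \<beta> (\<lambda>s. Aop (d s)) t
      \<le> 2 * wsq \<beta> f t"
    using AE_domA_energy[OF _ * **] by simp_all
qed

end

section \<open>Mild solutions and the integral equation\<close>

context state_operator begin

text \<open>Solutions of \<open>y' + A y = f\<close>, \<open>y(0) = y\<^sub>0\<close>.\<close>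

definition mild :: "real \<Rightarrow> 'v \<Rightarrow> (real \<Rightarrow> 'h) \<Rightarrow> (real \<Rightarrow> 'v) \<Rightarrow> bool" where
  "mild T y0 f y \<longleftrightarrow> (\<forall>t\<in>{0..T}. \<forall>i.
     cf i (y t) = exp (- evl i * t) * cf i y0 + duhamel i f t)"

lemma integrable_coeff: "L2_on T f \<Longrightarrow> integrable (Lo T) (\<lambda>s. f s \<bullet> ef i)"
  using L2_on_integrable[of T f] by (intro integrable_inner_left) auto

lemma integrable_exp_coeff:
  assumes "L2_on T f" "t \<le> T"
  shows "integrable (Lo t) (\<lambda>s. exp (- evl i * (t - s)) * (f s \<bullet> ef i))"
proof -
  have "integrable (Lo t) (\<lambda>s. exp (- evl i * t) * (exp (evl i * s) * (f s \<bullet> ef i)))"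
    by (intro integrable_mult_right integrable_mult_exp integrable_coeff L2_on_mono[OF assms(2,1)])
  also have "(\<lambda>s. exp (- evl i * t) * (exp (evl i * s) * (f s \<bullet> ef i)))
      = (\<lambda>s. exp (- evl i * (t - s)) * (f s \<bullet> ef i))"
    unfolding mult.assoc[symmetric] mult_exp_exp by (simp add: algebra_simps)
  finally show ?thesis .
qed

lemma mild_diff:
  assumes y: "mild T y0 f y" and z: "mild T z0 g z" and f: "L2_on T f" and g: "L2_on T g"
  shows "mild T (y0 - z0) (\<lambda>s. f s - g s) (\<lambda>t. y t - z t)"
  unfolding mild_def
proof (intro ballI allI)
  fix t i assume t: "t \<in> {0..T}"
  have "(LINT s|Lo t. exp (- evl i * (t - s)) * ((f s - g s) \<bullet> ef i))
      = (LINT s|Lo t. exp (- evl i * (t - s)) * (f s \<bullet> ef i) - exp (- evl i * (t - s)) * (g s \<bullet> ef i))"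
    by (simp add: inner_diff_left right_diff_distrib)
  also have "\<dots> = duhamel i f t - duhamel i g t"
    using t by (intro Bochner_Integration.integral_diff integrable_exp_coeff[OF f] integrable_exp_coeff[OF g]) auto
  finally show "cf i (y t - z t) = exp (- evl i * t) * cf i (y0 - z0)
      + (LINT s|Lo t. exp (- evl i * (t - s)) * ((f s - g s) \<bullet> ef i))"
    using y t z by (simp add: mild_def algebra_simps)
qed

lemma measurable_mild:
  fixes d :: "real \<Rightarrow> 'v"
  assumes "continuous_on {0..t} d" shows "d \<in> BM t"
  using integrable_continuous_Lo[OF assms] by simp

lemma mode_bound:
  assumes [measurable]: "f \<in> BM t" and t: "0 \<le> t"
  shows "ennreal (evl i * (duhamel i f t)^2)
    \<le> (\<integral>\<^sup>+ s. ennreal ((f s \<bullet> ef i)^2) \<partial>Lo t)"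
proof -
  have "ennreal (evl i * (duhamel i f t)^2)
      \<le> (\<integral>\<^sup>+ s. ennreal (exp ((evl i - 2 * evl i) * (t - s)) * (f s \<bullet> ef i)^2) \<partial>Lo t)"
    using t by (intro convolution_sq_bound[OF _ _ evl_pos refl]) auto
  also have "\<dots> \<le> (\<integral>\<^sup>+ s. ennreal ((f s \<bullet> ef i)^2) \<partial>Lo t)"
    by (intro nn_integral_mono ennreal_leI mult_left_le_one_le)
       (auto intro!: mult_nonpos_nonneg)
  finally show ?thesis .
qed

lemma suminf_modes:
  assumes [measurable]: "f \<in> BM t"
  shows "(\<Sum>i. \<integral>\<^sup>+ s. ennreal ((f s \<bullet> ef i)^2) \<partial>Lo t) = (\<integral>\<^sup>+ s. ennreal ((norm (f s))^2) \<partial>Lo t)"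
proof -
  have "(\<Sum>i. \<integral>\<^sup>+ s. ennreal ((f s \<bullet> ef i)^2) \<partial>Lo t) = (\<integral>\<^sup>+ s. (\<Sum>i. ennreal ((f s \<bullet> ef i)^2)) \<partial>Lo t)"
    by (rule nn_integral_suminf[symmetric]) measurable
  then show ?thesis by (simp only: H.ennreal_parseval)
qed

text \<open>The majorant of the \<open>i\<close>-th mode is the integral of its squared forcing over
  the whole interval: it does not depend on \<open>t\<close>, and Parseval makes it
  summable.\<close>

lemma mild_continuous:
  assumes y: "mild T 0 f y" and f: "L2_on T f"
  shows "continuous_on {0..T} y"
proof (rule continuous_V_by_coeffs)
  fix i
  have "continuous_on {0..T} (\<lambda>t. exp (- evl i * t) * (LINT s|Lo t. exp (evl i * s) * (f s \<bullet> ef i)))"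
    by (intro continuous_intros continuous_on_integral_Lo integrable_mult_exp integrable_coeff f)
  then show "continuous_on {0..T} (\<lambda>t. cf i (y t))"
  proof (rule continuous_on_eq)
    fix t assume "t \<in> {0..T}"
    moreover have "exp (- evl i * t) * (LINT s|Lo t. exp (evl i * s) * (f s \<bullet> ef i))
        = duhamel i f t"
      unfolding LINT_cmult[symmetric] mult.assoc[symmetric] mult_exp_exp
      by (simp add: algebra_simps)
    ultimately show "exp (- evl i * t) * (LINT s|Lo t. exp (evl i * s) * (f s \<bullet> ef i)) = cf i (y t)"
      using y by (simp add: mild_def)
  qed
next
  define B where "B i = enn2real (\<integral>\<^sup>+ s. ennreal ((f s \<bullet> ef i)^2) \<partial>Lo T)" for i
  have fm: "f \<in> BM T" using f by (simp add: L2_on_def)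
  have fin: "(\<Sum>i. \<integral>\<^sup>+ s. ennreal ((f s \<bullet> ef i)^2) \<partial>Lo T) < \<infinity>"
    using f by (simp only: suminf_modes[OF fm] L2_on_iff_nn)
  have nnB: "(\<integral>\<^sup>+ s. ennreal ((f s \<bullet> ef i)^2) \<partial>Lo T) = ennreal (B i)" for i
  proof -
    have "(\<integral>\<^sup>+ s. ennreal ((f s \<bullet> ef i)^2) \<partial>Lo T) \<le> (\<Sum>i. \<integral>\<^sup>+ s. ennreal ((f s \<bullet> ef i)^2) \<partial>Lo T)"
      using sum_le_suminf[of "\<lambda>i. \<integral>\<^sup>+ s. ennreal ((f s \<bullet> ef i)^2) \<partial>Lo T" "{i}"] by simp
    then show ?thesis using fin by (simp add: B_def ennreal_enn2real_if top_unique)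
  qed
  show "summable B"
    using fin unfolding nnB by (intro summable_suminf_not_top) (auto simp: B_def)
  fix i t assume t: "t \<in> {0..T}"
  have "f \<in> BM t" using t measurable_Lo_mono[OF _ fm] by simp
  then have "ennreal (evl i * (cf i (y t))^2) \<le> (\<integral>\<^sup>+ s. ennreal ((f s \<bullet> ef i)^2) \<partial>Lo t)"
    using mode_bound[of f t i] y t by (simp add: mild_def)
  also have "\<dots> \<le> ennreal (B i)" unfolding nnB[symmetric] using t by (intro nn_integral_Lo_mono) auto
  finally show "evl i * (cf i (y t))^2 \<le> B i" by (simp add: B_def)
qed

text \<open>Existence of the free flow with additional damping \<open>\<kappa>\<close>. It is used
  with \<open>\<kappa> = 0\<close> to carry initial data, and with \<open>lam\<close> on the modes
  in \<open>S\<close> as a comparison function for the closed loop.\<close>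

lemma ex_damped:
  assumes \<kappa>: "\<And>i. 0 \<le> \<kappa> i"
  shows "\<exists>z. \<forall>t\<ge>0. \<forall>i. cf i (z t) = exp (- (evl i + \<kappa> i) * t) * cf i y0"
proof -
  have "\<exists>v. \<forall>i. cf i v = exp (- (evl i + \<kappa> i) * t) * cf i y0" if t: "t \<ge> 0" for t :: real
  proof (rule ex_cf, rule summable_comparison_test')
    show "summable (\<lambda>i. evl i * (cf i y0)^2)" using norm_V_sums sums_summable by blast
    fix i :: nat
    have "exp (- (evl i + \<kappa> i) * t) \<le> 1"
      using mult_nonneg_nonneg[OF add_nonneg_nonneg[OF evl_nonneg[of i] \<kappa>[of i]] t]
      by (simp only: exp_le_one_iff mult_minus_left neg_le_0_iff_le)
    then have "(exp (- (evl i + \<kappa> i) * t) * cf i y0)^2 \<le> (cf i y0)^2"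
      unfolding power_mult_distrib by (intro mult_left_le_one_le power_le_one) auto
    then show "norm (evl i * (exp (- (evl i + \<kappa> i) * t) * cf i y0)^2) \<le> evl i * (cf i y0)^2"
      by (simp add: mult_left_mono abs_mult)
  qed
  then show ?thesis by metis
qed

text \<open>All modes are present here, so \<open>\<beta>\<close> may well exceed
  \<open>evl i\<close>. Instead, \<open>exp (\<beta> * s) * exp (- 2 * evl i * s)\<close> is at most
  \<open>grow \<beta> t * exp (- evl i * s)\<close>, and the integral of the last factor, at most
  \<open>1 / evl i\<close>, reduces \<open>(evl i)^2\<close> to the weight \<open>evl i\<close> of
  the norm of \<open>V\<close>.\<close>

lemma damped_props:
  assumes \<kappa>: "\<And>i. 0 \<le> \<kappa> i" and \<beta>: "evl 0 \<le> \<beta>" and t: "0 \<le> t"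
    and z: "\<And>s i. s \<in> {0..t} \<Longrightarrow> cf i (z s) = exp (- (evl i + \<kappa> i) * s) * cf i y0"
  shows "continuous_on {0..t} z"
    and "norm (z t) \<le> exp (- evl 0 * t) * norm y0"
    and "AE s in Lo t. z s \<in> DA"
    and "wsq \<beta> (\<lambda>s. Aop (z s)) t
      \<le> ennreal (grow \<beta> t * (norm y0)^2)"
proof -
  have ge: "exp (- (evl i + \<kappa> i) * s) \<le> exp (- evl i * s)" if "0 \<le> s" for i s
    using that \<kappa>[of i] unfolding exp_le_cancel_iff by (intro mult_right_mono) auto
  have ge0: "exp (- evl i * s) \<le> exp (- evl 0 * s)" if "0 \<le> s" for i s
    using that evl_ge[of i] unfolding exp_le_cancel_iff by (intro mult_right_mono) auto
  show c: "continuous_on {0..t} z"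
  proof (rule continuous_V_by_coeffs)
    show "summable (\<lambda>i. evl i * (cf i y0)^2)" using norm_V_sums sums_summable by blast
    fix i
    have "continuous_on {0..t} (\<lambda>s. exp (- (evl i + \<kappa> i) * s) * cf i y0)" by (intro continuous_intros)
    then show "continuous_on {0..t} (\<lambda>s. cf i (z s))" by (rule continuous_on_eq) (simp add: z)
    fix s assume s: "s \<in> {0..t}"
    have "exp (- (evl i + \<kappa> i) * s) \<le> 1"
      by (rule order_trans[OF ge]) (use s in auto)
    then have "(cf i (z s))^2 \<le> (cf i y0)^2"
      unfolding z[OF s] power_mult_distrib by (intro mult_left_le_one_le power_le_one) auto
    then show "evl i * (cf i (z s))^2 \<le> evl i * (cf i y0)^2" by (simp add: mult_left_mono)
  qed
  have "(norm (z t))^2 \<le> (exp (- evl 0 * t))^2 * (norm y0)^2"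
  proof (rule sums_le[OF _ norm_V_sums sums_mult[OF norm_V_sums]])
    fix i
    have "exp (- (evl i + \<kappa> i) * t) \<le> exp (- evl 0 * t)" using ge[OF t, of i] ge0[OF t, of i] by linarith
    then have "(exp (- (evl i + \<kappa> i) * t))^2 * (evl i * (cf i y0)^2) \<le> (exp (- evl 0 * t))^2 * (evl i * (cf i y0)^2)"
      by (intro mult_right_mono power_mono) auto
    then show "evl i * (cf i (z t))^2 \<le> (exp (- evl 0 * t))^2 * (evl i * (cf i y0)^2)"
      using z[of t i] t by (simp add: power_mult_distrib mult_ac)
  qed
  then have "(norm (z t))^2 \<le> (exp (- evl 0 * t) * norm y0)^2" by (simp add: power_mult_distrib)
  then show "norm (z t) \<le> exp (- evl 0 * t) * norm y0" by (rule power2_le_imp_le) simp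
  define C where "C = grow \<beta> t"
  have mode: "msq \<beta> (\<lambda>s. evl i * cf i (z s)) t
      \<le> ennreal C * ennreal (evl i * (cf i y0)^2)" for i
  proof -
    have "msq \<beta> (\<lambda>s. evl i * cf i (z s)) t
        \<le> (\<integral>\<^sup>+ s. ennreal (C * (evl i * cf i y0)^2) * ennreal (exp (- evl i * s)) \<partial>Lo t)"
    proof (rule nn_integral_mono)
      fix s assume "s \<in> space (Lo t)"
      then have s: "0 < s" "s < t" by auto
      have "(\<beta> - evl 0) * s \<le> (\<beta> - evl 0) * t" using s \<beta> by (intro mult_left_mono) auto
      moreover have "evl 0 * s \<le> evl i * s" using s evl_ge[of i] by (intro mult_right_mono) auto
      moreover have "0 \<le> \<kappa> i * s" using s \<kappa> by simp
      ultimately have "\<beta> * s + 2 * (- (evl i + \<kappa> i) * s) \<le> (\<beta> - evl 0) * t + - evl i * s"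
        by (simp add: algebra_simps)
      then have "exp (\<beta> * s) * (exp (- (evl i + \<kappa> i) * s))^2 \<le> C * exp (- evl i * s)"
        unfolding exp_double[symmetric] mult_exp_exp C_def by simp
      from mult_right_mono[OF this, of "(evl i * cf i y0)^2"]
      have "exp (\<beta> * s) * (evl i * cf i (z s))^2 \<le> (C * (evl i * cf i y0)^2) * exp (- evl i * s)"
        using z[of s i] s by (simp add: power_mult_distrib mult_ac)
      then show "ennreal (exp (\<beta> * s)) * ennreal ((evl i * cf i (z s))^2)
          \<le> ennreal (C * (evl i * cf i y0)^2) * ennreal (exp (- evl i * s))"
        by (simp add: ennreal_mult[symmetric] C_def ennreal_leI)
    qed
    also have "\<dots> = ennreal (C * (evl i * cf i y0)^2) * (\<integral>\<^sup>+ s. ennreal (exp (- evl i * s)) \<partial>Lo t)"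
      by (rule nn_integral_cmult) measurable
    also have "(\<integral>\<^sup>+ s. ennreal (exp (- evl i * s)) \<partial>Lo t) = ennreal ((exp (- evl i * t) - exp (- evl i * 0)) / - evl i)"
      using t by (intro nn_integral_exp) auto
    also have "(exp (- evl i * t) - exp (- evl i * 0)) / - evl i \<le> 1 / evl i"
    proof -
      have "(exp (- evl i * t) - exp (- evl i * 0)) / - evl i = (1 - exp (- evl i * t)) / evl i"
        using minus_divide_divide[of "1 - exp (- evl i * t)" "evl i"] by simp
      also have "\<dots> \<le> 1 / evl i" by (intro divide_right_mono) auto
      finally show ?thesis .
    qed
    finally have "msq \<beta> (\<lambda>s. evl i * cf i (z s)) t
        \<le> ennreal (C * (evl i * cf i y0)^2) * ennreal (1 / evl i)"
      by (simp add: ennreal_leI mult_left_mono)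
    also have "\<dots> = ennreal C * ennreal (evl i * (cf i y0)^2)"
    proof -
      have "C * (evl i * cf i y0)^2 * (1 / evl i) = C * (evl i * (cf i y0)^2)"
        by (simp add: power2_eq_square)
      moreover have "0 \<le> C" by (simp add: C_def)
      ultimately show ?thesis by (metis ennreal_mult evl_nonneg mult_nonneg_nonneg zero_le_divide_1_iff zero_le_power2)
    qed
    finally show ?thesis .
  qed
  have zm: "z \<in> BM t" using c by (rule measurable_mild)
  have "(\<Sum>i. msq \<beta> (\<lambda>s. evl i * cf i (z s)) t)
      \<le> (\<Sum>i. ennreal C * ennreal (evl i * (cf i y0)^2))"
    by (intro suminf_le mode) auto
  also have "\<dots> = ennreal (C * (norm y0)^2)"
    by (simp only: ennreal_suminf_cmult norm_V_suminf) (simp add: ennreal_mult C_def)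
  finally have *: "(\<Sum>i. msq \<beta> (\<lambda>s. evl i * cf i (z s)) t)
      \<le> ennreal (C * (norm y0)^2)" .
  show "AE s in Lo t. z s \<in> DA"
    and "wsq \<beta> (\<lambda>s. Aop (z s)) t
      \<le> ennreal (grow \<beta> t * (norm y0)^2)"
    using AE_domA_energy[OF zm *] by (simp_all add: C_def)
qed

lemma ex_mild:
  assumes f: "\<And>T. L2_on T f"
  shows "\<exists>y. \<forall>T. mild T y0 f y"
proof -
  have "\<exists>v. \<forall>i. cf i v = exp (- evl i * t) * cf i y0 + duhamel i f t"
    if t: "0 \<le> t" for t
  proof -
    define u where "u i = duhamel i f t" for i
    have fm: "f \<in> BM t" using f by (simp add: L2_on_def)
    have "(\<Sum>i. ennreal (evl i * (u i)^2)) \<le> (\<Sum>i. \<integral>\<^sup>+ s. ennreal ((f s \<bullet> ef i)^2) \<partial>Lo t)"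
      unfolding u_def by (intro suminf_le mode_bound[OF fm t]) auto
    also have "\<dots> < \<infinity>" using f[of t] by (simp only: suminf_modes[OF fm] L2_on_iff_nn)
    finally have "summable (\<lambda>i. evl i * (u i)^2)"
      by (intro summable_suminf_not_top) auto
    from ex_cf[OF this] obtain v where v: "\<And>i. cf i v = u i" by blast
    obtain z where z: "\<And>i. cf i (z t) = exp (- (evl i + 0) * t) * cf i y0"
      using ex_damped[of "\<lambda>_. 0" y0] t by auto
    show ?thesis by (rule exI[of _ "z t + v"]) (simp add: z v u_def)
  qed
  note ex = this
  define y where "y t = (SOME v. \<forall>i. cf i v = exp (- evl i * t) * cf i y0
      + duhamel i f t)" for t
  have "\<forall>i. cf i (y t) = exp (- evl i * t) * cf i y0
      + duhamel i f t" if "0 \<le> t" for t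
    unfolding y_def using someI_ex[OF ex[OF that]] .
  then show ?thesis unfolding mild_def by (intro exI[of _ y] allI ballI) simp
qed

text \<open>Tested with an eigenfunction the equation becomes scalar and is
  \<open>variation_of_constants\<close>; these tests determine a vector of \<open>H\<close>.\<close>

lemma mild_imp_integral_equation:
  assumes y: "mild T y0 f y" and f: "L2_on T f" and c: "continuous_on {0..T} y"
    and dom: "AE t in Lo T. y t \<in> DA" and Ay: "L2_on T (\<lambda>t. Aop (y t))"
  defines "w \<equiv> \<lambda>s. f s - Aop (y s)"
  shows "L2_on T w" and "\<forall>t\<in>{0..T}. \<iota> (y t) = \<iota> y0 + (LINT s|Lo t. w s)"
proof -
  show w: "L2_on T w"
    unfolding w_def by (rule L2_on_diff[OF f Ay])
  show "\<forall>t\<in>{0..T}. \<iota> (y t) = \<iota> y0 + (LINT s|Lo t. w s)"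
  proof (intro ballI H.ext_b)
    fix t i assume t: "t \<in> {0..T}"
    have wi: "integrable (Lo t) w" using L2_on_integrable[OF L2_on_mono[OF _ w]] t by auto
    have cy: "continuous_on {0..t} (\<lambda>s. cf i (y s))"
      using t unfolding cf_def by (intro continuous_intros continuous_on_subset[OF c]) auto
    have fi: "integrable (Lo t) (\<lambda>s. f s \<bullet> ef i)" using t by (intro integrable_coeff L2_on_mono[OF _ f]) auto
    have "(LINT s|Lo t. w s) \<bullet> ef i = (LINT s|Lo t. w s \<bullet> ef i)"
      using wi by simp
    also have "\<dots> = (LINT s|Lo t. f s \<bullet> ef i - evl i * cf i (y s))"
    proof (rule integral_cong_AE)
      show "(\<lambda>s. w s \<bullet> ef i) \<in> BM t" using wi by auto
      show "(\<lambda>s. f s \<bullet> ef i - evl i * cf i (y s)) \<in> BM t"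
        using fi integrable_continuous_Lo[OF cy] by auto
      have "AE s in Lo t. y s \<in> DA"
        using AE_Lo_mono[OF _ dom, of t] t by auto
      then show "AE s in Lo t. w s \<bullet> ef i = f s \<bullet> ef i - evl i * cf i (y s)"
        by eventually_elim (simp add: w_def inner_diff_left opA_coeff)
    qed
    also have "\<dots> = cf i (y t) - cf i y0"
    proof -
      have "cf i (y t) = cf i y0 + (LINT s|Lo t. f s \<bullet> ef i - evl i * cf i (y s))"
        by (rule variation_of_constants[OF fi]) (use t y in \<open>auto simp: mild_def\<close>)
      then show ?thesis by simp
    qed
    finally show "\<iota> (y t) \<bullet> ef i = (\<iota> y0 + (LINT s|Lo t. w s)) \<bullet> ef i"
      by (simp add: inner_add_left cf_def)
  qed
qed

text \<open>Puts an arbitrary strong solution into Duhamel form, so that the energy estimates apply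
  to it. Uniqueness rests on this.\<close>

lemma integral_equation_imp_mild:
  assumes cy: "continuous_on {0..T} y" and dom: "AE t in Lo T. y t \<in> DA"
    and w: "L2_on T w" and eq: "\<forall>t\<in>{0..T}. \<iota> (y t) = \<iota> y0 + (LINT s|Lo t. w s)"
    and f: "L2_on T f" and wf: "AE t in Lo T. w t = f t - Aop (y t)"
  shows "mild T y0 f y"
  unfolding mild_def
proof (intro ballI allI)
  fix t i assume t: "t \<in> {0..T}"
  have fi: "integrable (Lo t) (\<lambda>s. f s \<bullet> ef i)" using t by (intro integrable_coeff L2_on_mono[OF _ f]) auto
  have ci: "continuous_on {0..t} (\<lambda>s. cf i (y s))"
    using t unfolding cf_def by (intro continuous_intros continuous_on_subset[OF cy]) auto
  show "cf i (y t) = exp (- evl i * t) * cf i y0 + duhamel i f t"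
  proof (rule variation_of_constants_converse[OF fi integrable_continuous_Lo[OF ci]])
    show "0 \<le> t" using t by simp
    fix s assume s: "s \<in> {0..t}"
    have wi: "integrable (Lo s) w" using L2_on_integrable[OF L2_on_mono[OF _ w]] s t by auto
    have "cf i (y s) = cf i y0 + (LINT r|Lo s. w r) \<bullet> ef i"
      using eq s t by (simp add: cf_def inner_add_left)
    also have "(LINT r|Lo s. w r) \<bullet> ef i = (LINT r|Lo s. w r \<bullet> ef i)" using wi by simp
    also have "\<dots> = (LINT r|Lo s. f r \<bullet> ef i - evl i * cf i (y r))"
    proof (rule integral_cong_AE)
      show "(\<lambda>r. w r \<bullet> ef i) \<in> BM s" using wi by auto
      have "integrable (Lo s) (\<lambda>r. f r \<bullet> ef i)" "integrable (Lo s) (\<lambda>r. cf i (y r))"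
        using integrable_Lo_mono[OF _ fi] integrable_Lo_mono[OF _ integrable_continuous_Lo[OF ci]] s by auto
      then show "(\<lambda>r. f r \<bullet> ef i - evl i * cf i (y r)) \<in> BM s" by auto
      have "AE r in Lo s. y r \<in> DA" "AE r in Lo s. w r = f r - Aop (y r)"
        using AE_Lo_mono[OF _ dom, of s] AE_Lo_mono[OF _ wf, of s] s t by auto
      then show "AE r in Lo s. w r \<bullet> ef i = f r \<bullet> ef i - evl i * cf i (y r)"
        by eventually_elim (simp add: inner_diff_left opA_coeff)
    qed
    finally show "cf i (y s) = cf i y0 + (LINT r|Lo s. f r \<bullet> ef i - evl i * cf i (y r))" .
  qed
qed

end

section \<open>The nonlinearity\<close>

lemma rpow_nonneg [simp]: "0 \<le> rpow x p"
  by (simp add: rpow_def)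

lemma rpow_eq_powr: "0 < x \<Longrightarrow> rpow x p = x powr p"
  by (simp add: rpow_def)

lemma rpow_le_powr: "0 \<le> p \<Longrightarrow> 0 \<le> x \<Longrightarrow> x \<le> y \<Longrightarrow> 0 < y \<Longrightarrow> rpow x p \<le> y powr p"
  by (auto simp: rpow_def powr_mono2)

text \<open>Weighted Young inequality; the small factor comes from \<open>\<zeta>2 + \<delta>2 < 1\<close>, by
  measuring \<open>Y\<close> and \<open>D\<close> in units of \<open>K E\<close> and \<open>K v\<close> with \<open>K\<close> large.\<close>

lemma young_rpow:
  fixes \<zeta>1 \<zeta>2 \<delta>1 \<delta>2 \<rho> \<epsilon> :: real
  assumes nn: "0 \<le> \<zeta>1" "0 \<le> \<zeta>2" "0 \<le> \<delta>1" "0 \<le> \<delta>2" and ex: "\<zeta>2 + \<delta>2 < 1" "1 \<le> \<delta>1 + \<delta>2"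
    and \<rho>: "1 \<le> \<rho>" and \<epsilon>: "0 < \<epsilon>"
  shows "\<exists>C\<ge>0. \<forall>E y Y v D. 0 < E \<longrightarrow> E \<le> 1 \<longrightarrow> 0 \<le> y \<longrightarrow> y \<le> \<rho> * E \<longrightarrow> 0 \<le> Y \<longrightarrow> 0 < v \<longrightarrow> v \<le> 2 * \<rho> \<longrightarrow> 0 \<le> D \<longrightarrow>
    rpow y \<zeta>1 * rpow Y \<zeta>2 * rpow v \<delta>1 * rpow D \<delta>2 \<le> \<epsilon> * D + v * (\<epsilon> * (Y / E) + C)"
proof -
  define \<theta> where "\<theta> = 1 - \<zeta>2 - \<delta>2"
  have \<theta>: "\<theta> > 0" using ex by (simp add: \<theta>_def)
  define B where "B = \<rho> powr \<zeta>1 * (2 * \<rho>) powr (\<delta>1 + \<delta>2 - 1)"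
  have B: "B > 0" using \<rho> by (simp add: B_def)
  \<comment> \<open>The smallest scale \<open>K \<ge> 1\<close> with
    \<open>B * K powr (- \<theta>) \<le> \<epsilon>\<close>; large \<open>K\<close> helps because
    \<open>\<theta> > 0\<close>.\<close>
  define K where "K = max 1 ((B / \<epsilon>) powr (1 / \<theta>))"
  have K: "K \<ge> 1" by (simp add: K_def)
  have BK: "B * K powr (- \<theta>) \<le> \<epsilon>"
  proof -
    have "(B / \<epsilon>) = ((B / \<epsilon>) powr (1 / \<theta>)) powr \<theta>" using \<theta> B \<epsilon> by (simp add: powr_powr)
    also have "\<dots> \<le> K powr \<theta>" using \<theta> by (intro powr_mono2) (auto simp: K_def)
    finally have "B \<le> \<epsilon> * K powr \<theta>" using \<epsilon> by (simp add: field_simps)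
    then show ?thesis using K by (simp add: powr_minus field_simps)
  qed
  define C where "C = B * K powr (\<zeta>2 + \<delta>2)"
  have CK: "C = B * K powr (- \<theta>) * K" using K by (simp add: C_def \<theta>_def powr_diff powr_add powr_minus field_simps)
  have C: "C \<ge> 0" using B by (simp add: C_def)
  show ?thesis
  proof (intro exI[of _ C] conjI C allI impI)
    fix E y Y v D :: real
    assume E: "0 < E" "E \<le> 1" and y: "0 \<le> y" "y \<le> \<rho> * E" and Y: "0 \<le> Y"
      and v: "0 < v" "v \<le> 2 * \<rho>" and D: "0 \<le> D"
    \<comment> \<open>A common scale for the two large quantities and 1. Since
      \<open>m \<ge> 1\<close> and \<open>\<zeta>2 + \<delta>2 < 1\<close>, the power of
      \<open>m\<close> that arises is at most \<open>m\<close>, and the maximum is at most the sum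
      of its three arguments.\<close>
    define m where "m = max (Y / (K * E)) (max (D / (K * v)) 1)"
    have m1: "1 \<le> m" by (simp add: m_def)
    have "Y / (K * E) \<le> m" "D / (K * v) \<le> m" by (auto simp: m_def)
    then have Ym: "Y \<le> K * E * m" and Dm: "D \<le> K * v * m" using K E v by (auto simp: field_simps)
    have msum: "m \<le> Y / (K * E) + D / (K * v) + 1"
      using Y D K E v by (auto simp: m_def)
    have 1: "rpow y \<zeta>1 \<le> \<rho> powr \<zeta>1"
    proof (rule rpow_le_powr[OF nn(1) y(1)])
      show "y \<le> \<rho>" using y(2) E \<rho> mult_left_le[of E \<rho>] by linarith
    qed (use \<rho> in auto)
    have 2: "rpow Y \<zeta>2 \<le> (K * m) powr \<zeta>2"
    proof (rule rpow_le_powr[OF nn(2) Y])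
      have "K * E * m \<le> K * 1 * m" using K E m1 by (intro mult_right_mono mult_left_mono) auto
      with Ym show "Y \<le> K * m" by simp
    qed (use K m1 in auto)
    have 3: "rpow D \<delta>2 \<le> (K * m * v) powr \<delta>2"
      using K m1 v Dm by (intro rpow_le_powr nn D) (auto simp: mult_ac)
    have "rpow y \<zeta>1 * rpow Y \<zeta>2 * rpow v \<delta>1 * rpow D \<delta>2
        \<le> \<rho> powr \<zeta>1 * (K * m) powr \<zeta>2 * v powr \<delta>1 * (K * m * v) powr \<delta>2"
      unfolding rpow_eq_powr[OF v(1)]
      by (intro mult_mono 1 2 3 order_refl mult_nonneg_nonneg) auto
    \<comment> \<open>One full factor \<open>v\<close> is split off. As
      \<open>\<delta>1 + \<delta>2 \<ge> 1\<close>, the exponent of the rest is nonnegative, so the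
      rest is bounded through \<open>v \<le> 2 * \<rho>\<close>.\<close>
    also have "\<dots> = \<rho> powr \<zeta>1 * (K powr (\<zeta>2 + \<delta>2) * m powr (\<zeta>2 + \<delta>2)) * (v powr (\<delta>1 + \<delta>2 - 1) * v)"
      using K m1 v by (simp add: powr_mult powr_add powr_diff)
    also have "\<dots> \<le> \<rho> powr \<zeta>1 * (K powr (\<zeta>2 + \<delta>2) * m) * ((2 * \<rho>) powr (\<delta>1 + \<delta>2 - 1) * v)"
    proof -
      have "m powr (\<zeta>2 + \<delta>2) \<le> m powr 1" using ex m1 by (intro powr_mono) auto
      moreover have "v powr (\<delta>1 + \<delta>2 - 1) \<le> (2 * \<rho>) powr (\<delta>1 + \<delta>2 - 1)"
        using ex v by (intro powr_mono2) auto
      ultimately show ?thesis using m1 v by (intro mult_mono order_refl mult_nonneg_nonneg) auto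
    qed
    also have "\<dots> = C * v * m" by (simp add: C_def B_def mult_ac)
    also have "\<dots> \<le> C * v * (Y / (K * E) + D / (K * v) + 1)"
      using C v by (intro mult_left_mono msum) auto
    also have "\<dots> = (B * K powr (- \<theta>)) * (v * (Y / E) + D) + C * v"
    proof -
      have "C * v * (Y / (K * E)) = (B * K powr (- \<theta>)) * (v * (Y / E))" "C * v * (D / (K * v)) = (B * K powr (- \<theta>)) * D"
        unfolding CK using K v E by (simp_all add: divide_simps)
      then show ?thesis by (simp add: distrib_left)
    qed
    also have "\<dots> \<le> \<epsilon> * (v * (Y / E) + D) + C * v"
      using Y E v D by (intro add_right_mono mult_right_mono BK) auto
    finally show "rpow y \<zeta>1 * rpow Y \<zeta>2 * rpow v \<delta>1 * rpow D \<delta>2 \<le> \<epsilon> * D + v * (\<epsilon> * (Y / E) + C)"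
      by (simp add: algebra_simps)
  qed
qed

context state_operator begin

lemma N_zero: "t > 0 \<Longrightarrow> N t 0 = 0"
proof -
  assume "t > 0"
  from N_Cbi[OF this] obtain m :: "real \<Rightarrow> real" where "m 0 = 0" "\<forall>x\<in>DA. norm (N t x) \<le> m (NDA x)"
    by (auto simp: Cbi_def)
  then have "norm (N t 0) \<le> 0" by (metis domA_0 normDA_def norm_zero)
  then show ?thesis by simp
qed

text \<open>The parameter \<open>E\<close> stands for the decaying factor \<open>exp (- \<mu> t)\<close> of a solution; in
  the uniqueness argument \<open>E = 1\<close>.\<close>

definition lip_const :: "real \<Rightarrow> real \<Rightarrow> real \<Rightarrow> bool" where
  "lip_const \<rho> \<epsilon> C \<longleftrightarrow> 0 \<le> C \<and> (\<forall>t>0. \<forall>y1\<in>DA. \<forall>y2\<in>DA. \<forall>E. 0 < E \<longrightarrow> E \<le> 1 \<longrightarrow> norm y1 \<le> \<rho> * E \<longrightarrow> norm y2 \<le> \<rho> * E \<longrightarrow>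
    norm (N t y1 - N t y2) \<le> \<epsilon> * NDA (y1 - y2)
      + norm (y1 - y2) * (\<epsilon> * ((NDA y1 + NDA y2) / E) + C))"

lemma N_small_lipschitz:
  assumes \<rho>: "1 \<le> \<rho>" and \<epsilon>: "0 < \<epsilon>"
  shows "\<exists>C. lip_const \<rho> \<epsilon> C"
proof -
  \<comment> \<open>There are \<open>2 * n\<close> products to estimate, each multiplied by
    \<open>CN\<close>; the denominator has \<open>CN + 1\<close> because \<open>CN\<close> may be
    0.\<close>
  define \<epsilon>' where "\<epsilon>' = \<epsilon> / (2 * real n * (CN + 1))"
  have \<epsilon>': "\<epsilon>' > 0" using \<epsilon> n_pos CN_nonneg by (simp add: \<epsilon>'_def)
  have small: "CN * (2 * (real n * \<epsilon>')) \<le> \<epsilon>"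
  proof -
    have "2 * (real n * (\<epsilon> / (2 * real n * c))) = \<epsilon> / c" if "c > 0" for c
      using n_pos that by (simp add: field_simps)
    from this[of "CN + 1"] have "2 * (real n * \<epsilon>') = \<epsilon> / (CN + 1)"
      unfolding \<epsilon>'_def using CN_nonneg by linarith
    then show ?thesis using \<epsilon> CN_nonneg by (simp add: pos_divide_le_eq algebra_simps)
  qed
  let ?P = "\<lambda>j C. C \<ge> 0 \<and> (\<forall>E y Y v D. 0 < E \<longrightarrow> E \<le> 1 \<longrightarrow> 0 \<le> y \<longrightarrow> y \<le> \<rho> * E \<longrightarrow> 0 \<le> Y \<longrightarrow> 0 < v \<longrightarrow> v \<le> 2 * \<rho> \<longrightarrow> 0 \<le> D \<longrightarrow>
      rpow y (\<zeta>1 j) * rpow Y (\<zeta>2 j) * rpow v (\<delta>1 j) * rpow D (\<delta>2 j) \<le> \<epsilon>' * D + v * (\<epsilon>' * (Y / E) + C))"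
  have "\<forall>j\<in>{1..n}. \<exists>C. ?P j C"
  proof
    fix j assume j: "j \<in> {1..n}"
    show "\<exists>C. ?P j C"
      using young_rpow[of "\<zeta>1 j" "\<zeta>2 j" "\<delta>1 j" "\<delta>2 j" \<rho> \<epsilon>'] exponents_nonneg[OF j] exponents[OF j] \<rho> \<epsilon>' by blast
  qed
  from bchoice[OF this] obtain C where C0: "\<forall>j\<in>{1..n}. ?P j (C j)" ..
  have C1: "0 \<le> C j" if "j \<in> {1..n}" for j
    using bspec[OF C0 that] by (rule conjunct1)
  have C2: "rpow y (\<zeta>1 j) * rpow Y (\<zeta>2 j) * rpow v (\<delta>1 j) * rpow D (\<delta>2 j) \<le> \<epsilon>' * D + v * (\<epsilon>' * (Y / E) + C j)"
    if "j \<in> {1..n}" "0 < E" "E \<le> 1" "0 \<le> y" "y \<le> \<rho> * E" "0 \<le> Y" "0 < v" "v \<le> 2 * \<rho>" "0 \<le> D" for j E y Y v D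
    using conjunct2[OF bspec[OF C0 that(1)], rule_format, OF that(2-)] .
  define C' where "C' = CN * (2 * (\<Sum>j=1..n. C j))"
  have "C' \<ge> 0" unfolding C'_def using C1 CN_nonneg by (intro mult_nonneg_nonneg sum_nonneg) auto
  then show ?thesis
    unfolding lip_const_def
  proof (intro exI[of _ C'] conjI allI ballI impI)
    fix t :: real and y1 y2 E
    assume t: "t > 0" and y1: "y1 \<in> DA" and y2: "y2 \<in> DA" and E: "0 < E" "E \<le> 1"
      and n1: "norm y1 \<le> \<rho> * E" and n2: "norm y2 \<le> \<rho> * E"
    let ?v = "norm (y1 - y2)" and ?D = "NDA (y1 - y2)" and ?Y1 = "NDA y1" and ?Y2 = "NDA y2"
    have D0: "0 \<le> ?D" "0 \<le> ?Y1" "0 \<le> ?Y2" by (auto simp: normDA_def)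
    show "norm (N t y1 - N t y2) \<le> \<epsilon> * ?D + ?v * (\<epsilon> * ((?Y1 + ?Y2) / E) + C')"
    \<comment> \<open>Equal arguments are treated separately because \<open>young_rpow\<close>
      requires \<open>v > 0\<close>.\<close>
    proof (cases "y1 = y2")
      case True
      then show ?thesis using \<epsilon> D0 by simp
    next
      case False
      have v: "0 < ?v" "?v \<le> 2 * \<rho>"
      proof -
        show "0 < ?v" using False by simp
        have "\<rho> * E \<le> \<rho>" using mult_left_le[of E \<rho>] E \<rho> by simp
        then show "?v \<le> 2 * \<rho>" using norm_triangle_ineq4[of y1 y2] n1 n2 by linarith
      qed
      have "norm (N t y1 - N t y2) \<le> CN * (\<Sum>j=1..n.
        (rpow (norm y1) (\<zeta>1 j) * rpow ?Y1 (\<zeta>2 j) + rpow (norm y2) (\<zeta>1 j) * rpow ?Y2 (\<zeta>2 j))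
        * rpow ?v (\<delta>1 j) * rpow ?D (\<delta>2 j))"
        by (rule N_bound[OF t y1 y2])
      also have "\<dots> \<le> CN * (\<Sum>j=1..n. (\<epsilon>' * ?D + ?v * (\<epsilon>' * (?Y1 / E) + C j)) + (\<epsilon>' * ?D + ?v * (\<epsilon>' * (?Y2 / E) + C j)))"
      proof (intro mult_left_mono sum_mono CN_nonneg)
        fix j assume j: "j \<in> {1..n}"
        have "rpow (norm y1) (\<zeta>1 j) * rpow ?Y1 (\<zeta>2 j) * rpow ?v (\<delta>1 j) * rpow ?D (\<delta>2 j) \<le> \<epsilon>' * ?D + ?v * (\<epsilon>' * (?Y1 / E) + C j)"
          by (rule C2[OF j E _ n1 D0(2) v D0(1)]) simp
        moreover have "rpow (norm y2) (\<zeta>1 j) * rpow ?Y2 (\<zeta>2 j) * rpow ?v (\<delta>1 j) * rpow ?D (\<delta>2 j) \<le> \<epsilon>' * ?D + ?v * (\<epsilon>' * (?Y2 / E) + C j)"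
          by (rule C2[OF j E _ n2 D0(3) v D0(1)]) simp
        ultimately show "(rpow (norm y1) (\<zeta>1 j) * rpow ?Y1 (\<zeta>2 j) + rpow (norm y2) (\<zeta>1 j) * rpow ?Y2 (\<zeta>2 j))
            * rpow ?v (\<delta>1 j) * rpow ?D (\<delta>2 j)
          \<le> (\<epsilon>' * ?D + ?v * (\<epsilon>' * (?Y1 / E) + C j)) + (\<epsilon>' * ?D + ?v * (\<epsilon>' * (?Y2 / E) + C j))"
          by (simp only: distrib_right)
      qed
      also have "\<dots> = (\<Sum>j=1..n. CN * (2 * (\<epsilon>' * ?D) + ?v * (\<epsilon>' * ((?Y1 + ?Y2) / E))) + CN * ?v * (2 * C j))"
        unfolding sum_distrib_left
        by (intro sum.cong refl) (simp add: algebra_simps add_divide_distrib)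
      also have "\<dots> = real n * (CN * (2 * (\<epsilon>' * ?D) + ?v * (\<epsilon>' * ((?Y1 + ?Y2) / E)))) + (\<Sum>j=1..n. CN * ?v * (2 * C j))"
        by (simp add: sum.distrib)
      also have "(\<Sum>j=1..n. CN * ?v * (2 * C j)) = ?v * C'"
        by (simp add: C'_def sum_distrib_left mult_ac)
      also have "real n * (CN * (2 * (\<epsilon>' * ?D) + ?v * (\<epsilon>' * ((?Y1 + ?Y2) / E))))
          \<le> (CN * (2 * (real n * \<epsilon>'))) * (?D + ?v * ((?Y1 + ?Y2) / E))"
      proof -
        have *: "real n * (CN * (2 * (\<epsilon>' * D) + v * (\<epsilon>' * q))) \<le> (CN * (2 * (real n * \<epsilon>'))) * (D + v * q)"
          if "0 \<le> v * q" for D v q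
        proof -
          have "0 \<le> (real n * (CN * \<epsilon>')) * (v * q)"
            using CN_nonneg \<epsilon>' by (intro mult_nonneg_nonneg[OF _ that]) auto
          then show ?thesis by (simp add: algebra_simps)
        qed
        show ?thesis
          by (rule *, intro mult_nonneg_nonneg divide_nonneg_nonneg add_nonneg_nonneg) (use E D0 in auto)
      qed
      also have "\<dots> \<le> \<epsilon> * (?D + ?v * ((?Y1 + ?Y2) / E))"
        using E D0 by (intro mult_right_mono small add_nonneg_nonneg mult_nonneg_nonneg divide_nonneg_nonneg) auto
      finally show ?thesis by (simp add: algebra_simps)
    qed
  qed
qed

end

section \<open>Oblique projections and the feedback\<close>

locale feedback_setting = state_operator \<iota> A \<alpha> e Arc N Crc CN n \<zeta>1 \<zeta>2 \<delta>1 \<delta>2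
  for \<iota> :: "'v::{real_inner, banach, second_countable_topology} \<Rightarrow>\<^sub>L
                'h::{real_inner, banach, second_countable_topology}"
    and A \<alpha> e Arc N Crc CN n \<zeta>1 \<zeta>2 \<delta>1 \<delta>2 +
  fixes S :: "nat set" and U :: "'h set" and lam :: real
  assumes adm: "admissible_pair \<iota> e S U"
begin

definition J :: "nat set" where "J = {j. Suc j \<in> S}"

abbreviation Eperp :: "'h set" where "Eperp \<equiv> orthogonal_comp (Esp \<iota> e S)"

abbreviation P :: "'h \<Rightarrow> 'h" where "P \<equiv> oblique_proj U Eperp"

definition PE :: "'h \<Rightarrow> 'h" where "PE h = (\<Sum>j\<in>J. (h \<bullet> ef j) *\<^sub>R ef j)"

lemma finite_J [simp]: "finite J"
proof -
  have "J = Suc -` S" by (auto simp: J_def)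
  then show ?thesis using adm by (simp add: admissible_pair_def finite_vimageI)
qed

lemma Esp_eq: "Esp \<iota> e S = span (ef ` J)"
proof -
  have "S \<subseteq> {1..}" using adm by (simp add: admissible_pair_def)
  then have "S = Suc ` J" by (force simp: J_def image_iff intro: Suc_pred[symmetric])
  moreover have "(\<lambda>i. \<iota> (e i)) ` (Suc ` J) = ef ` J" by (simp add: image_image ef_def)
  ultimately show ?thesis unfolding Esp_def by metis
qed

lemma Eperp_iff: "h \<in> Eperp \<longleftrightarrow> (\<forall>j\<in>J. h \<bullet> ef j = 0)"
proof
  assume "h \<in> Eperp"
  then show "\<forall>j\<in>J. h \<bullet> ef j = 0"
    by (auto simp: Esp_eq orthogonal_comp_def orthogonal_def inner_commute span_base)
next
  assume *: "\<forall>j\<in>J. h \<bullet> ef j = 0"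
  have "span (ef ` J) \<subseteq> {y. h \<bullet> y = 0}"
    using * by (intro span_minimal) (auto simp: subspace_def inner_add_right)
  then show "h \<in> Eperp" by (auto simp: Esp_eq orthogonal_comp_def orthogonal_def inner_commute)
qed

lemma PE_inner: "PE h \<bullet> ef j = (if j \<in> J then h \<bullet> ef j else 0)"
  by (simp add: PE_def H.inner_sum_b)

lemma sum_ef_Esp: "(\<Sum>j\<in>J. c j *\<^sub>R ef j) \<in> Esp \<iota> e S"
  unfolding Esp_eq by (intro span_sum span_scale span_base imageI)

lemma PE_Esp: "PE h \<in> Esp \<iota> e S"
  unfolding PE_def by (rule sum_ef_Esp)

lemma diff_PE_Eperp: "h - PE h \<in> Eperp"
  by (simp add: Eperp_iff inner_diff_left PE_inner)

lemma PE_id: "x \<in> Esp \<iota> e S \<Longrightarrow> PE x = x"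
proof -
  assume x: "x \<in> Esp \<iota> e S"
  have "x - PE x \<in> Esp \<iota> e S"
    using x PE_Esp[of x] by (simp add: Esp_eq span_diff)
  then have "orthogonal (x - PE x) (x - PE x)"
    using diff_PE_Eperp[of x] by (auto simp: orthogonal_comp_def)
  then show ?thesis by (simp add: orthogonal_def)
qed

lemma Eperp_subspace: "subspace Eperp"
  using adm by (simp add: admissible_pair_def direct_sum_def)

lemma U_subspace: "subspace U"
  using adm by (simp add: admissible_pair_def)

lemma orth_proj_eq: "orth_proj (Esp \<iota> e S) h = PE h"
  unfolding orth_proj_def oblique_proj_def
proof (rule the_equality)
  show "PE h \<in> Esp \<iota> e S \<and> h - PE h \<in> Eperp" by (simp add: PE_Esp diff_PE_Eperp)
  fix f assume f: "f \<in> Esp \<iota> e S \<and> h - f \<in> Eperp"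
  have "PE h = PE f"
    unfolding PE_def using f by (intro sum.cong) (auto simp: Eperp_iff inner_diff_left)
  then show "f = PE h" using f PE_id by simp
qed

lemma P_unique: "f \<in> U \<Longrightarrow> h - f \<in> Eperp \<Longrightarrow> P h = f"
  unfolding oblique_proj_def
proof (rule the_equality)
  fix f g assume f: "f \<in> U" "h - f \<in> Eperp" and g: "g \<in> U \<and> h - g \<in> Eperp"
  have "g - f \<in> U" using f g U_subspace by (simp add: subspace_diff)
  moreover have "(h - f) - (h - g) \<in> Eperp" 
    by (intro subspace_diff Eperp_subspace f(2) conjunct2[OF g])
  then have "g - f \<in> Eperp" by simp
  ultimately have "g - f \<in> U \<inter> Eperp" by simp
  moreover have "U \<inter> Eperp = {0}" using adm by (simp add: admissible_pair_def direct_sum_def)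
  ultimately have "g - f = 0" by simp
  then show "g = f" by simp
qed simp

lemma P_mem: "P h \<in> U" "h - P h \<in> Eperp"
proof -
  obtain f g where fg: "f \<in> U" "g \<in> Eperp" "h = f + g"
    using adm unfolding admissible_pair_def direct_sum_def by blast
  then have "h - f \<in> Eperp" by simp
  with fg P_unique show "P h \<in> U" "h - P h \<in> Eperp" by metis+
qed

lemma P_linear: "P (x + y) = P x + P y" "P (c *\<^sub>R x) = c *\<^sub>R P x"
proof -
  show "P (x + y) = P x + P y"
  proof (rule P_unique)
    show "P x + P y \<in> U" by (intro subspace_add U_subspace P_mem)
    have "(x - P x) + (y - P y) \<in> Eperp" by (intro subspace_add Eperp_subspace P_mem)
    then show "x + y - (P x + P y) \<in> Eperp" by (simp add: algebra_simps)
  qed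
  show "P (c *\<^sub>R x) = c *\<^sub>R P x"
  proof (rule P_unique)
    show "c *\<^sub>R P x \<in> U" by (intro subspace_scale U_subspace P_mem)
    have "c *\<^sub>R (x - P x) \<in> Eperp" by (intro subspace_scale Eperp_subspace P_mem)
    then show "c *\<^sub>R x - c *\<^sub>R P x \<in> Eperp" by (simp add: algebra_simps)
  qed
qed

lemma P_Eperp: "h \<in> Eperp \<Longrightarrow> P h = 0"
  by (rule P_unique) (simp_all add: U_subspace subspace_0)

lemma linear_P: "linear P"
  by (rule linearI) (auto simp: P_linear)

text \<open>\<open>P\<close> annihilates the orthogonal complement of the eigenspace. So
  \<open>P h\<close> depends only on the coefficients of \<open>h\<close> in \<open>S\<close>, which
  the closed loop makes explicit.\<close>

lemma P_PE: "P (PE h) = P h"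
proof -
  have "P (h - PE h) = 0" by (rule P_Eperp[OF diff_PE_Eperp])
  then show ?thesis by (simp add: linear_diff[OF linear_P])
qed

text \<open>\<open>P_PE\<close> exhibits \<open>P\<close> as a map of finite rank, hence bounded by
  some constant. Only once this is known does a bound on \<open>onorm\<close> give the quantitative
  estimate with \<open>CP\<close>.\<close>

lemma bounded_linear_P: "bounded_linear P"
proof -
  have "P h = (\<Sum>j\<in>J. (h \<bullet> ef j) *\<^sub>R P (ef j))" for h
    unfolding P_PE[of h, symmetric] by (simp add: PE_def linear_sum[OF linear_P] P_linear)
  then have "P = (\<lambda>h. \<Sum>j\<in>J. (h \<bullet> ef j) *\<^sub>R P (ef j))" by blast
  moreover have "bounded_linear (\<lambda>h. \<Sum>j\<in>J. (h \<bullet> ef j) *\<^sub>R P (ef j))"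
    by (intro bounded_linear_sum bounded_linear_compose[OF bounded_linear_scaleR_left bounded_linear_inner_left])
  ultimately show ?thesis by simp
qed

lemma inner_diff_P: "j \<in> J \<Longrightarrow> (h - P h) \<bullet> ef j = 0"
  using P_mem(2)[of h] by (simp add: Eperp_iff)

lemma inner_P: "j \<in> J \<Longrightarrow> P h \<bullet> ef j = h \<bullet> ef j"
  using inner_diff_P[of j h] by (simp add: inner_diff_left)

definition PEV :: "'v \<Rightarrow> 'v" where "PEV y = (\<Sum>j\<in>J. cf j y *\<^sub>R e (Suc j))"

lemma domA_sum:
  assumes "finite I"
  shows "(\<Sum>j\<in>I. c j *\<^sub>R e (Suc j)) \<in> DA \<and>
    Aop (\<Sum>j\<in>I. c j *\<^sub>R e (Suc j)) = (\<Sum>j\<in>I. (c j * evl j) *\<^sub>R ef j)"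
  using assms by induction (auto simp: domA_add domA_scaleR e_domA)

lemma inv_incl: "inv (blinfun_apply \<iota>) (\<iota> v) = v"
  by (rule inv_f_f[OF incl_inj])

abbreviation "FB \<equiv> feedback \<iota> A e Arc N S U (A_shift \<iota> A lam)"

lemma A_shift_sum:
  "A_shift \<iota> A lam (\<Sum>j\<in>J. c j *\<^sub>R ef j) = (\<Sum>j\<in>J. (c j * (evl j + lam)) *\<^sub>R ef j)"
proof -
  have "(\<Sum>j\<in>J. c j *\<^sub>R ef j) = \<iota> (\<Sum>j\<in>J. c j *\<^sub>R e (Suc j))"
    by (simp add: blinfun.sum_right blinfun.scaleR_right ef_def)
  then have "A_shift \<iota> A lam (\<Sum>j\<in>J. c j *\<^sub>R ef j) = (\<Sum>j\<in>J. (c j * evl j) *\<^sub>R ef j) + lam *\<^sub>R (\<Sum>j\<in>J. c j *\<^sub>R ef j)"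
    by (simp add: A_shift_def inv_incl domA_sum)
  then show ?thesis
    by (simp add: scaleR_sum_right sum.distrib[symmetric] algebra_simps)
qed

text \<open>\<open>P\<close> kills the part of \<open>A y\<close> orthogonal to the eigenspace, and
  the part inside cancels against \<open>A\<close> applied to the orthogonal projection of
  \<open>y\<close>. The \<open>lam\<close> term remains, and \<open>P_PE\<close> removes its inner
  projection.\<close>

lemma feedback_eq:
  assumes y: "y \<in> DA"
  shows "FB t y = P (Arc t y + N t y) - lam *\<^sub>R P (\<iota> y)"
proof -
  have Ay: "Aop y - (\<Sum>j\<in>J. (cf j y * evl j) *\<^sub>R ef j) \<in> Eperp"
    by (simp add: Eperp_iff inner_diff_left H.inner_sum_b opA_coeff[OF y])
  have "A_shift \<iota> A lam (PE (\<iota> y)) = (\<Sum>j\<in>J. (cf j y * evl j) *\<^sub>R ef j) + lam *\<^sub>R PE (\<iota> y)"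
    unfolding PE_def A_shift_sum
    by (simp add: scaleR_sum_right sum.distrib[symmetric] algebra_simps cf_def)
  then have "FB t y
      = P ((Aop y - (\<Sum>j\<in>J. (cf j y * evl j) *\<^sub>R ef j)) + ((Arc t y + N t y) + (- lam) *\<^sub>R PE (\<iota> y)))"
    by (simp add: feedback_def orth_proj_eq algebra_simps)
  also have "\<dots> = P (Arc t y + N t y) + (- lam) *\<^sub>R P (\<iota> y)"
    by (simp only: P_linear P_Eperp[OF Ay] P_PE add_0_left)
  finally show ?thesis by simp
qed

lemma A_shift_Cbi: "A_shift \<iota> A lam \<in> Cbi (Esp \<iota> e S) norm (Esp \<iota> e S)"
proof -
  \<comment> \<open>On the eigenspace \<open>A + lam\<close> is diagonal and agrees with this
    bounded map of all of \<open>H\<close>; its operator bound gives a linear modulus.\<close>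
  define L where "L h = (\<Sum>j\<in>J. ((h \<bullet> ef j) * (evl j + lam)) *\<^sub>R ef j)" for h
  have L: "A_shift \<iota> A lam x = L x" if "x \<in> Esp \<iota> e S" for x
    using A_shift_sum[of "\<lambda>j. x \<bullet> ef j"] PE_id[OF that] by (simp add: PE_def L_def)
  have bl: "bounded_linear L"
    unfolding L_def
    by (intro bounded_linear_sum bounded_linear_compose[OF bounded_linear_scaleR_left]
        bounded_linear_mult_const bounded_linear_inner_left)
  then interpret L: bounded_linear L .
  obtain K where K: "K > 0" "\<And>x. norm (L x) \<le> norm x * K" using L.pos_bounded by blast
  show ?thesis
    unfolding Cbi_def
  proof (intro CollectI conjI)
    show "A_shift \<iota> A lam \<in> Esp \<iota> e S \<rightarrow> Esp \<iota> e S"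
      using L by (auto simp: L_def sum_ef_Esp)
    show "\<forall>x\<in>Esp \<iota> e S. \<forall>\<epsilon>>0. \<exists>\<delta>>0. \<forall>x'\<in>Esp \<iota> e S. norm (x' - x) < \<delta> \<longrightarrow> norm (A_shift \<iota> A lam x' - A_shift \<iota> A lam x) < \<epsilon>"
    proof (intro ballI allI impI)
      fix x and \<epsilon> :: real assume x: "x \<in> Esp \<iota> e S" and \<epsilon>: "\<epsilon> > 0"
      have "norm (A_shift \<iota> A lam x' - A_shift \<iota> A lam x) < \<epsilon>"
        if "x' \<in> Esp \<iota> e S" "norm (x' - x) < \<epsilon> / K" for x'
      proof -
        have "norm (A_shift \<iota> A lam x' - A_shift \<iota> A lam x) \<le> norm (x' - x) * K"
          using K(2)[of "x' - x"] by (simp add: L that x L.diff)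
        also have "\<dots> < \<epsilon>" using that K(1) by (simp add: pos_less_divide_eq)
        finally show ?thesis .
      qed
      then show "\<exists>\<delta>>0. \<forall>x'\<in>Esp \<iota> e S. norm (x' - x) < \<delta> \<longrightarrow> norm (A_shift \<iota> A lam x' - A_shift \<iota> A lam x) < \<epsilon>"
        using \<epsilon> K(1) by (intro exI[of _ "\<epsilon> / K"]) auto
    qed
    show "\<exists>m :: real \<Rightarrow> real. continuous_on {0..} m \<and> mono_on {0..} m \<and> m 0 = 0 \<and>
        (\<forall>x\<in>Esp \<iota> e S. norm (A_shift \<iota> A lam x) \<le> m (norm x))"
      using K by (intro exI[of _ "\<lambda>r. r * K"]) (auto intro!: continuous_intros mono_onI mult_right_mono simp: L)
  qed
qed

lemma feedback_in_class:
  "FB \<in> feedback_class \<iota> A e Arc N"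
  unfolding feedback_class_def using adm A_shift_Cbi by blast

end

section \<open>Existence and decay\<close>

text \<open>A simple function takes finitely many values, so measurability of each
  \<open>g s c\<close> in \<open>s\<close> suffices for it; continuity in the second argument passes
  to the limit.\<close>

lemma caratheodory_measurable:
  fixes g :: "'s \<Rightarrow> 'a::{metric_space, second_countable_topology} \<Rightarrow> 'b::metric_space"
  assumes meas: "\<And>c. (\<lambda>s. g s c) \<in> borel_measurable M"
    and cont: "\<And>s. s \<in> space M \<Longrightarrow> continuous_on UNIV (g s)"
    and h: "h \<in> borel_measurable M"
  shows "(\<lambda>s. g s (h s)) \<in> borel_measurable M"
proof -
  obtain F where F: "\<And>i. simple_function M (F i)" "\<And>s. s \<in> space M \<Longrightarrow> (\<lambda>i. F i s) \<longlonglongrightarrow> h s"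
    using borel_measurable_implies_sequence_metric[OF h] by metis
  show ?thesis
  proof (rule borel_measurable_LIMSEQ_metric)
    fix i
    have fin: "finite (F i ` space M)" using F(1)[of i] by (simp add: simple_function_def)
    show "(\<lambda>s. g s (F i s)) \<in> borel_measurable M"
    proof (rule measurable_compose_countable'[where f = "\<lambda>c s. g s c" and g = "F i" and I = "F i ` space M"])
      show "F i \<in> measurable M (count_space (F i ` space M))"
        using F(1)[of i] by (subst measurable_count_space_eq2[OF fin]) (auto simp: simple_function_def)
      show "countable (F i ` space M)" using fin by (rule countable_finite)
    qed (rule meas)
  next
    fix s assume s: "s \<in> space M"
    show "(\<lambda>i. g s (F i s)) \<longlonglongrightarrow> g s (h s)"
      by (rule continuous_on_tendsto_compose[OF cont[OF s] F(2)[OF s]]) auto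
  qed
qed

lemma measurable_Lo_halfline:
  "f \<in> borel_measurable (lebesgue_on {0<..}) \<Longrightarrow> f \<in> BM T"
proof -
  assume f: "f \<in> borel_measurable (lebesgue_on {0<..})"
  have "Lo T = restrict_space (lebesgue_on {0<..}) {..<T}"
    by (subst restrict_restrict_space) (auto intro!: arg_cong[where f = lebesgue_on])
  then show ?thesis using measurable_restrict_space1[OF f, of "{..<T}"] by simp
qed

lemma AE_Lo_halfline:
  assumes "AE t in lebesgue_on {0<..}. Q t" shows "AE t in Lo T. Q t"
proof -
  have "Lo T = restrict_space (lebesgue_on {0<..}) {..<T}"
    by (subst restrict_restrict_space) (auto intro!: arg_cong[where f = lebesgue_on])
  then show ?thesis
    using assms by (simp only:) (subst AE_restrict_space_iff, auto simp: sets_restrict_space_iff)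
qed

lemma continuous_on_halfline:
  fixes d :: "real \<Rightarrow> 'b::topological_space"
  assumes cd: "\<And>t. 0 \<le> t \<Longrightarrow> continuous_on {0..t} d"
  shows "continuous_on {0..} d"
  unfolding continuous_on_eq_continuous_within
proof
  fix x :: real assume x: "x \<in> {0..}"
  have "at x within {0..} = at x within {0..x + 1}"
    by (rule at_within_nhd[of x "{..<x + 1}"]) auto
  then show "continuous (at x within {0..}) d"
    using cd[of "x + 1"] x by (simp add: continuous_on_eq_continuous_within)
qed

lemma L2_on_continuous:
  fixes f :: "real \<Rightarrow> 'b::{banach, second_countable_topology}"
  assumes c: "\<And>t. 0 \<le> t \<Longrightarrow> continuous_on {0..t} f" shows "L2_on T f"
proof (rule L2_on_mono)
  show "T \<le> max 0 T" by simp
  have "integrable (Lo (max 0 T)) (\<lambda>s. (norm (f s))^2)"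
    by (intro integrable_continuous_Lo continuous_intros c) simp
  then show "L2_on (max 0 T) f"
    using integrable_continuous_Lo[OF c, of "max 0 T"] by (simp add: L2_on_def)
qed

section \<open>The perturbation and the weighted space\<close>

context state_operator begin

text \<open>The value 0 is taken at nonpositive times and where \<open>y t\<close> lies outside the
  domain, which for the functions of interest is a null set of times. It makes \<open>K y\<close>
  measurable for every measurable \<open>y\<close>.\<close>

definition K :: "(real \<Rightarrow> 'v) \<Rightarrow> real \<Rightarrow> 'h" where
  "K y t = (if 0 < t \<and> y t \<in> DA then Arc t (y t) + N t (y t) else 0)"

lemma K_zero: "K (\<lambda>_. 0) = (\<lambda>_. 0)"
  by (auto simp: K_def N_zero blinfun.zero_right)

lemma continuous_N_invA:
  assumes "t > 0" shows "continuous_on UNIV (\<lambda>h. N t (invA h))"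
  unfolding continuous_on_iff
proof (intro ballI allI impI)
  fix h and \<epsilon> :: real assume "\<epsilon> > 0"
  then obtain \<delta> where \<delta>: "\<delta> > 0"
    "\<And>x'. x' \<in> DA \<Longrightarrow> NDA (x' - invA h) < \<delta> \<Longrightarrow> norm (N t x' - N t (invA h)) < \<epsilon>"
    using N_Cbi[OF assms] invA(1)[of h] unfolding Cbi_def by blast
  have "dist (N t (invA h')) (N t (invA h)) < \<epsilon>" if "dist h' h < \<delta>" for h'
    using \<delta>(2)[OF invA(1)[of h']] that by (simp add: normDA_def domA_diff invA dist_norm)
  with \<delta>(1) show "\<exists>\<delta>>0. \<forall>x'\<in>UNIV. dist x' h < \<delta> \<longrightarrow> dist (N t (invA x')) (N t (invA h)) < \<epsilon>" by blast
qed

text \<open>\<open>N t\<close> is continuous in the norm of the domain only. Viewed through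
  \<open>invA\<close> as a function of \<open>A y\<close> it is continuous on \<open>H\<close>, and
  \<open>Aop (y s)\<close> is measurable in \<open>s\<close>.\<close>

lemma measurable_K:
  assumes y [measurable]: "y \<in> BM T"
  shows "K y \<in> BM T"
proof -
  have hm: "(\<lambda>s. Aop (y s)) \<in> BM T"
    by (rule measurable_compose[OF y measurable_opA])
  have [measurable]: "(\<lambda>s. N s (invA (Aop (y s)))) \<in> BM T"
  proof (rule caratheodory_measurable[where g = "\<lambda>s h. N s (invA h)", OF _ _ hm])
    show "(\<lambda>s. N s (invA c)) \<in> BM T" for c
      by (intro measurable_Lo_halfline N_meas invA)
    show "continuous_on UNIV (\<lambda>h. N s (invA h))" if "s \<in> space (Lo T)" for s
      using that by (intro continuous_N_invA) simp
  qed
  have [measurable]: "(\<lambda>s. Arc s (y s)) \<in> BM T"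
  proof (rule caratheodory_measurable[where g = "\<lambda>s v. Arc s v", OF _ _ y])
    show "(\<lambda>s. Arc s c) \<in> BM T" for c
      by (intro measurable_Lo_halfline Arc_meas)
    show "continuous_on UNIV (blinfun_apply (Arc s))" for s
      by (intro continuous_intros)
  qed
  have "(\<lambda>s. if y s \<in> DA then Arc s (y s) + N s (invA (Aop (y s))) else 0) \<in> BM T"
    by measurable
  then show ?thesis
    by (rule measurable_cong[THEN iffD1, rotated]) (auto simp: K_def invA_opA)
qed

text \<open>\<open>bnd \<beta> r\<close> is the ball of radius \<open>r\<close> of the space in which the closed loop is solved;
  all its elements decay like \<open>exp (- \<mu> t)\<close>, \<open>\<mu> = evl 0 / 2\<close>, while the weight \<open>exp (\<beta> s)\<close> with
  \<open>\<beta>\<close> large makes lower order terms small.\<close>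

definition bnd :: "real \<Rightarrow> real \<Rightarrow> (real \<Rightarrow> 'v) \<Rightarrow> bool" where
  "bnd \<beta> r y \<longleftrightarrow> continuous_on {0..} y \<and>
     (\<forall>t\<ge>0. AE s in Lo t. y s \<in> DA) \<and>
     (\<forall>t\<ge>0. norm (y t) \<le> r * decay t) \<and>
     (\<forall>t\<ge>0. wsq \<beta> (\<lambda>s. Aop (y s)) t
        \<le> ennreal (r^2 * grow \<beta> t))"

definition bndF :: "real \<Rightarrow> real \<Rightarrow> (real \<Rightarrow> 'h) \<Rightarrow> bool" where
  "bndF \<beta> r f \<longleftrightarrow> (\<forall>t\<ge>0. f \<in> BM t \<and>
     wsq \<beta> f t \<le> ennreal (r^2 * grow \<beta> t))"

lemma bndD:
  assumes "bnd \<beta> r y" "0 \<le> t"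
  shows "continuous_on {0..t} y" "AE s in Lo t. y s \<in> DA"
    "norm (y t) \<le> r * decay t"
    "wsq \<beta> (\<lambda>s. Aop (y s)) t \<le> ennreal (r^2 * grow \<beta> t)"
    "y \<in> BM t"
proof -
  show c: "continuous_on {0..t} y"
    using assms by (auto simp: bnd_def intro: continuous_on_subset)
  show "y \<in> BM t" by (rule measurable_mild[OF c])
qed (use assms in \<open>auto simp: bnd_def\<close>)

lemma bnd_mono:
  assumes y: "bnd \<beta> r y" and r: "0 \<le> r" "r \<le> r'"
  shows "bnd \<beta> r' y"
proof -
  have 1: "r * exp x \<le> r' * exp x" for x :: real using r by (intro mult_right_mono) auto
  have 2: "ennreal (r^2 * exp x) \<le> ennreal (r'^2 * exp x)" for x :: real
    using r by (intro ennreal_leI mult_right_mono power_mono) auto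
  show ?thesis
    unfolding bnd_def using y[unfolded bnd_def] order_trans[OF _ 1] order_trans[OF _ 2] by blast
qed

lemma bnd_zero: "bnd \<beta> r (\<lambda>_. 0)" if "0 \<le> r"
  using that by (simp add: bnd_def)

text \<open>The condition on the radii reflects \<open>norm_add_sq_le\<close>, which replaces
  Minkowski's inequality for the weighted integral; it also implies \<open>r1 + r2 \<le> r\<close>,
  as needed for the pointwise bound.\<close>

lemma bnd_add:
  assumes y: "bnd \<beta> r1 y" and z: "bnd \<beta> r2 z" and r: "2 * r1^2 + 2 * r2^2 \<le> r^2" "0 \<le> r"
  shows "bnd \<beta> r (\<lambda>t. y t + z t)"
  unfolding bnd_def
proof (intro conjI allI impI)
  show "continuous_on {0..} (\<lambda>t. y t + z t)"
    using y z by (auto simp: bnd_def intro!: continuous_intros)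
  fix t :: real assume t: "0 \<le> t"
  note Y = bndD[OF y t] and Z = bndD[OF z t]
  show dom: "AE s in Lo t. y s + z s \<in> DA"
    using Y(2) Z(2) by eventually_elim (rule domA_add)
  have "(r1 + r2)^2 \<le> r^2"
    using r(1) zero_le_power2[of "r1 - r2"] by (simp add: power2_eq_square algebra_simps)
  then have rr: "r1 + r2 \<le> r" using r(2) by (rule power2_le_imp_le)
  have "norm (y t + z t) \<le> (r1 + r2) * decay t"
    using norm_triangle_ineq[of "y t" "z t"] Y(3) Z(3) by (simp add: distrib_right)
  also have "\<dots> \<le> r * decay t" using rr by (intro mult_right_mono) auto
  finally show "norm (y t + z t) \<le> r * decay t" .
  have [measurable]: "(\<lambda>s. Aop (y s)) \<in> BM t" "(\<lambda>s. Aop (z s)) \<in> BM t"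
    using measurable_compose[OF Y(5) measurable_opA] measurable_compose[OF Z(5) measurable_opA] by auto
  define G where "G = grow \<beta> t"
  have "wsq \<beta> (\<lambda>s. Aop (y s + z s)) t
      \<le> 2 * wsq \<beta> (\<lambda>s. Aop (y s)) t
        + 2 * wsq \<beta> (\<lambda>s. Aop (z s)) t"
  proof (rule nn_integral_sq_le)
    show "AE s in Lo t. (norm (Aop (y s + z s)))^2 \<le> 2 * (norm (Aop (y s)))^2 + 2 * (norm (Aop (z s)))^2"
      using Y(2) Z(2) by eventually_elim (simp add: domA_add norm_add_sq_le)
  qed auto
  also have "\<dots> \<le> 2 * ennreal (r1^2 * G) + 2 * ennreal (r2^2 * G)"
    using Y(4) Z(4) by (intro add_mono mult_left_mono) (auto simp: G_def)
  also have "\<dots> = ennreal ((2 * r1^2 + 2 * r2^2) * G)"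
  proof -
    have "2 * ennreal a + 2 * ennreal b = ennreal (2 * a + 2 * b)" if "0 \<le> a" "0 \<le> b" for a b
      using that by (simp add: ennreal_mult)
    from this[of "r1^2 * G" "r2^2 * G"] show ?thesis by (simp add: G_def distrib_right mult.assoc)
  qed
  also have "\<dots> \<le> ennreal (r^2 * G)" using r by (intro ennreal_leI mult_right_mono) (auto simp: G_def)
  finally show "wsq \<beta> (\<lambda>s. Aop (y s + z s)) t
      \<le> ennreal (r^2 * grow \<beta> t)" by (simp add: G_def)
qed

lemma bndF_L2:
  assumes f: "bndF \<beta> r f" and \<beta>: "0 \<le> \<beta>" shows "L2_on T f"
proof -
  have "L2_on T f" if T: "0 \<le> T" for T
  proof -
    have "(\<integral>\<^sup>+ s. ennreal ((norm (f s))^2) \<partial>Lo T) \<le> wsq \<beta> f T"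
      using \<beta> by (intro nn_integral_mono ennreal_leI) (auto simp: mult_le_cancel_right1)
    also have "\<dots> \<le> ennreal (r^2 * exp ((\<beta> - evl 0) * T))" using f T by (simp add: bndF_def)
    also have "\<dots> < \<infinity>" by simp
    finally show ?thesis using f T by (simp add: L2_on_iff_nn bndF_def)
  qed
  from L2_on_mono[OF _ this, of T "max 0 T"] show ?thesis by simp
qed

lemma bndF_scale:
  assumes f: "bndF \<beta> r f" and c: "\<And>s. norm (g s) \<le> c * norm (f s)"
    and g: "\<And>t. 0 \<le> t \<Longrightarrow> g \<in> BM t"
  shows "bndF \<beta> (c * r) g"
  unfolding bndF_def
proof (intro allI impI conjI g)
  fix t :: real assume t: "0 \<le> t"
  have fm: "f \<in> BM t" using f t by (simp add: bndF_def)
  have "wsq \<beta> g t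
      \<le> (\<integral>\<^sup>+ s. ennreal (c^2) * ennreal (exp (\<beta> * s) * (norm (f s))^2) \<partial>Lo t)"
  proof (rule nn_integral_mono)
    fix s
    have "(norm (g s))^2 \<le> (c * norm (f s))^2" by (intro power_mono c) simp
    then have "exp (\<beta> * s) * (norm (g s))^2 \<le> exp (\<beta> * s) * (c * norm (f s))^2" by simp
    also have "\<dots> = c^2 * (exp (\<beta> * s) * (norm (f s))^2)" by (simp add: power_mult_distrib)
    finally show "ennreal (exp (\<beta> * s) * (norm (g s))^2) \<le> ennreal (c^2) * ennreal (exp (\<beta> * s) * (norm (f s))^2)"
      by (simp add: ennreal_mult[symmetric] ennreal_leI)
  qed
  also have "\<dots> = ennreal (c^2) * wsq \<beta> f t"
    using fm by (intro nn_integral_cmult) measurable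
  also have "\<dots> \<le> ennreal (c^2) * ennreal (r^2 * grow \<beta> t)"
    using f t by (intro mult_left_mono) (auto simp: bndF_def)
  finally show "wsq \<beta> g t
      \<le> ennreal ((c * r)^2 * grow \<beta> t)"
    by (simp add: ennreal_mult[symmetric] power_mult_distrib mult.assoc)
qed

text \<open>The factor 2 rounds up \<open>sqrt 2\<close> from \<open>energy_bound_DA\<close>. In the
  pointwise bound, \<open>grow \<beta> t\<close> is \<open>exp (\<beta> * t)\<close> times the
  square of \<open>decay t\<close>, so the weight cancels and a decay rate independent of
  \<open>\<beta>\<close> remains.\<close>

lemma mild_bnd:
  assumes d: "\<And>T. mild T 0 f d" and f: "bndF \<beta> r f" and r: "0 \<le> r" and \<beta>0: "0 \<le> \<beta>"
    and \<beta>: "\<And>i. 2 * \<beta> \<le> evl i \<or> (\<forall>s. f s \<bullet> ef i = 0)"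
  shows "bnd \<beta> (2 * r) d"
  unfolding bnd_def
proof (intro conjI allI impI)
  have L: "L2_on T f" for T by (rule bndF_L2[OF f \<beta>0])
  have cd: "continuous_on {0..t} d" for t by (rule mild_continuous[OF d L])
  show "continuous_on {0..} d" by (rule continuous_on_halfline[OF cd])
  fix t :: real assume t: "0 \<le> t"
  have fm: "f \<in> BM t"
    and fb: "wsq \<beta> f t \<le> ennreal (r^2 * grow \<beta> t)"
    using f t by (auto simp: bndF_def)
  have dm: "d \<in> BM t" by (rule measurable_mild[OF cd])
  have dc: "cf i (d s) = duhamel i f s" if "0 \<le> s" for i s
    using d[of s] that by (simp add: mild_def)
  have fin: "wsq \<beta> f t < \<infinity>"
    using fb by (rule le_less_trans) simp
  show "AE s in Lo t. d s \<in> DA"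
    by (rule energy_bound_DA(1)[OF fm dm t dc \<beta> fin]) auto
  have "wsq \<beta> (\<lambda>s. Aop (d s)) t
      \<le> 2 * wsq \<beta> f t"
    by (rule energy_bound_DA(2)[OF fm dm t dc \<beta> fin]) auto
  also have "\<dots> \<le> 2 * ennreal (r^2 * grow \<beta> t)" by (intro mult_left_mono fb) simp
  also have "\<dots> = ennreal (2 * (r^2 * grow \<beta> t))" by (simp add: ennreal_mult)
  also have "\<dots> \<le> ennreal ((2 * r)^2 * grow \<beta> t)"
    by (intro ennreal_leI) (simp add: power_mult_distrib)
  finally show "wsq \<beta> (\<lambda>s. Aop (d s)) t
      \<le> ennreal ((2 * r)^2 * grow \<beta> t)" .
  have "ennreal (exp (\<beta> * t) * (norm (d t))^2) \<le> ennreal (r^2 * grow \<beta> t)"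
    using energy_bound_V[OF fm t dc[OF t] \<beta>] fb by (rule order_trans)
  then have "exp (\<beta> * t) * (norm (d t))^2 \<le> r^2 * grow \<beta> t" by simp
  also have "grow \<beta> t = exp (\<beta> * t) * (decay t)^2"
    unfolding exp_double[symmetric] mult_exp_exp by (simp add: algebra_simps)
  finally have "exp (\<beta> * t) * (norm (d t))^2 \<le> exp (\<beta> * t) * (r * decay t)^2"
    by (simp only: power_mult_distrib mult_ac)
  then have "(norm (d t))^2 \<le> (r * decay t)^2" by simp
  then have "norm (d t) \<le> r * decay t" by (rule power2_le_imp_le) (use r in simp)
  also have "\<dots> \<le> 2 * r * decay t" using r by (intro mult_right_mono) auto
  finally show "norm (d t) \<le> 2 * r * decay t" .
qed

end

lemma sum4_sq_le: "(a + b + c + d)^2 \<le> 4 * (a^2 + b^2 + c^2 + d^2)" for a b c d :: real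
proof -
  have "0 \<le> (a - b)^2 + (a - c)^2 + (a - d)^2 + (b - c)^2 + (b - d)^2 + (c - d)^2" by simp
  then show ?thesis by (simp add: power2_eq_square algebra_simps)
qed

section \<open>Smallness of the Lipschitz constant for large \<beta>\<close>

context state_operator begin

lemma K_diff_bound:
  assumes lip: "lip_const \<rho> \<epsilon> C" and t: "t > 0" and dom: "y t \<in> DA" "z t \<in> DA" and E: "0 < E" "E \<le> 1"
    and n: "norm (y t) \<le> \<rho> * E" "norm (z t) \<le> \<rho> * E" and Arc: "norm (Arc t) \<le> Crc"
  shows "norm (K y t - K z t) \<le> \<epsilon> * norm (Aop (y t - z t))
    + norm (y t - z t) * (\<epsilon> * ((norm (Aop (y t)) + norm (Aop (z t))) / E) + (C + Crc))"
proof -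
  have "norm (N t (y t) - N t (z t)) \<le> \<epsilon> * norm (Aop (y t - z t))
      + norm (y t - z t) * (\<epsilon> * ((norm (Aop (y t)) + norm (Aop (z t))) / E) + C)"
    using lip t dom E n unfolding lip_const_def normDA_def by blast
  moreover have "norm (Arc t (y t) - Arc t (z t)) \<le> Crc * norm (y t - z t)"
    unfolding blinfun.diff_right[symmetric]
    by (intro order_trans[OF norm_blinfun] mult_right_mono Arc) simp
  moreover have "norm (K y t - K z t) \<le> norm (Arc t (y t) - Arc t (z t)) + norm (N t (y t) - N t (z t))"
  proof -
    have "K y t - K z t = (Arc t (y t) - Arc t (z t)) + (N t (y t) - N t (z t))"
      using t dom by (simp add: K_def)
    then show ?thesis by (simp only: norm_triangle_ineq)
  qed
  ultimately show ?thesis by (simp add: algebra_simps)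
qed

text \<open>A quantity controlled only by its pointwise decay gains the factor
  \<open>1 / (\<beta> - evl 0)\<close>; this makes terms of lower order small for large
  \<open>\<beta>\<close>.\<close>

lemma nn_integral_decay:
  assumes "evl 0 + 1 \<le> \<beta>" "0 \<le> t"
  shows "(\<integral>\<^sup>+ s. ennreal (exp (\<beta> * s) * (decay s)^2) \<partial>Lo t) \<le> ennreal (grow \<beta> t / (\<beta> - evl 0))"
proof -
  have "exp (\<beta> * s) * (decay s)^2 = grow \<beta> s" for s
    unfolding exp_double[symmetric] mult_exp_exp by (simp add: algebra_simps)
  then have "(\<integral>\<^sup>+ s. ennreal (exp (\<beta> * s) * (decay s)^2) \<partial>Lo t)
      = (\<integral>\<^sup>+ s. ennreal (grow \<beta> s) \<partial>Lo t)" by (simp only:)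
  also have "\<dots> = ennreal ((grow \<beta> t - exp ((\<beta> - evl 0) * 0)) / (\<beta> - evl 0))"
    using assms by (intro nn_integral_exp) auto
  also have "\<dots> \<le> ennreal (grow \<beta> t / (\<beta> - evl 0))"
    using assms by (intro ennreal_leI divide_right_mono) auto
  finally show ?thesis .
qed

text \<open>The bound \<open>\<delta> * E s\<close> on the difference cancels the division by
  \<open>E s\<close> in \<open>lip_const\<close>, so nothing is lost while the functions decay. The
  terms with \<open>A\<close> are small through \<open>\<epsilon>\<close>, the remaining one through
  \<open>\<beta>\<close>. Given the data of the equation, both thresholds depend on
  \<open>\<rho>\<close> and \<open>\<eta>\<close> alone, hence not on \<open>M\<close>.\<close>

lemma K_contraction:
  assumes \<rho>: "1 \<le> \<rho>" and \<eta>: "0 < \<eta>"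
  shows "\<exists>\<beta>0\<ge>evl 0 + 1. \<forall>\<beta>\<ge>\<beta>0. \<forall>y1 y2 \<delta>. 0 \<le> \<delta> \<longrightarrow> bnd \<beta> \<rho> y1 \<longrightarrow> bnd \<beta> \<rho> y2 \<longrightarrow>
    bnd \<beta> \<delta> (\<lambda>t. y1 t - y2 t) \<longrightarrow> bndF \<beta> (\<eta> * \<delta>) (\<lambda>s. K y1 s - K y2 s)"
proof -
  \<comment> \<open>After squaring, the difference term takes at most \<open>1 / 16\<close> of
    \<open>\<eta>^2\<close>, the two terms with \<open>\<rho>\<close> together \<open>1 / 8\<close>,
    and the choice of \<open>\<beta>0\<close> limits the lower order term to
    \<open>1 / 2\<close>.\<close>
  define \<epsilon> where "\<epsilon> = \<eta> / (8 * \<rho>)"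
  have \<epsilon>: "0 < \<epsilon>" using \<eta> \<rho> by (simp add: \<epsilon>_def)
  obtain C where lip: "lip_const \<rho> \<epsilon> C" using N_small_lipschitz[OF \<rho> \<epsilon>] ..
  then have C: "C \<ge> 0" by (simp add: lip_const_def)
  define C' where "C' = C + Crc"
  have C': "C' \<ge> 0" using C Crc_nonneg by (simp add: C'_def)
  define \<beta>0 where "\<beta>0 = evl 0 + 1 + 8 * C'^2 / \<eta>^2"
  have "evl 0 + 1 \<le> \<beta>0" by (simp add: \<beta>0_def)
  then show ?thesis
  proof (intro exI[of _ \<beta>0] conjI allI impI)
    fix \<beta> y1 y2 \<delta>
    assume \<beta>: "\<beta>0 \<le> \<beta>" and \<delta>: "0 \<le> \<delta>" and b1: "bnd \<beta> \<rho> y1" and b2: "bnd \<beta> \<rho> y2"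
      and bd: "bnd \<beta> \<delta> (\<lambda>t. y1 t - y2 t)"
    have \<beta>1: "evl 0 + 1 \<le> \<beta>" using \<beta> \<open>evl 0 + 1 \<le> \<beta>0\<close> by simp
    show "bndF \<beta> (\<eta> * \<delta>) (\<lambda>s. K y1 s - K y2 s)"
      unfolding bndF_def
    proof (intro allI impI conjI)
      fix t :: real assume t: "0 \<le> t"
      note B1 = bndD[OF b1 t] and B2 = bndD[OF b2 t] and BD = bndD[OF bd t]
      show "(\<lambda>s. K y1 s - K y2 s) \<in> BM t"
        using measurable_K[OF B1(5)] measurable_K[OF B2(5)] by measurable
      define E where "E s = decay s" for s
      define Y1 where "Y1 s = norm (Aop (y1 s))" for s
      define Y2 where "Y2 s = norm (Aop (y2 s))" for s
      define D where "D s = norm (Aop (y1 s - y2 s))" for s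
      have m [measurable]: "Y1 \<in> BM t" "Y2 \<in> BM t" "D \<in> BM t"
        unfolding Y1_def Y2_def D_def
        using measurable_compose[OF measurable_compose[OF B1(5) measurable_opA] borel_measurable_norm]
          measurable_compose[OF measurable_compose[OF B2(5) measurable_opA] borel_measurable_norm]
          measurable_compose[OF measurable_compose[OF BD(5) measurable_opA] borel_measurable_norm] by simp_all
      have mE [measurable]: "E \<in> BM t"
        unfolding E_def by measurable
      have Arc': "AE s in Lo t. norm (Arc s) \<le> Crc" by (rule AE_Lo_halfline[OF Arc_bound])
      have "AE s in Lo t. s \<in> {0<..<t}" by (intro AE_I2) simp
      then have "AE s in Lo t. norm (K y1 s - K y2 s) \<le> \<epsilon> * D s + (\<delta> * \<epsilon>) * Y1 s + (\<delta> * \<epsilon>) * Y2 s + (\<delta> * C') * E s"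
        using B1(2) B2(2) Arc'
      proof eventually_elim
        case (elim s)
        then have s: "0 < s" "s < t" by auto
        have E: "0 < E s" "E s \<le> 1" using s by (auto simp: E_def)
        have v: "norm (y1 s - y2 s) \<le> \<delta> * E s"
          using bndD(3)[OF bd, of s] s by (simp add: E_def)
        have "norm (K y1 s - K y2 s) \<le> \<epsilon> * D s + norm (y1 s - y2 s) * (\<epsilon> * ((Y1 s + Y2 s) / E s) + C')"
          unfolding D_def Y1_def Y2_def C'_def
          using s elim E bndD(3)[OF b1, of s] bndD(3)[OF b2, of s] by (intro K_diff_bound[OF lip]) (auto simp: E_def)
        also have "\<dots> \<le> \<epsilon> * D s + (\<delta> * E s) * (\<epsilon> * ((Y1 s + Y2 s) / E s) + C')"
          using C' \<epsilon> E by (intro add_left_mono mult_right_mono v) (auto simp: Y1_def Y2_def)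
        also have "\<dots> = \<epsilon> * D s + (\<delta> * \<epsilon>) * Y1 s + (\<delta> * \<epsilon>) * Y2 s + (\<delta> * C') * E s"
          using E by (simp add: field_simps)
        finally show ?case .
      qed
      then have "AE s in Lo t. ennreal (exp (\<beta> * s) * (norm (K y1 s - K y2 s))^2) \<le>
          ennreal (4 * \<epsilon>^2) * ennreal (exp (\<beta> * s) * (D s)^2)
          + (ennreal (4 * (\<delta> * \<epsilon>)^2) * ennreal (exp (\<beta> * s) * (Y1 s)^2)
          + (ennreal (4 * (\<delta> * \<epsilon>)^2) * ennreal (exp (\<beta> * s) * (Y2 s)^2)
          + ennreal (4 * (\<delta> * C')^2) * ennreal (exp (\<beta> * s) * (E s)^2)))"
      proof eventually_elim
        case (elim s)
        then have "(norm (K y1 s - K y2 s))^2 \<le> (\<epsilon> * D s + (\<delta> * \<epsilon>) * Y1 s + (\<delta> * \<epsilon>) * Y2 s + (\<delta> * C') * E s)^2"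
          by (intro power_mono) auto
        also note sum4_sq_le
        finally have "exp (\<beta> * s) * (norm (K y1 s - K y2 s))^2
            \<le> exp (\<beta> * s) * (4 * ((\<epsilon> * D s)^2 + ((\<delta> * \<epsilon>) * Y1 s)^2 + ((\<delta> * \<epsilon>) * Y2 s)^2 + ((\<delta> * C') * E s)^2))"
          by simp
        also have "\<dots> = (4 * \<epsilon>^2) * (exp (\<beta> * s) * (D s)^2) + ((4 * (\<delta> * \<epsilon>)^2) * (exp (\<beta> * s) * (Y1 s)^2)
            + ((4 * (\<delta> * \<epsilon>)^2) * (exp (\<beta> * s) * (Y2 s)^2) + (4 * (\<delta> * C')^2) * (exp (\<beta> * s) * (E s)^2)))"
          by (simp add: power_mult_distrib algebra_simps)
        finally have "ennreal (exp (\<beta> * s) * (norm (K y1 s - K y2 s))^2)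
            \<le> ennreal ((4 * \<epsilon>^2) * (exp (\<beta> * s) * (D s)^2) + ((4 * (\<delta> * \<epsilon>)^2) * (exp (\<beta> * s) * (Y1 s)^2)
            + ((4 * (\<delta> * \<epsilon>)^2) * (exp (\<beta> * s) * (Y2 s)^2) + (4 * (\<delta> * C')^2) * (exp (\<beta> * s) * (E s)^2))))"
          by (rule ennreal_leI)
        then show ?case by (simp add: ennreal_mult)
      qed
      then have "wsq \<beta> (\<lambda>s. K y1 s - K y2 s) t \<le>
          (\<integral>\<^sup>+ s. ennreal (4 * \<epsilon>^2) * ennreal (exp (\<beta> * s) * (D s)^2)
          + (ennreal (4 * (\<delta> * \<epsilon>)^2) * ennreal (exp (\<beta> * s) * (Y1 s)^2)
          + (ennreal (4 * (\<delta> * \<epsilon>)^2) * ennreal (exp (\<beta> * s) * (Y2 s)^2)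
          + ennreal (4 * (\<delta> * C')^2) * ennreal (exp (\<beta> * s) * (E s)^2))) \<partial>Lo t)"
        by (rule nn_integral_mono_AE)
      also have "\<dots> = ennreal (4 * \<epsilon>^2) * (\<integral>\<^sup>+ s. ennreal (exp (\<beta> * s) * (D s)^2) \<partial>Lo t)
          + (ennreal (4 * (\<delta> * \<epsilon>)^2) * (\<integral>\<^sup>+ s. ennreal (exp (\<beta> * s) * (Y1 s)^2) \<partial>Lo t)
          + (ennreal (4 * (\<delta> * \<epsilon>)^2) * (\<integral>\<^sup>+ s. ennreal (exp (\<beta> * s) * (Y2 s)^2) \<partial>Lo t)
          + ennreal (4 * (\<delta> * C')^2) * (\<integral>\<^sup>+ s. ennreal (exp (\<beta> * s) * (E s)^2) \<partial>Lo t)))"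
        by (simp add: nn_integral_add nn_integral_cmult)
      also have "\<dots> \<le> ennreal (4 * \<epsilon>^2) * ennreal (\<delta>^2 * grow \<beta> t)
          + (ennreal (4 * (\<delta> * \<epsilon>)^2) * ennreal (\<rho>^2 * grow \<beta> t)
          + (ennreal (4 * (\<delta> * \<epsilon>)^2) * ennreal (\<rho>^2 * grow \<beta> t)
          + ennreal (4 * (\<delta> * C')^2) * ennreal (grow \<beta> t / (\<beta> - evl 0))))"
        using B1(4) B2(4) BD(4) nn_integral_decay[OF \<beta>1 t] unfolding D_def Y1_def Y2_def E_def
        by (intro add_mono mult_left_mono) auto
      also have "\<dots> = ennreal ((4 * \<epsilon>^2 + 8 * \<epsilon>^2 * \<rho>^2 + 4 * C'^2 / (\<beta> - evl 0)) * \<delta>^2 * grow \<beta> t)"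
        using \<beta>1 by (simp add: ennreal_mult[symmetric] ennreal_plus[symmetric] power_mult_distrib algebra_simps add_divide_distrib del: ennreal_plus)
      also have "\<dots> \<le> ennreal (\<eta>^2 * \<delta>^2 * grow \<beta> t)"
      proof (intro ennreal_leI mult_right_mono)
        have "8 * \<epsilon>^2 * \<rho>^2 = \<eta>^2 / 8" using \<rho> by (simp add: \<epsilon>_def power_divide power_mult_distrib)
        moreover have "4 * \<epsilon>^2 \<le> \<eta>^2 / 16"
        proof -
          have "4 * \<epsilon>^2 * 1 \<le> 4 * \<epsilon>^2 * \<rho>^2" using \<rho> by (intro mult_left_mono) (auto simp: one_le_power)
          then show ?thesis using \<open>8 * \<epsilon>^2 * \<rho>^2 = \<eta>^2 / 8\<close> by linarith
        qed
        moreover have "4 * C'^2 / (\<beta> - evl 0) \<le> \<eta>^2 / 2"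
        proof -
          have "8 * C'^2 / \<eta>^2 \<le> \<beta> - evl 0" using \<beta> by (simp add: \<beta>0_def)
          then have "8 * C'^2 \<le> \<eta>^2 * (\<beta> - evl 0)" using \<eta> by (simp add: pos_divide_le_eq mult.commute)
          then show ?thesis using \<beta>1 by (simp add: pos_divide_le_eq)
        qed
        ultimately show "4 * \<epsilon>^2 + 8 * \<epsilon>^2 * \<rho>^2 + 4 * C'^2 / (\<beta> - evl 0) \<le> \<eta>^2"
          using zero_le_power2[of \<eta>] by linarith
      qed auto
      finally show "wsq \<beta> (\<lambda>s. K y1 s - K y2 s) t
          \<le> ennreal ((\<eta> * \<delta>)^2 * grow \<beta> t)"
        by (simp add: power_mult_distrib)
    qed
  qed
qed

end

text \<open>The Lipschitz constant \<open>1 / (8 * (1 + CP))\<close> becomes \<open>1 / 8\<close>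
  after \<open>1 - P\<close> and \<open>1 / 4\<close> after the linear solver. The radius
  \<open>r\<close> is twice a bound for the first iterate and is proportional to
  \<open>norm y0\<close>, which makes the final estimate homogeneous in the data. The limit is
  controlled by \<open>2 * r\<close>, hence the condition on \<open>\<rho>\<close>.\<close>

locale picard = feedback_setting \<iota> A \<alpha> e Arc N Crc CN n \<zeta>1 \<zeta>2 \<delta>1 \<delta>2 S U lam
  for \<iota> :: "'v::{real_inner, banach, second_countable_topology} \<Rightarrow>\<^sub>L
                'h::{real_inner, banach, second_countable_topology}"
    and A \<alpha> e Arc N Crc CN n \<zeta>1 \<zeta>2 \<delta>1 \<delta>2 S U lam +
  fixes CP \<beta> \<rho> r :: real and y0 :: 'v
  assumes lam_pos: "0 < lam" and CP_pos: "0 < CP"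
    and P_bound: "norm (oblique_proj U (orthogonal_comp (Esp \<iota> e S)) h) \<le> CP * norm h"
    and gap: "i \<notin> J \<Longrightarrow> 2 * \<beta> \<le> evl i"
    and \<beta>_ge: "evl 0 + 1 \<le> \<beta>"
    and contr: "0 \<le> \<delta> \<Longrightarrow> bnd \<beta> \<rho> u1 \<Longrightarrow> bnd \<beta> \<rho> u2 \<Longrightarrow> bnd \<beta> \<delta> (\<lambda>t. u1 t - u2 t) \<Longrightarrow>
      bndF \<beta> (1 / (8 * (1 + CP)) * \<delta>) (\<lambda>s. K u1 s - K u2 s)"
    and r_def: "r = (8 * (lam * (1 + CP) * norm \<iota>) + 4) * norm y0"
    and radius: "2 * r \<le> \<rho>"
begin

lemma \<beta>_nonneg: "0 \<le> \<beta>" using \<beta>_ge evl_nonneg[of 0] by linarith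

lemma r_nonneg: "0 \<le> r"
  using lam_pos CP_pos by (simp add: r_def)

lemma \<rho>_nonneg: "0 \<le> \<rho>" and r_le_\<rho>: "r \<le> \<rho>" using radius r_nonneg by linarith+

text \<open>The free flow with extra damping \<open>lam\<close> on the modes in \<open>S\<close>; on
  these modes it already is the solution of the closed loop.\<close>

definition z :: "real \<Rightarrow> 'v" where
  "z = (SOME z. \<forall>t\<ge>0. \<forall>i. cf i (z t) = exp (- (evl i + (if i \<in> J then lam else 0)) * t) * cf i y0)"

lemma z: "0 \<le> t \<Longrightarrow> cf i (z t) = exp (- (evl i + (if i \<in> J then lam else 0)) * t) * cf i y0"
proof -
  have "\<exists>z. \<forall>t\<ge>0. \<forall>i. cf i (z t) = exp (- (evl i + (if i \<in> J then lam else 0)) * t) * cf i y0"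
    using lam_pos by (intro ex_damped) auto
  from someI_ex[OF this] show "0 \<le> t \<Longrightarrow> ?thesis" unfolding z_def by blast
qed

lemma bnd_z: "bnd \<beta> (norm y0) z"
proof -
  have D: "continuous_on {0..t} z" "norm (z t) \<le> exp (- evl 0 * t) * norm y0" "AE s in Lo t. z s \<in> DA"
    "wsq \<beta> (\<lambda>s. Aop (z s)) t
      \<le> ennreal (grow \<beta> t * (norm y0)^2)" if t: "0 \<le> t" for t
    using damped_props[of "\<lambda>i. if i \<in> J then lam else 0" \<beta> t z y0] z \<beta>_ge lam_pos t by auto
  show ?thesis
    unfolding bnd_def
  proof (intro conjI allI impI)
    show "continuous_on {0..} z" by (rule continuous_on_halfline[OF D(1)])
    fix t :: real assume t: "0 \<le> t"
    show "AE s in Lo t. z s \<in> DA" by (rule D(3)[OF t])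
    have "exp (- evl 0 * t) \<le> decay t"
      unfolding exp_le_cancel_iff using t by (intro mult_right_mono) auto
    then have "exp (- evl 0 * t) * norm y0 \<le> norm y0 * decay t"
      by (simp only: mult.commute[of "norm y0"]) (rule mult_right_mono, auto)
    with D(2)[OF t] show "norm (z t) \<le> norm y0 * decay t" by linarith
    show "wsq \<beta> (\<lambda>s. Aop (z s)) t
      \<le> ennreal ((norm y0)^2 * grow \<beta> t)"
      using D(4)[OF t] by (simp add: mult.commute)
  qed
qed

lemma continuous_z: "0 \<le> t \<Longrightarrow> continuous_on {0..t} z"
  by (rule bndD(1)[OF bnd_z])

lemma bounded_linear_PE: "bounded_linear PE"
  unfolding PE_def
  by (intro bounded_linear_sum bounded_linear_compose[OF bounded_linear_scaleR_left bounded_linear_inner_left])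

lemma mild_z: "mild T y0 (\<lambda>s. (- lam) *\<^sub>R PE (\<iota> (z s))) z"
  unfolding mild_def
proof (intro ballI allI)
  fix t i assume "t \<in> {0..T}"
  then have t: "0 \<le> t" by simp
  show "cf i (z t) = exp (- evl i * t) * cf i y0
      + (LINT s|Lo t. exp (- evl i * (t - s)) * ((- lam) *\<^sub>R PE (\<iota> (z s)) \<bullet> ef i))"
  proof (cases "i \<in> J")
    case False
    then show ?thesis using z[OF t, of i] by (simp add: PE_inner)
  next
    case True
    have "(LINT s|Lo t. exp (- evl i * (t - s)) * ((- lam) *\<^sub>R PE (\<iota> (z s)) \<bullet> ef i))
        = (LINT s|Lo t. (exp (- evl i * t) * cf i y0) * (- lam * exp (- lam * s)))"
    proof (intro LINT_cong refl)
      fix s assume "s \<in> space (Lo t)"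
      then have s: "0 \<le> s" by simp
      have "exp (- evl i * (t - s)) * exp (- (evl i + lam) * s) = exp (- evl i * t) * exp (- lam * s)"
        unfolding mult_exp_exp by (simp add: algebra_simps)
      then show "exp (- evl i * (t - s)) * ((- lam) *\<^sub>R PE (\<iota> (z s)) \<bullet> ef i)
          = (exp (- evl i * t) * cf i y0) * (- lam * exp (- lam * s))"
        using True z[OF s, of i] by (simp add: PE_inner cf_def[symmetric] mult_ac)
    qed
    also have "\<dots> = (exp (- evl i * t) * cf i y0) * (exp (- lam * t) - 1)"
      by (subst LINT_cmult)
         (simp only: integral_exp(2)[OF t] mult_zero_right exp_zero)
    finally have "exp (- evl i * t) * cf i y0 + (LINT s|Lo t. exp (- evl i * (t - s)) * ((- lam) *\<^sub>R PE (\<iota> (z s)) \<bullet> ef i))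
        = (exp (- evl i * t) * exp (- lam * t)) * cf i y0" by (simp add: algebra_simps)
    then show ?thesis using z[OF t, of i] True unfolding mult_exp_exp by (simp add: algebra_simps)
  qed
qed

section \<open>The fixed-point map and its iterates\<close>

definition G :: "(real \<Rightarrow> 'v) \<Rightarrow> real \<Rightarrow> 'h" where "G y s = - (K y s - P (K y s))"

text \<open>The damping is evaluated at \<open>z\<close> instead of \<open>y\<close>; by
  \<open>Py_eq\<close> this makes no difference at the fixed point constructed below. Being fixed,
  it cancels in \<open>F u1 - F u2\<close> and leaves a forcing orthogonal to the eigenspace, as
  \<open>mild_bnd\<close> demands when \<open>evl i\<close> is small for some mode in
  \<open>S\<close>.\<close>

definition F :: "(real \<Rightarrow> 'v) \<Rightarrow> real \<Rightarrow> 'h" where "F y s = G y s - lam *\<^sub>R P (\<iota> (z s))"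

definition \<Phi> :: "(real \<Rightarrow> 'v) \<Rightarrow> real \<Rightarrow> 'v" where "\<Phi> y = (SOME u. \<forall>T. mild T y0 (F y) u)"

lemma norm_diff_P: "norm (h - P h) \<le> (1 + CP) * norm h"
  using norm_triangle_ineq4[of h "P h"] P_bound[of h] by (simp add: distrib_right)

lemma G_diff: "G u1 s - G u2 s = - ((K u1 s - K u2 s) - P (K u1 s - K u2 s))"
  by (simp add: G_def linear_diff[OF linear_P])

lemma G_bndF:
  assumes "0 \<le> \<delta>" "bnd \<beta> \<rho> u1" "bnd \<beta> \<rho> u2" "bnd \<beta> \<delta> (\<lambda>t. u1 t - u2 t)"
  shows "bndF \<beta> (\<delta> / 8) (\<lambda>s. G u1 s - G u2 s)"
proof -
  have c: "bndF \<beta> (1 / (8 * (1 + CP)) * \<delta>) (\<lambda>s. K u1 s - K u2 s)" by (rule contr[OF assms])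
  have "bndF \<beta> ((1 + CP) * (1 / (8 * (1 + CP)) * \<delta>)) (\<lambda>s. G u1 s - G u2 s)"
  proof (rule bndF_scale[OF c])
    show "norm (G u1 s - G u2 s) \<le> (1 + CP) * norm (K u1 s - K u2 s)" for s
      unfolding G_diff norm_minus_cancel by (rule norm_diff_P)
    fix t :: real assume "0 \<le> t"
    then have m [measurable]: "(\<lambda>s. K u1 s - K u2 s) \<in> BM t" using c by (simp add: bndF_def)
    have Pm: "P \<in> borel_measurable borel"
      by (intro borel_measurable_continuous_onI linear_continuous_on bounded_linear_P)
    have [measurable]: "(\<lambda>s. P (K u1 s - K u2 s)) \<in> BM t" by (rule measurable_compose[OF m Pm])
    show "(\<lambda>s. G u1 s - G u2 s) \<in> BM t" unfolding G_diff by measurable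
  qed
  moreover have "(1 + CP) * (1 / (8 * (1 + CP)) * \<delta>) = \<delta> / 8"
  proof -
    have "c * (1 / (8 * c) * \<delta>) = \<delta> / 8" if "c \<noteq> 0" for c :: real using that by simp
    from this[of "1 + CP"] show ?thesis using CP_pos by linarith
  qed
  ultimately show ?thesis by (simp only:)
qed

lemma G_zero: "G (\<lambda>_. 0) = (\<lambda>_. 0)"
  by (rule ext) (simp add: G_def K_zero linear_0[OF linear_P])

lemma continuous_Pz: "0 \<le> t \<Longrightarrow> continuous_on {0..t} (\<lambda>s. P (\<iota> (z s)))"
  by (intro bounded_linear.continuous_on[OF bounded_linear_P] continuous_intros continuous_z)

lemma L2_Pz: "L2_on T (\<lambda>s. lam *\<^sub>R P (\<iota> (z s)))"
  by (intro L2_on_continuous continuous_intros continuous_Pz)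

lemma L2_PEz: "L2_on T (\<lambda>s. (- lam) *\<^sub>R PE (\<iota> (z s)))"
  by (intro L2_on_continuous continuous_intros bounded_linear.continuous_on[OF bounded_linear_PE] continuous_z)

lemma F_L2: "bnd \<beta> \<rho> u \<Longrightarrow> L2_on T (F u)"
proof -
  assume u: "bnd \<beta> \<rho> u"
  then have "bndF \<beta> (\<rho> / 8) (\<lambda>s. G u s - G (\<lambda>_. 0) s)"
    by (intro G_bndF \<rho>_nonneg bnd_zero) auto
  then have "L2_on T (G u)" using bndF_L2[OF _ \<beta>_nonneg] by (simp add: G_zero)
  then show ?thesis unfolding F_def by (intro L2_on_diff L2_Pz)
qed

lemma \<Phi>_mild: "bnd \<beta> \<rho> u \<Longrightarrow> mild T y0 (F u) (\<Phi> u)"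
  using someI_ex[OF ex_mild[OF F_L2], of u y0] unfolding \<Phi>_def by blast

lemma \<Phi>_contr:
  assumes "0 \<le> \<delta>" "bnd \<beta> \<rho> u1" "bnd \<beta> \<rho> u2" "bnd \<beta> \<delta> (\<lambda>t. u1 t - u2 t)"
  shows "bnd \<beta> (\<delta> / 4) (\<lambda>t. \<Phi> u1 t - \<Phi> u2 t)"
proof -
  have "bnd \<beta> (2 * (\<delta> / 8)) (\<lambda>t. \<Phi> u1 t - \<Phi> u2 t)"
  proof (rule mild_bnd[OF _ G_bndF[OF assms] _ \<beta>_nonneg])
    show "mild T 0 (\<lambda>s. G u1 s - G u2 s) (\<lambda>t. \<Phi> u1 t - \<Phi> u2 t)" for T
      using mild_diff[OF \<Phi>_mild[OF assms(2)] \<Phi>_mild[OF assms(3)] F_L2[OF assms(2)] F_L2[OF assms(3)], of T]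
      by (simp add: F_def)
    show "2 * \<beta> \<le> evl i \<or> (\<forall>s. (G u1 s - G u2 s) \<bullet> ef i = 0)" for i
      using gap[of i] by (cases "i \<in> J") (auto simp: G_diff inner_diff_P simp del: minus_diff_eq)
  qed (use assms in simp)
  then show ?thesis by simp
qed

lemma norm_PE_le: "norm (PE h) \<le> norm h"
proof (rule power2_le_imp_le)
  show "(norm (PE h))^2 \<le> (norm h)^2"
    unfolding PE_def H.norm_sum_b[OF finite_J] by (rule H.bessel) simp
qed simp

text \<open>The fixed damping has components in \<open>S\<close>, so \<open>mild_bnd\<close> cannot
  be applied to it alone. Subtracting \<open>z\<close> leaves the forcing
  \<open>lam * (1 - P) PE z\<close>, which is orthogonal to the eigenspace and of size
  \<open>c1 * norm y0\<close>.\<close>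

lemma \<Phi>_zero: "bnd \<beta> (r / 2) (\<Phi> (\<lambda>_. 0))"
proof -
  define c1 where "c1 = lam * (1 + CP) * norm \<iota>"
  have c1: "0 \<le> c1" using lam_pos CP_pos by (simp add: c1_def)
  define f where "f s = lam *\<^sub>R (PE (\<iota> (z s)) - P (PE (\<iota> (z s))))" for s
  have zero: "bnd \<beta> \<rho> (\<lambda>_. 0)" by (rule bnd_zero[OF \<rho>_nonneg])
  have cf: "continuous_on {0..t} f" if "0 \<le> t" for t
    unfolding f_def using that
    by (intro continuous_intros bounded_linear.continuous_on[OF bounded_linear_P]
        bounded_linear.continuous_on[OF bounded_linear_PE] continuous_z) auto
  have bf: "bndF \<beta> (c1 * norm y0) f"
    unfolding bndF_def
  proof (intro allI impI conjI)
    fix t :: real assume t: "0 \<le> t"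
    show "f \<in> BM t" using integrable_continuous_Lo[OF cf[OF t]] by simp
    define E where "E s = decay s" for s
    have "wsq \<beta> f t
        \<le> (\<integral>\<^sup>+ s. ennreal ((c1 * norm y0)^2) * ennreal (exp (\<beta> * s) * (E s)^2) \<partial>Lo t)"
    proof (rule nn_integral_mono)
      fix s assume "s \<in> space (Lo t)"
      then have s: "0 \<le> s" by simp
      have "norm (f s) \<le> lam * ((1 + CP) * norm (PE (\<iota> (z s))))"
        unfolding f_def norm_scaleR using lam_pos norm_diff_P by (simp add: mult_left_mono)
      also have "\<dots> \<le> lam * ((1 + CP) * (norm \<iota> * (norm y0 * E s)))"
        using lam_pos CP_pos bndD(3)[OF bnd_z s]
        by (intro mult_left_mono order_trans[OF norm_PE_le] order_trans[OF norm_incl]) (auto simp: E_def)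
      finally have "norm (f s) \<le> (c1 * norm y0) * E s" by (simp add: c1_def mult_ac)
      then have "(norm (f s))^2 \<le> ((c1 * norm y0) * E s)^2" by (intro power_mono) auto
      then have "exp (\<beta> * s) * (norm (f s))^2 \<le> (c1 * norm y0)^2 * (exp (\<beta> * s) * (E s)^2)"
        by (simp add: power_mult_distrib mult_ac)
      then show "ennreal (exp (\<beta> * s) * (norm (f s))^2) \<le> ennreal ((c1 * norm y0)^2) * ennreal (exp (\<beta> * s) * (E s)^2)"
        by (simp add: ennreal_mult[symmetric] ennreal_leI)
    qed
    also have "\<dots> = ennreal ((c1 * norm y0)^2) * (\<integral>\<^sup>+ s. ennreal (exp (\<beta> * s) * (E s)^2) \<partial>Lo t)"
      unfolding E_def by (rule nn_integral_cmult) measurable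
    also have "\<dots> \<le> ennreal ((c1 * norm y0)^2) * ennreal (grow \<beta> t / (\<beta> - evl 0))"
      unfolding E_def by (intro mult_left_mono nn_integral_decay \<beta>_ge t) simp
    also have "\<dots> \<le> ennreal ((c1 * norm y0)^2) * ennreal (grow \<beta> t)"
    proof (intro mult_left_mono ennreal_leI)
      show "grow \<beta> t / (\<beta> - evl 0) \<le> grow \<beta> t"
        using \<beta>_ge divide_left_mono[of 1 "\<beta> - evl 0" "grow \<beta> t"] by simp
    qed simp
    finally show "wsq \<beta> f t
        \<le> ennreal ((c1 * norm y0)^2 * grow \<beta> t)"
      by (simp add: ennreal_mult)
  qed
  have "bnd \<beta> (2 * (c1 * norm y0)) (\<lambda>t. \<Phi> (\<lambda>_. 0) t - z t)"
  proof (rule mild_bnd[OF _ bf _ \<beta>_nonneg])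
    have "(\<lambda>s. F (\<lambda>_. 0) s - (- lam) *\<^sub>R PE (\<iota> (z s))) = f"
      by (auto simp: F_def G_zero f_def P_PE algebra_simps)
    then show "mild T 0 f (\<lambda>t. \<Phi> (\<lambda>_. 0) t - z t)" for T
      using mild_diff[OF \<Phi>_mild[OF zero] mild_z F_L2[OF zero] L2_PEz, of T] by simp
    show "2 * \<beta> \<le> evl i \<or> (\<forall>s. f s \<bullet> ef i = 0)" for i
      using gap[of i] by (cases "i \<in> J") (auto simp: f_def inner_diff_P)
  qed (use c1 in simp)
  \<comment> \<open>Origin of \<open>r\<close>: \<open>bnd_add\<close> combines the radii
    \<open>2 * c1 * norm y0\<close> and \<open>norm y0\<close> into
    \<open>(4 * c1 + 2) * norm y0\<close>, which is half of \<open>r\<close>.\<close>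
  then have "bnd \<beta> (r / 2) (\<lambda>t. (\<Phi> (\<lambda>_. 0) t - z t) + z t)"
  proof (rule bnd_add[OF _ bnd_z])
    have "2 * (2 * c1)^2 + 2 \<le> (4 * c1 + 2)^2" using c1 by (simp add: power2_eq_square algebra_simps)
    then have "(2 * (2 * c1)^2 + 2) * (norm y0)^2 \<le> (4 * c1 + 2)^2 * (norm y0)^2" by (rule mult_right_mono) simp
    then have "2 * (2 * (c1 * norm y0))^2 + 2 * (norm y0)^2 \<le> ((4 * c1 + 2) * norm y0)^2"
    proof -
      have "2 * (2 * (c1 * norm y0))^2 + 2 * (norm y0)^2 = (2 * (2 * c1)^2 + 2) * (norm y0)^2"
        by (simp add: power2_eq_square algebra_simps)
      also note \<open>\<dots> \<le> (4 * c1 + 2)^2 * (norm y0)^2\<close>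
      also have "(4 * c1 + 2)^2 * (norm y0)^2 = ((4 * c1 + 2) * norm y0)^2"
        by (rule power_mult_distrib[symmetric])
      finally show ?thesis .
    qed
    moreover have "r / 2 = (4 * c1 + 2) * norm y0" by (simp add: r_def c1_def algebra_simps)
    ultimately show "2 * (2 * (c1 * norm y0))^2 + 2 * (norm y0)^2 \<le> (r / 2)^2"
      by (simp only:)
  qed (use r_nonneg in simp)
  then show ?thesis by simp
qed

definition ys :: "nat \<Rightarrow> real \<Rightarrow> 'v" where "ys k = (\<Phi> ^^ k) (\<lambda>_. 0)"

lemma ys_0: "ys 0 = (\<lambda>_. 0)" and ys_Suc: "ys (Suc k) = \<Phi> (ys k)"
  by (simp_all add: ys_def)

text \<open>The contraction contributes \<open>r / 4\<close> and the first iterate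
  \<open>r / 2\<close>; \<open>bnd_add\<close> accepts \<open>r\<close> because
  \<open>2 / 16 + 2 / 4 \<le> 1\<close>.\<close>

lemma ys_bnd: "bnd \<beta> r (ys k)"
proof (induction k)
  case 0
  then show ?case by (simp add: ys_0 bnd_zero r_nonneg)
next
  case (Suc k)
  have "bnd \<beta> (r / 4) (\<lambda>t. \<Phi> (ys k) t - \<Phi> (\<lambda>_. 0) t)"
    using Suc by (intro \<Phi>_contr r_nonneg bnd_mono[OF Suc r_nonneg r_le_\<rho>] bnd_zero \<rho>_nonneg) simp
  then have "bnd \<beta> r (\<lambda>t. (\<Phi> (ys k) t - \<Phi> (\<lambda>_. 0) t) + \<Phi> (\<lambda>_. 0) t)"
    by (rule bnd_add[OF _ \<Phi>_zero _ r_nonneg]) (simp add: power_divide)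
  then show ?case by (simp add: ys_Suc)
qed

lemma ys_bnd_\<rho>: "bnd \<beta> \<rho> (ys k)"
  by (rule bnd_mono[OF ys_bnd r_nonneg r_le_\<rho>])

lemma ys_step: "bnd \<beta> (r / 4 ^ k) (\<lambda>t. ys (Suc k) t - ys k t)"
proof (induction k)
  case 0
  then show ?case using ys_bnd[of 1] by (simp add: ys_0)
next
  case (Suc k)
  from \<Phi>_contr[OF _ ys_bnd_\<rho> ys_bnd_\<rho> Suc] r_nonneg
  show ?case by (simp add: ys_Suc mult.commute)
qed

text \<open>Summation of the geometric increments by \<open>bnd_add\<close>. Splitting off the first
  increment keeps the bound independent of \<open>m\<close>: the ratio \<open>1 / 4\<close>
  reproduces the factor 2 since \<open>2 * (1 / 2)^2 + 2 \<le> 2^2\<close>.\<close>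

lemma ys_diff: "bnd \<beta> (2 * (r / 4 ^ k)) (\<lambda>t. ys (k + m) t - ys k t)"
proof (induction m arbitrary: k)
  case 0
  then show ?case using r_nonneg by (simp add: bnd_zero)
next
  case (Suc m)
  have "bnd \<beta> (2 * (r / 4 ^ k)) (\<lambda>t. (ys (Suc k + m) t - ys (Suc k) t) + (ys (Suc k) t - ys k t))"
  proof (rule bnd_add[OF Suc[of "Suc k"] ys_step])
    have "2 * (2 * (r / 4 ^ Suc k))^2 + 2 * (r / 4 ^ k)^2 = (5 / 2) * (r / 4 ^ k)^2"
      by (simp add: power_divide power_mult_distrib)
    also have "\<dots> \<le> (2 * (r / 4 ^ k))^2"
      unfolding power_mult_distrib by (intro mult_right_mono) auto
    finally show "2 * (2 * (r / 4 ^ Suc k))^2 + 2 * (r / 4 ^ k)^2 \<le> (2 * (r / 4 ^ k))^2" .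
  qed (use r_nonneg in simp)
  then show ?case by simp
qed

end

lemma convergent_if_norm_diff_summable:
  fixes f :: "nat \<Rightarrow> 'a::banach"
  assumes "summable (\<lambda>k. norm (f (Suc k) - f k))"
  shows "convergent f"
proof -
  have "(\<lambda>k. (\<Sum>j<k. f (Suc j) - f j) + f 0) \<longlonglongrightarrow> (\<Sum>j. f (Suc j) - f j) + f 0"
    by (intro tendsto_intros summable_LIMSEQ summable_norm_cancel[OF assms])
  then show ?thesis unfolding sum_lessThan_telescope by (auto simp: convergent_def)
qed

section \<open>The limit of the iterates\<close>

context picard begin

definition y :: "real \<Rightarrow> 'v" where "y t = lim (\<lambda>k. ys k t)"

lemma exp_decay_le_1: "0 \<le> t \<Longrightarrow> decay t \<le> 1"
  by simp

lemma ys_tendsto: "0 \<le> t \<Longrightarrow> (\<lambda>k. ys k t) \<longlonglongrightarrow> y t"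
proof -
  assume t: "0 \<le> t"
  have "summable (\<lambda>k. norm (ys (Suc k) t - ys k t))"
  proof (rule summable_comparison_test')
    show "summable (\<lambda>k. r * (1 / 4) ^ k)" by (intro summable_mult summable_geometric) simp
    fix k
    have "norm (ys (Suc k) t - ys k t) \<le> r / 4 ^ k * decay t"
      by (rule bndD(3)[OF ys_step t])
    also have "\<dots> \<le> r / 4 ^ k" using r_nonneg by (intro mult_left_le exp_decay_le_1 t) simp
    finally show "norm (norm (ys (Suc k) t - ys k t)) \<le> r * (1 / 4) ^ k" by (simp add: power_divide)
  qed
  from convergent_if_norm_diff_summable[OF this] show ?thesis
    unfolding y_def by (simp add: convergent_LIMSEQ_iff)
qed

lemma ys_uniform: "0 \<le> t \<Longrightarrow> norm (y t - ys k t) \<le> 2 * (r / 4 ^ k) * decay t"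
proof (rule LIMSEQ_le_const2)
  assume t: "0 \<le> t"
  show "(\<lambda>m. norm (ys (k + m) t - ys k t)) \<longlonglongrightarrow> norm (y t - ys k t)"
    using LIMSEQ_ignore_initial_segment[OF ys_tendsto[OF t], of k]
    by (intro tendsto_intros) (simp add: add.commute)
  show "\<exists>N. \<forall>m\<ge>N. norm (ys (k + m) t - ys k t) \<le> 2 * (r / 4 ^ k) * decay t"
    using bndD(3)[OF ys_diff t] by blast
qed

lemma continuous_y: "continuous_on {0..} y"
proof (rule uniform_limit_theorem)
  show "\<forall>\<^sub>F k in sequentially. continuous_on {0..} (ys k)"
    using ys_bnd by (simp add: bnd_def)
  show "uniform_limit {0..} ys y sequentially"
  proof (rule uniform_limitI)
    fix \<epsilon> :: real assume "0 < \<epsilon>"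
    have "(\<lambda>k. 2 * r * (1 / 4) ^ k) \<longlonglongrightarrow> 2 * r * 0"
      by (intro tendsto_intros LIMSEQ_power_zero) simp
    then have "\<forall>\<^sub>F k in sequentially. 2 * r * (1 / 4) ^ k < \<epsilon>"
      using \<open>0 < \<epsilon>\<close> by (intro order_tendstoD(2)) auto
    then show "\<forall>\<^sub>F k in sequentially. \<forall>t\<in>{0..}. dist (ys k t) (y t) < \<epsilon>"
    proof eventually_elim
      case (elim k)
      show ?case
      proof
        fix t :: real assume "t \<in> {0..}"
        then have t: "0 \<le> t" by simp
        have "norm (y t - ys k t) \<le> 2 * (r / 4 ^ k) * decay t" by (rule ys_uniform[OF t])
        also have "\<dots> \<le> 2 * (r / 4 ^ k)" using r_nonneg by (intro mult_left_le exp_decay_le_1 t) simp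
        also have "\<dots> = 2 * r * (1 / 4) ^ k" by (simp add: power_divide)
        finally show "dist (ys k t) (y t) < \<epsilon>" using elim by (simp add: dist_norm norm_minus_commute)
      qed
    qed
  qed
qed simp

lemma AE_ys_domA: "0 \<le> t \<Longrightarrow> AE s in Lo t. \<forall>k. ys k s \<in> DA"
  using bndD(2)[OF ys_bnd] by (simp add: AE_all_countable)

lemma measurable_opA_ys [measurable]: "0 \<le> t \<Longrightarrow> (\<lambda>s. Aop (ys k s)) \<in> BM t"
  by (rule measurable_compose[OF bndD(5)[OF ys_bnd] measurable_opA])

text \<open>Weighting the squared increments with \<open>2 ^ k\<close> makes the increments themselves summable
  almost everywhere.\<close>

lemma AE_opA_ys_tendsto:
  assumes t: "0 \<le> t"
  shows "AE s in Lo t. y s \<in> DA \<and> (\<lambda>k. Aop (ys k s)) \<longlonglongrightarrow> Aop (y s)"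
proof -
  define G' where "G' = grow \<beta> t"
  define a where "a k s = norm (Aop (ys (Suc k) s) - Aop (ys k s))" for k s
  have [measurable]: "a k \<in> BM t" for k
    unfolding a_def using t by measurable
  have int: "(\<integral>\<^sup>+ s. ennreal (2 ^ k) * ennreal (exp (\<beta> * s) * (a k s)^2) \<partial>Lo t) \<le> ennreal (r^2 * G' * (1 / 8) ^ k)" for k
  proof -
    have "(\<integral>\<^sup>+ s. ennreal (2 ^ k) * ennreal (exp (\<beta> * s) * (a k s)^2) \<partial>Lo t)
        = ennreal (2 ^ k) * (\<integral>\<^sup>+ s. ennreal (exp (\<beta> * s) * (a k s)^2) \<partial>Lo t)"
      by (rule nn_integral_cmult) measurable
    also have "(\<integral>\<^sup>+ s. ennreal (exp (\<beta> * s) * (a k s)^2) \<partial>Lo t)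
        = wsq \<beta> (\<lambda>s. Aop (ys (Suc k) s - ys k s)) t"
      by (rule nn_integral_cong_AE, use AE_ys_domA[OF t] in eventually_elim) (simp add: a_def domA_diff)
    also have "ennreal (2 ^ k) * \<dots> \<le> ennreal (2 ^ k) * ennreal ((r / 4 ^ k)^2 * G')"
      unfolding G'_def by (intro mult_left_mono bndD(4)[OF ys_step t]) simp
    also have "\<dots> = ennreal (2 ^ k * ((r / 4 ^ k)^2 * G'))" by (simp add: ennreal_mult G'_def)
    also have "2 ^ k * ((r / 4 ^ k)^2 * G') = r^2 * G' * (1 / 8) ^ k"
    proof -
      have "(2::real) ^ k * ((1 / 4) ^ k * (1 / 4) ^ k) = (1 / 8) ^ k"
        unfolding power_mult_distrib[symmetric] by simp
      moreover have "r / 4 ^ k = r * (1 / 4) ^ k" by (simp add: power_divide)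
      ultimately show ?thesis by (simp only: power2_eq_square) (simp add: mult_ac)
    qed
    finally show ?thesis .
  qed
  have "(\<integral>\<^sup>+ s. (\<Sum>k. ennreal (2 ^ k) * ennreal (exp (\<beta> * s) * (a k s)^2)) \<partial>Lo t)
      = (\<Sum>k. \<integral>\<^sup>+ s. ennreal (2 ^ k) * ennreal (exp (\<beta> * s) * (a k s)^2) \<partial>Lo t)"
    by (rule nn_integral_suminf) measurable
  also have "\<dots> \<le> (\<Sum>k. ennreal (r^2 * G' * (1 / 8) ^ k))"
    by (intro suminf_le int) auto
  also have "\<dots> < top"
    unfolding less_top[symmetric]
    by (intro ennreal_suminf_neq_top summable_mult summable_geometric) (auto simp: G'_def)
  finally have fin: "(\<integral>\<^sup>+ s. (\<Sum>k. ennreal (2 ^ k) * ennreal (exp (\<beta> * s) * (a k s)^2)) \<partial>Lo t) \<noteq> \<infinity>" by simp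
  have "AE s in Lo t. (\<Sum>k. ennreal (2 ^ k) * ennreal (exp (\<beta> * s) * (a k s)^2)) \<noteq> \<infinity>"
    by (rule nn_integral_noteq_infinite[OF _ fin]) measurable
  moreover have "AE s in Lo t. s \<in> {0<..<t}" by (intro AE_I2) simp
  ultimately show ?thesis using AE_ys_domA[OF t]
  proof eventually_elim
    case (elim s)
    have s: "0 \<le> s" using elim by simp
    have "summable (\<lambda>k. 2 ^ k * (exp (\<beta> * s) * (a k s)^2))"
      using elim(1) by (intro summable_suminf_not_top) (auto simp: ennreal_mult)
    then have "summable (\<lambda>k. 2 ^ k * (exp (\<beta> * s) * (a k s)^2) + (1 / 2) ^ k)"
      by (intro summable_add summable_geometric) auto
    then have "summable (\<lambda>k. a k s)"
    proof (rule summable_comparison_test')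
      fix k :: nat
      have a0: "0 \<le> a k s" by (simp add: a_def)
      \<comment> \<open>Young's inequality, applied below with \<open>q = 2 ^ k\<close>: summability
        of the weighted squares becomes summability of the increments at the price of a geometric
        series.\<close>
      have q: "a k s \<le> q * (a k s)^2 + 1 / q" if "q > 0" for q :: real
      proof -
        have "2 * (a k s * q) \<le> q^2 * (a k s)^2 + 1"
          using zero_le_power2[of "q * a k s - 1"] by (simp add: power2_eq_square algebra_simps)
        moreover have "0 \<le> a k s * q" using a0 that by simp
        ultimately have "a k s * q \<le> q^2 * (a k s)^2 + 1" by linarith
        then have "a k s \<le> (q^2 * (a k s)^2 + 1) / q" using that by (simp add: pos_le_divide_eq)
        also have "\<dots> = q * (a k s)^2 + 1 / q" using that by (simp add: add_divide_distrib power2_eq_square)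
        finally show ?thesis .
      qed
      have "1 \<le> exp (\<beta> * s)" using \<beta>_nonneg s by simp
      then have "1 * (a k s)^2 \<le> exp (\<beta> * s) * (a k s)^2" by (rule mult_right_mono) simp
      then have "2 ^ k * (a k s)^2 \<le> 2 ^ k * (exp (\<beta> * s) * (a k s)^2)" by simp
      moreover have "a k s \<le> 2 ^ k * (a k s)^2 + 1 / 2 ^ k" by (rule q) simp
      ultimately show "norm (a k s) \<le> 2 ^ k * (exp (\<beta> * s) * (a k s)^2) + (1 / 2) ^ k"
        unfolding real_norm_def abs_of_nonneg[OF a0] power_one_over[symmetric] by linarith
    qed
    then have "convergent (\<lambda>k. Aop (ys k s))"
      unfolding a_def by (rule convergent_if_norm_diff_summable)
    then obtain h where h: "(\<lambda>k. Aop (ys k s)) \<longlonglongrightarrow> h" by (auto simp: convergent_def)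
    \<comment> \<open>Closedness of \<open>A\<close>: the pointwise limit \<open>y s\<close> must be
      \<open>invA h\<close>, so it lies in the domain and \<open>A\<close> maps it to
      \<open>h\<close>.\<close>
    from bounded_linear.tendsto[OF bounded_linear_invA this]
    have "(\<lambda>k. ys k s) \<longlonglongrightarrow> invA h" using elim by (simp add: invA_opA)
    then have "y s = invA h" using ys_tendsto[OF s] LIMSEQ_unique by blast
    then show ?case using h by (simp add: invA)
  qed
qed

text \<open>The weighted energy is lower semicontinuous by Fatou, with the almost everywhere
  convergence of \<open>A\<close> along the iterates. Thus the iterates converge in the space in
  which \<open>\<Phi>\<close> contracts, and \<open>y\<close> may be inserted into
  \<open>\<Phi>\<close>.\<close>

lemma y_diff: "bnd \<beta> (2 * (r / 4 ^ k)) (\<lambda>t. y t - ys k t)"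
  unfolding bnd_def
proof (intro conjI allI impI)
  show "continuous_on {0..} (\<lambda>t. y t - ys k t)"
    using ys_bnd[of k] by (intro continuous_intros continuous_y) (simp add: bnd_def)
  fix t :: real assume t: "0 \<le> t"
  show "norm (y t - ys k t) \<le> 2 * (r / 4 ^ k) * decay t" by (rule ys_uniform[OF t])
  show "AE s in Lo t. y s - ys k s \<in> DA"
    using AE_ys_domA[OF t] AE_opA_ys_tendsto[OF t] by eventually_elim (simp add: domA_diff)
  define B where "B = ennreal ((2 * (r / 4 ^ k))^2 * grow \<beta> t)"
  define u where "u m s = ennreal (exp (\<beta> * s) * (norm (Aop (ys (k + m) s) - Aop (ys k s)))^2)" for m s
  have [measurable]: "u m \<in> BM t" for m
    unfolding u_def using t by measurable
  have "(\<integral>\<^sup>+ s. u m s \<partial>Lo t) \<le> B" for m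
  proof -
    have "(\<integral>\<^sup>+ s. u m s \<partial>Lo t) = wsq \<beta> (\<lambda>s. Aop (ys (k + m) s - ys k s)) t"
      by (rule nn_integral_cong_AE, use AE_ys_domA[OF t] in eventually_elim) (simp add: u_def domA_diff)
    also have "\<dots> \<le> B" unfolding B_def by (rule bndD(4)[OF ys_diff t])
    finally show ?thesis .
  qed
  then have "limsup (\<lambda>m. \<integral>\<^sup>+ s. u m s \<partial>Lo t) \<le> B" by (intro Limsup_bounded) simp
  then have le: "liminf (\<lambda>m. \<integral>\<^sup>+ s. u m s \<partial>Lo t) \<le> B"
    by (rule order_trans[OF Liminf_le_Limsup[OF trivial_limit_sequentially]])
  have "wsq \<beta> (\<lambda>s. Aop (y s - ys k s)) t
      = (\<integral>\<^sup>+ s. liminf (\<lambda>m. u m s) \<partial>Lo t)"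
  proof (rule nn_integral_cong_AE, use AE_ys_domA[OF t] AE_opA_ys_tendsto[OF t] in eventually_elim)
    case (elim s)
    then have "(\<lambda>m. Aop (ys (k + m) s)) \<longlonglongrightarrow> Aop (y s)"
      using LIMSEQ_ignore_initial_segment[of "\<lambda>m. Aop (ys m s)" _ k] by (simp add: add.commute)
    then have "(\<lambda>m. u m s) \<longlonglongrightarrow> ennreal (exp (\<beta> * s) * (norm (Aop (y s) - Aop (ys k s)))^2)"
      unfolding u_def by (intro tendsto_intros)
    then show ?case using elim by (simp add: lim_imp_Liminf domA_diff)
  qed
  also have "\<dots> \<le> liminf (\<lambda>m. \<integral>\<^sup>+ s. u m s \<partial>Lo t)" by (rule nn_integral_liminf) measurable
  also note le
  finally show "wsq \<beta> (\<lambda>s. Aop (y s - ys k s)) t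
      \<le> ennreal ((2 * (r / 4 ^ k))^2 * grow \<beta> t)" by (simp add: B_def)
qed

lemma y_bnd: "bnd \<beta> (2 * r) y"
  using y_diff[of 0] by (simp add: ys_0)

lemma y_bnd_\<rho>: "bnd \<beta> \<rho> y"
  by (rule bnd_mono[OF y_bnd _ radius]) (use r_nonneg in simp)

lemma \<Phi>_fixed: "0 \<le> t \<Longrightarrow> \<Phi> y t = y t"
proof -
  assume t: "0 \<le> t"
  have "(\<lambda>k. ys (Suc k) t) \<longlonglongrightarrow> \<Phi> y t"
  proof (rule LIM_zero_cancel, rule Lim_null_comparison)
    show "\<forall>\<^sub>F k in sequentially. norm (ys (Suc k) t - \<Phi> y t) \<le> r / 2 * (1 / 4) ^ k"
    proof (intro always_eventually allI)
      fix k
      have "bnd \<beta> (2 * (r / 4 ^ k) / 4) (\<lambda>t. \<Phi> y t - \<Phi> (ys k) t)"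
        using r_nonneg by (intro \<Phi>_contr y_bnd_\<rho> ys_bnd_\<rho> y_diff) simp
      from bndD(3)[OF this t]
      have "norm (ys (Suc k) t - \<Phi> y t) \<le> 2 * (r / 4 ^ k) / 4 * decay t"
        by (simp add: ys_Suc norm_minus_commute)
      also have "\<dots> \<le> 2 * (r / 4 ^ k) / 4" using r_nonneg by (intro mult_left_le exp_decay_le_1 t) simp
      also have "\<dots> = r / 2 * (1 / 4) ^ k" by (simp add: power_divide)
      finally show "norm (ys (Suc k) t - \<Phi> y t) \<le> r / 2 * (1 / 4) ^ k" .
    qed
    have "(\<lambda>k. r / 2 * (1 / 4) ^ k) \<longlonglongrightarrow> r / 2 * 0" by (intro tendsto_intros LIMSEQ_power_zero) simp
    then show "(\<lambda>k. r / 2 * (1 / 4) ^ k) \<longlonglongrightarrow> 0" by simp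
  qed
  then show ?thesis using LIMSEQ_Suc[OF ys_tendsto[OF t]] LIMSEQ_unique by blast
qed

lemma y_mild: "mild T y0 (F y) y"
  using \<Phi>_mild[OF y_bnd_\<rho>, of T] \<Phi>_fixed by (simp add: mild_def)

text \<open>On a mode in \<open>S\<close> the forcings of \<open>y\<close> and \<open>z\<close>
  coincide: \<open>G\<close> has no component there and \<open>P\<close> leaves these coefficients
  unchanged. So \<open>y\<close> and \<open>z\<close> have the same coefficients in
  \<open>S\<close>, which are all that \<open>P\<close> sees, and the fixed damping is the actual
  feedback.\<close>

lemma Py_eq: "0 \<le> t \<Longrightarrow> P (\<iota> (y t)) = P (\<iota> (z t))"
proof -
  assume t: "0 \<le> t"
  have m: "mild t (y0 - y0) (\<lambda>s. F y s - (- lam) *\<^sub>R PE (\<iota> (z s))) (\<lambda>t. y t - z t)"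
    by (rule mild_diff[OF y_mild mild_z F_L2[OF y_bnd_\<rho>] L2_PEz])
  have "\<iota> (y t) \<bullet> ef j = \<iota> (z t) \<bullet> ef j" if j: "j \<in> J" for j
  proof -
    have G0: "G y s \<bullet> ef j = 0" for s using inner_diff_P[OF j, of "K y s"] unfolding G_def inner_minus_left by simp
    have "(F y s - (- lam) *\<^sub>R PE (\<iota> (z s))) \<bullet> ef j = 0" for s
      unfolding F_def inner_diff_left inner_scaleR_left inner_P[OF j] PE_inner G0 using j by simp
    then have "cf j (y t - z t) = 0" using m t by (simp add: mild_def)
    then show ?thesis unfolding cf_linear by (simp add: cf_def)
  qed
  then have "PE (\<iota> (y t)) = PE (\<iota> (z t))" by (simp add: PE_def)
  then show ?thesis by (metis P_PE)
qed

lemma y_strong: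
  assumes T: "0 < T"
  shows "strong_solution \<iota> A Arc N FB y0 T y"
  unfolding strong_solution_def
proof (intro conjI exI[of _ "\<lambda>s. F y s - Aop (y s)"])
  have T0: "0 \<le> T" using T by simp
  note FL = F_L2[OF y_bnd_\<rho>, of T]
  note mild = y_mild[of T]
  show c: "continuous_on {0..T} y" by (rule bndD(1)[OF y_bnd T0])
  show "y 0 = y0"
    by (rule cf_ext) (use mild T in \<open>simp add: mild_def\<close>)
  show dom: "AE t in Lo T. y t \<in> DA" by (rule bndD(2)[OF y_bnd T0])
  have "bndF \<beta> (2 * r) (\<lambda>t. Aop (y t))"
    unfolding bndF_def using bndD(4)[OF y_bnd] measurable_compose[OF bndD(5)[OF y_bnd] measurable_opA] by blast
  then show Ay: "L2_on T (\<lambda>t. Aop (y t))" by (rule bndF_L2[OF _ \<beta>_nonneg])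
  show "L2_on T (\<lambda>s. F y s - Aop (y s))"
    and "\<forall>t\<in>{0..T}. \<iota> (y t) = \<iota> y0 + (LINT s|Lo t. F y s - Aop (y s))"
    by (rule mild_imp_integral_equation[OF mild FL c dom Ay])+
  have "AE t in Lo T. t \<in> {0<..<T}" by (intro AE_I2) simp
  then show "AE t in Lo T. F y t - Aop (y t) + Aop (y t) + blinfun_apply (Arc t) (y t) + N t (y t)
      - FB t (y t) = 0"
    using dom
  proof eventually_elim
    case (elim t)
    then have "K y t = Arc t (y t) + N t (y t)" by (simp add: K_def)
    then show ?case using elim by (simp add: feedback_eq F_def G_def Py_eq)
  qed
qed

lemma y_decay: "0 \<le> t \<Longrightarrow> norm (y t) \<le> 2 * r * decay t"
  by (rule bndD(3)[OF y_bnd])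

end

section \<open>Uniqueness\<close>

text \<open>Gronwall's lemma with an integrable kernel: just after the last zero of \<open>G\<close> the kernel has
  mass less than \<open>1/2\<close>.\<close>

lemma gronwall_zero:
  fixes G \<kappa> :: "real \<Rightarrow> real"
  assumes G0: "\<And>t. 0 \<le> G t" and mono: "\<And>s t. 0 \<le> s \<Longrightarrow> s \<le> t \<Longrightarrow> t \<le> T \<Longrightarrow> G s \<le> G t"
    and \<kappa>0: "\<And>s. 0 \<le> \<kappa> s" and \<kappa>: "integrable (Lo T) \<kappa>"
    and le: "\<And>t. t \<in> {0..T} \<Longrightarrow> ennreal (G t) \<le> (\<integral>\<^sup>+ s. ennreal (\<kappa> s * G s) \<partial>Lo t)"
    and t: "t \<in> {0..T}"
  shows "G t = 0"
proof -
  have T: "0 \<le> T" using t by simp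
  define Z where "Z = {t \<in> {0..T}. G t = 0}"
  have "0 \<in> Z" using le[of 0] T G0[of 0] by (simp add: Z_def nn_integral_empty space_restrict_space)
  define t' where "t' = Sup Z"
  have bdd: "bdd_above Z" by (auto simp: Z_def bdd_above_def)
  have t'0: "0 \<le> t'" unfolding t'_def using \<open>0 \<in> Z\<close> bdd by (rule cSup_upper)
  have t'T: "t' \<le> T" unfolding t'_def using \<open>0 \<in> Z\<close> by (intro cSup_least) (auto simp: Z_def)
  have before: "G s = 0" if s: "0 \<le> s" "s < t'" for s
  proof -
    obtain u where "u \<in> Z" "s < u" using s(2) \<open>0 \<in> Z\<close> bdd unfolding t'_def by (metis less_cSup_iff empty_iff)
    then show ?thesis using mono[of s u] s(1) G0[of s] by (simp add: Z_def)
  qed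
  \<comment> \<open>The supremum of the zeros is itself a zero, because the integral up to it only
    sees earlier times.\<close>
  have "ennreal (G t') \<le> (\<integral>\<^sup>+ s. ennreal (\<kappa> s * G s) \<partial>Lo t')" using t'0 t'T by (intro le) simp
  also have "\<dots> = (\<integral>\<^sup>+ s. 0 \<partial>Lo t')" by (intro nn_integral_cong) (simp add: before)
  finally have Gt': "G t' = 0" using G0[of t'] by simp
  have "t' = T"
  proof (rule ccontr)
    assume "t' \<noteq> T"
    define Q where "Q t = (LINT s|Lo t. \<kappa> s)" for t
    have "continuous_on {0..T} Q" unfolding Q_def by (rule continuous_on_integral_Lo[OF \<kappa>])
    then obtain d where d: "d > 0" "\<And>u. u \<in> {0..T} \<Longrightarrow> dist u t' < d \<Longrightarrow> dist (Q u) (Q t') < 1 / 2"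
      unfolding continuous_on_iff using t'0 t'T by (metis atLeastAtMost_iff half_gt_zero zero_less_one)
    define t1 where "t1 = min T (t' + d / 2)"
    have t1: "t' < t1" "t1 \<le> T" using \<open>t' \<noteq> T\<close> t'T d(1) by (auto simp: t1_def)
    have "dist t1 t' < d" using d(1) t1 by (auto simp: t1_def dist_real_def)
    then have "\<bar>Q t1 - Q t'\<bar> < 1 / 2" using d(2)[of t1] t1 t'0 unfolding dist_real_def by simp
    then have Q: "Q t1 - Q t' < 1 / 2" by linarith
    have \<kappa>1: "integrable (Lo t1) \<kappa>" by (rule integrable_Lo_mono[OF t1(2) \<kappa>])
    \<comment> \<open>The part of the kernel before \<open>t'\<close>, where \<open>G\<close>
      vanishes; what is left of the kernel has mass \<open>Q t1 - Q t'\<close>, less than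
      \<open>1 / 2\<close>.\<close>
    define \<kappa>' where "\<kappa>' s = (if s < t' then \<kappa> s else 0)" for s
    have \<kappa>'i: "integrable (Lo t1) \<kappa>'"
    proof (rule L1_bound[OF \<kappa>1])
      have [measurable]: "\<kappa> \<in> BM t1" using \<kappa>1 by simp
      show "\<kappa>' \<in> BM t1" unfolding \<kappa>'_def by measurable
    qed (simp add: \<kappa>'_def)
    have "ennreal (G t1) \<le> (\<integral>\<^sup>+ s. ennreal (\<kappa> s * G s) \<partial>Lo t1)" using t1 t'0 by (intro le) simp
    also have "\<dots> \<le> (\<integral>\<^sup>+ s. ennreal (G t1 * (\<kappa> s - \<kappa>' s)) \<partial>Lo t1)"
    proof (intro nn_integral_mono ennreal_leI)
      fix s assume "s \<in> space (Lo t1)"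
      then have s: "0 < s" "s < t1" by auto
      show "\<kappa> s * G s \<le> G t1 * (\<kappa> s - \<kappa>' s)"
        using s t1 before[of s] mult_right_mono[OF mono[of s t1] \<kappa>0[of s]] by (auto simp: \<kappa>'_def mult.commute)
    qed
    also have "\<dots> = ennreal (LINT s|Lo t1. G t1 * (\<kappa> s - \<kappa>' s))"
    proof -
      have "0 \<le> \<kappa> s - \<kappa>' s" for s using \<kappa>0 by (simp add: \<kappa>'_def)
      then show ?thesis using \<kappa>1 \<kappa>'i G0 by (intro nn_integral_eq_integral) auto
    qed
    also have "(LINT s|Lo t1. G t1 * (\<kappa> s - \<kappa>' s)) = G t1 * (Q t1 - Q t')"
    proof -
      have "Q t' = (LINT s|Lo t1. \<kappa>' s)"
        unfolding Q_def \<kappa>'_def using t1 by (intro integral_Lo_restrict) simp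
      then show ?thesis using \<kappa>1 \<kappa>'i by (simp add: Q_def)
    qed
    finally have "G t1 \<le> G t1 * (Q t1 - Q t')"
      using G0[of t1] by (cases "G t1 = 0") (auto simp: ennreal_le_iff2)
    also have "\<dots> \<le> G t1 * (1 / 2)" using Q G0 by (intro mult_left_mono) auto
    finally have "G t1 = 0" using G0[of t1] by linarith
    then have "t1 \<in> Z" using t1 t'0 by (simp add: Z_def)
    then have "t1 \<le> t'" unfolding t'_def using bdd by (rule cSup_upper)
    then show False using t1 by simp
  qed
  then show ?thesis using mono[of t T] t Gt' G0[of t] by simp
qed

section \<open>Uniqueness of strong solutions\<close>

context feedback_setting begin

lemma strong_solution_mild:
  assumes "strong_solution \<iota> A Arc N FB y0 T y"
  shows "\<exists>f. L2_on T f \<and> mild T y0 f y \<and> continuous_on {0..T} y \<and>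
    (AE t in Lo T. y t \<in> DA) \<and> L2_on T (\<lambda>t. Aop (y t)) \<and>
    (AE t in Lo T. f t = - (K y t - P (K y t)) - lam *\<^sub>R P (\<iota> (y t)))"
proof -
  from assms obtain w where c: "continuous_on {0..T} y" and dom: "AE t in Lo T. y t \<in> DA"
    and A: "L2_on T (\<lambda>t. Aop (y t))" and w: "L2_on T w"
    and eq: "\<forall>t\<in>{0..T}. \<iota> (y t) = \<iota> y0 + (LINT s|Lo t. w s)"
    and ae: "AE t in Lo T. w t + Aop (y t) + Arc t (y t) + N t (y t) - FB t (y t) = 0"
    unfolding strong_solution_def by blast
  define f where "f t = w t + Aop (y t)" for t
  have f: "L2_on T f" unfolding f_def by (rule L2_on_add[OF w A])
  have "mild T y0 f y"
    by (rule integral_equation_imp_mild[OF c dom w eq f]) (simp add: f_def)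
  moreover have "AE t in Lo T. f t = - (K y t - P (K y t)) - lam *\<^sub>R P (\<iota> (y t))"
  proof -
    have "AE t in Lo T. t \<in> {0<..<T}" by (intro AE_I2) simp
    then show ?thesis
      using dom ae by eventually_elim (simp add: f_def K_def feedback_eq algebra_simps)
  qed
  ultimately show ?thesis using f c dom A by blast
qed

text \<open>A competitor need not lie in the contraction ball, so the energy estimates are used with
  \<open>\<beta> = 0\<close>, where they hold on all modes, for the difference \<open>d\<close> with
  forcing \<open>g\<close>. Maximal regularity bounds the integral of \<open>D^2\<close> by twice
  that of \<open>(norm (g s))^2\<close>; entering with weight \<open>1 / 4\<close>, it is absorbed.
  What remains is Gronwall with the kernel \<open>\<kappa>\<close>, integrable because
  \<open>A\<close> of both solutions is square integrable.\<close>

lemma strong_solution_unique: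
  assumes y: "strong_solution \<iota> A Arc N FB y0 T y"
    and z: "strong_solution \<iota> A Arc N FB y0 T z"
    and t: "t \<in> {0..T}"
  shows "z t = y t"
proof -
  obtain f1 where f1: "L2_on T f1" "mild T y0 f1 y" "continuous_on {0..T} y"
    "AE t in Lo T. y t \<in> DA" "L2_on T (\<lambda>t. Aop (y t))"
    "AE t in Lo T. f1 t = - (K y t - P (K y t)) - lam *\<^sub>R P (\<iota> (y t))"
    using strong_solution_mild[OF y] by blast
  obtain f2 where f2: "L2_on T f2" "mild T y0 f2 z" "continuous_on {0..T} z"
    "AE t in Lo T. z t \<in> DA" "L2_on T (\<lambda>t. Aop (z t))"
    "AE t in Lo T. f2 t = - (K z t - P (K z t)) - lam *\<^sub>R P (\<iota> (z t))"
    using strong_solution_mild[OF z] by blast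
  define d where "d t = y t - z t" for t
  define g where "g t = f1 t - f2 t" for t
  have gL: "L2_on T g" unfolding g_def by (rule L2_on_diff[OF f1(1) f2(1)])
  have "mild T (y0 - y0) g d" unfolding g_def d_def by (rule mild_diff[OF f1(2) f2(2) f1(1) f2(1)])
  then have dc: "cf i (d s) = duhamel i g s" if "s \<in> {0..T}" for s i
    using that by (simp add: mild_def)
  have dcont: "continuous_on {0..T} d" unfolding d_def by (intro continuous_intros f1(3) f2(3))
  obtain Kp where Kp: "Kp > 0" "\<And>h. norm (P h) \<le> norm h * Kp"
    using bounded_linear.pos_bounded[OF bounded_linear_P] by blast
  have "bounded (y ` {0..T} \<union> z ` {0..T})"
    unfolding bounded_Un by (intro conjI compact_imp_bounded compact_continuous_image f1(3) f2(3)) auto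
  then obtain \<rho>0 where \<rho>0: "\<forall>x\<in>y ` {0..T} \<union> z ` {0..T}. norm x \<le> \<rho>0" unfolding bounded_iff ..
  define \<rho> where "\<rho> = max 1 \<rho>0"
  have \<rho>: "1 \<le> \<rho>" "\<And>s. s \<in> {0..T} \<Longrightarrow> norm (y s) \<le> \<rho>" "\<And>s. s \<in> {0..T} \<Longrightarrow> norm (z s) \<le> \<rho>"
    using \<rho>0 by (auto simp: \<rho>_def intro: order_trans[OF _ max.cobounded2])
  \<comment> \<open>After \<open>1 - P\<close> the coefficient of \<open>D\<close> is
    \<open>1 / 4\<close>, so squaring with \<open>sum4_sq_le\<close> leaves the weight
    \<open>1 / 4\<close> on \<open>D^2\<close> that the absorption needs.\<close>
  define \<epsilon> where "\<epsilon> = 1 / (4 * (1 + Kp))"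
  have \<epsilon>: "0 < \<epsilon>" "(1 + Kp) * \<epsilon> = 1 / 4"
  proof -
    show "0 < \<epsilon>" using Kp(1) by (simp add: \<epsilon>_def)
    have "c * (1 / (4 * c)) = 1 / 4" if "0 < c" for c :: real using that by simp
    from this[of "1 + Kp"] show "(1 + Kp) * \<epsilon> = 1 / 4" unfolding \<epsilon>_def using Kp(1) by linarith
  qed
  obtain C where lip: "lip_const \<rho> \<epsilon> C" using N_small_lipschitz[OF \<rho>(1) \<epsilon>(1)] ..
  then have C: "C \<ge> 0" by (simp add: lip_const_def)
  define Y where "Y s = norm (Aop (y s))" for s
  define Z where "Z s = norm (Aop (z s))" for s
  define D where "D s = norm (Aop (d s))" for s
  define a where "a = (1 + Kp) * (C + Crc) + \<bar>lam\<bar> * (norm \<iota> * Kp)"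
  have a: "0 \<le> a" using Kp(1) C Crc_nonneg by (simp add: a_def)
  define \<kappa> where "\<kappa> s = 8 * (a^2 + (Y s)^2 + (Z s)^2)" for s
  have ae: "AE s in Lo T. (norm (g s))^2 \<le> (1 / 4) * (D s)^2 + (\<kappa> s / 2) * (norm (d s))^2"
  proof -
    have Arc': "AE s in Lo T. norm (Arc s) \<le> Crc" by (rule AE_Lo_halfline[OF Arc_bound])
    have "AE s in Lo T. s \<in> {0<..<T}" by (intro AE_I2) simp
    then show ?thesis
      using f1(4,6) f2(4,6) Arc'
    proof eventually_elim
      case (elim s)
      define X where "X = K y s - K z s"
      have "P (K y s) - P (K z s) = P X"
        unfolding linear_diff[OF linear_P, symmetric] X_def ..
      moreover have "P (\<iota> (y s)) - P (\<iota> (z s)) = P (\<iota> (d s))"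
        unfolding linear_diff[OF linear_P, symmetric] d_def by (simp add: blinfun.diff_right)
      moreover have "g s = - ((K y s - K z s) - (P (K y s) - P (K z s))) - lam *\<^sub>R (P (\<iota> (y s)) - P (\<iota> (z s)))"
        using elim by (simp add: g_def scaleR_diff_right)
      ultimately have "g s = - (X - P X) - lam *\<^sub>R P (\<iota> (d s))"
        unfolding X_def by (simp only:)
      then have "norm (g s) \<le> norm (X - P X) + norm (lam *\<^sub>R P (\<iota> (d s)))"
        using norm_triangle_ineq4[of "- (X - P X)" "lam *\<^sub>R P (\<iota> (d s))"] by (simp only: norm_minus_cancel)
      also have "\<dots> \<le> (1 + Kp) * norm X + \<bar>lam\<bar> * (norm \<iota> * Kp) * norm (d s)"
      proof (rule add_mono)
        show "norm (X - P X) \<le> (1 + Kp) * norm X"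
          using norm_triangle_ineq4[of X "P X"] Kp(2)[of X] by (simp add: algebra_simps)
        have "norm (P (\<iota> (d s))) \<le> (norm \<iota> * norm (d s)) * Kp"
          using Kp(1) by (intro order_trans[OF Kp(2)] mult_right_mono norm_incl) simp
        then have "\<bar>lam\<bar> * norm (P (\<iota> (d s))) \<le> \<bar>lam\<bar> * ((norm \<iota> * norm (d s)) * Kp)" by (rule mult_left_mono) simp
        then show "norm (lam *\<^sub>R P (\<iota> (d s))) \<le> \<bar>lam\<bar> * (norm \<iota> * Kp) * norm (d s)"
          by (simp add: mult_ac)
      qed
      finally have 1: "norm (g s) \<le> (1 + Kp) * norm X + \<bar>lam\<bar> * (norm \<iota> * Kp) * norm (d s)" .
      have "norm X \<le> \<epsilon> * D s + norm (d s) * (\<epsilon> * ((Y s + Z s) / 1) + (C + Crc))"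
        unfolding X_def D_def Y_def Z_def d_def
        using elim \<rho>(2,3)[of s] by (intro K_diff_bound[OF lip]) auto
      then have "norm X \<le> \<epsilon> * D s + norm (d s) * (\<epsilon> * (Y s + Z s) + (C + Crc))" by simp
      then have "(1 + Kp) * norm X \<le> (1 + Kp) * (\<epsilon> * D s + norm (d s) * (\<epsilon> * (Y s + Z s) + (C + Crc)))"
        using Kp(1) by (intro mult_left_mono) auto
      also have "\<dots> = ((1 + Kp) * \<epsilon>) * D s + norm (d s) * (((1 + Kp) * \<epsilon>) * (Y s + Z s) + (1 + Kp) * (C + Crc))"
        by (simp add: algebra_simps)
      finally have "norm (g s) \<le> D s / 4 + norm (d s) * (Y s / 4) + norm (d s) * (Z s / 4) + norm (d s) * a"
        using 1 unfolding \<epsilon>(2) a_def by (simp add: algebra_simps add_divide_distrib)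
      then have "(norm (g s))^2 \<le> (D s / 4 + norm (d s) * (Y s / 4) + norm (d s) * (Z s / 4) + norm (d s) * a)^2"
        by (intro power_mono) auto
      also note sum4_sq_le
      also have "4 * ((D s / 4)^2 + (norm (d s) * (Y s / 4))^2 + (norm (d s) * (Z s / 4))^2 + (norm (d s) * a)^2)
          = (1 / 4) * (D s)^2 + (4 * a^2 + (Y s)^2 / 4 + (Z s)^2 / 4) * (norm (d s))^2"
        by (simp add: power_mult_distrib power_divide algebra_simps)
      also have "\<dots> \<le> (1 / 4) * (D s)^2 + (\<kappa> s / 2) * (norm (d s))^2"
      proof (intro add_left_mono mult_right_mono)
        have *: "4 * u + v / 4 + w / 4 \<le> 8 * (u + v + w) / 2" if "0 \<le> v" "0 \<le> w" for u v w :: real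
          using that by (simp add: field_simps)
        show "4 * a^2 + (Y s)^2 / 4 + (Z s)^2 / 4 \<le> \<kappa> s / 2"
          unfolding \<kappa>_def by (rule *) simp_all
      qed simp
      finally show ?case .
    qed
  qed
  have \<kappa>i: "integrable (Lo T) \<kappa>"
    unfolding \<kappa>_def Y_def Z_def
    by (intro integrable_mult_right Bochner_Integration.integrable_add integrable_const_Lo)
       (use f1(5) f2(5) in \<open>simp_all add: L2_on_def\<close>)
  have \<kappa>0: "0 \<le> \<kappa> s" for s by (simp add: \<kappa>_def)
  define Gn where "Gn t = (\<integral>\<^sup>+ s. ennreal ((norm (g s))^2) \<partial>Lo t)" for t
  define G where "G t = enn2real (Gn t)" for t
  have Gfin: "Gn t < top" if "t \<le> T" for t
    using L2_on_mono[OF that gL] by (simp add: L2_on_iff_nn Gn_def)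
  have Geq: "Gn t = ennreal (G t)" if "t \<le> T" for t
    using Gfin[OF that] by (simp add: G_def)
  have est: "(norm (d t))^2 \<le> G t \<and> (\<integral>\<^sup>+ s. ennreal ((D s)^2) \<partial>Lo t) \<le> 2 * Gn t" if t: "t \<in> {0..T}" for t
  proof
    have t': "0 \<le> t" "t \<le> T" using t by auto
    have gm: "g \<in> BM t" using L2_on_mono[OF t'(2) gL] by (simp add: L2_on_def)
    have dm: "d \<in> BM t"
      using t by (intro measurable_mild continuous_on_subset[OF dcont]) auto
    have "ennreal (exp (0 * t) * (norm (d t))^2) \<le> wsq 0 g t"
      by (rule energy_bound_V[OF gm t'(1) dc[OF t]]) simp
    then have "ennreal ((norm (d t))^2) \<le> ennreal (G t)" by (simp add: Gn_def[symmetric] Geq t')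
    then show "(norm (d t))^2 \<le> G t" by (simp add: G_def)
    have "wsq 0 (\<lambda>s. Aop (d s)) t
        \<le> 2 * wsq 0 g t"
    proof (rule energy_bound_DA(2)[OF gm dm t'(1)])
      show "wsq 0 g t < \<infinity>"
        using Gfin[OF t'(2)] by (simp add: Gn_def)
    qed (use t' dc in auto)
    then show "(\<integral>\<^sup>+ s. ennreal ((D s)^2) \<partial>Lo t) \<le> 2 * Gn t" by (simp add: Gn_def D_def)
  qed
  have "G t = 0"
  proof (rule gronwall_zero[OF _ _ \<kappa>0 \<kappa>i _ t])
    show "0 \<le> G t" for t by (simp add: G_def)
    fix s t assume st: "0 \<le> s" "s \<le> t" "t \<le> T"
    show "G s \<le> G t"
      unfolding G_def using Gfin[OF st(3)] nn_integral_Lo_mono[OF st(2)]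
      by (intro enn2real_mono) (auto simp: Gn_def)
  next
    fix t assume t: "t \<in> {0..T}"
    then have t': "0 \<le> t" "t \<le> T" by auto
    define I where "I = (\<integral>\<^sup>+ s. ennreal (\<kappa> s * G s) \<partial>Lo t)"
    have dm: "d \<in> BM t"
      using t by (intro measurable_mild continuous_on_subset[OF dcont]) auto
    have [measurable]: "d \<in> BM t" "D \<in> BM t" "\<kappa> \<in> BM t"
      unfolding D_def
      using dm measurable_compose[OF measurable_compose[OF dm measurable_opA] borel_measurable_norm]
        measurable_Lo_mono[OF t'(2) borel_measurable_integrable[OF \<kappa>i]] by simp_all
    have "Gn t \<le> (\<integral>\<^sup>+ s. ennreal (1 / 4) * ennreal ((D s)^2) + ennreal (1 / 2) * ennreal (\<kappa> s * (norm (d s))^2) \<partial>Lo t)"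
      unfolding Gn_def
    proof (rule nn_integral_mono_AE, use AE_Lo_mono[OF t'(2) ae] in eventually_elim)
      case (elim s)
      then have "ennreal ((norm (g s))^2) \<le> ennreal ((1 / 4) * (D s)^2 + (1 / 2) * (\<kappa> s * (norm (d s))^2))"
        by (intro ennreal_leI) simp
      also have "\<dots> = ennreal ((1 / 4) * (D s)^2) + ennreal ((1 / 2) * (\<kappa> s * (norm (d s))^2))"
        using \<kappa>0 by (intro ennreal_plus) auto
      also have "\<dots> = ennreal (1 / 4) * ennreal ((D s)^2) + ennreal (1 / 2) * ennreal (\<kappa> s * (norm (d s))^2)"
        using \<kappa>0 by (intro arg_cong2[where f = "(+)"] ennreal_mult) auto
      finally show ?case .
    qed
    also have "\<dots> = ennreal (1 / 4) * (\<integral>\<^sup>+ s. ennreal ((D s)^2) \<partial>Lo t)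
        + ennreal (1 / 2) * (\<integral>\<^sup>+ s. ennreal (\<kappa> s * (norm (d s))^2) \<partial>Lo t)"
      by (subst nn_integral_add) (auto simp: nn_integral_cmult)
    also have "\<dots> \<le> ennreal (1 / 4) * (2 * Gn t) + ennreal (1 / 2) * I"
    proof (intro add_mono mult_left_mono)
      show "(\<integral>\<^sup>+ s. ennreal ((D s)^2) \<partial>Lo t) \<le> 2 * Gn t" using est[OF t] by simp
      show "(\<integral>\<^sup>+ s. ennreal (\<kappa> s * (norm (d s))^2) \<partial>Lo t) \<le> I"
        unfolding I_def using est t' \<kappa>0
        by (intro nn_integral_mono ennreal_leI mult_left_mono) auto
    qed auto
    finally have le: "Gn t \<le> ennreal (1 / 4) * (2 * Gn t) + ennreal (1 / 2) * I" .
    show "ennreal (G t) \<le> (\<integral>\<^sup>+ s. ennreal (\<kappa> s * G s) \<partial>Lo t)"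
    \<comment> \<open>An infinite kernel integral leaves nothing to show. Otherwise all terms are
      real, and the half of \<open>G t\<close> on the right is subtracted.\<close>
    proof (cases I)
      case top
      then show ?thesis by (simp add: I_def)
    next
      case (real x)
      have G0: "0 \<le> G t" by (simp add: G_def)
      have "ennreal (1 / 4) * (2 * Gn t) + ennreal (1 / 2) * I = ennreal (1 / 4 * (2 * G t)) + ennreal (1 / 2 * x)"
        using G0 real unfolding Geq[OF t'(2)] by (simp only: ennreal_mult[symmetric] ennreal_numeral[symmetric] zero_le_numeral zero_le_divide_1_iff mult_nonneg_nonneg)
      also have "\<dots> = ennreal (1 / 4 * (2 * G t) + 1 / 2 * x)"
        using G0 real by (intro ennreal_plus[symmetric]) auto
      finally have "ennreal (G t) \<le> ennreal (1 / 4 * (2 * G t) + 1 / 2 * x)"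
        using le unfolding Geq[OF t'(2)] by simp
      then have "G t \<le> 1 / 4 * (2 * G t) + 1 / 2 * x" using G0 real by (subst (asm) ennreal_le_iff) auto
      then have "G t \<le> x" by simp
      then show ?thesis using real by (simp add: I_def ennreal_leI)
    qed
  qed
  then have "(norm (d t))^2 \<le> 0" using est[OF t] by simp
  then show ?thesis by (simp add: d_def)
qed

end

lemma (in state_operator) feedback_stabilizes:
  fixes S :: "nat \<Rightarrow> nat set" and U :: "nat \<Rightarrow> 'h set"
  assumes lam: "lam > 0" and CP: "CP > 0"
    and adm: "\<And>M. M \<ge> 1 \<Longrightarrow> S M \<noteq> {} \<and> admissible_pair \<iota> e (S M) (U M)"
    and lim: "filterlim (\<lambda>M. alpha_plus \<alpha> (S M)) at_top sequentially"
    and bound: "\<And>M. M \<ge> 1 \<Longrightarrow> onorm (oblique_proj (U M) (orthogonal_comp (Esp \<iota> e (S M)))) \<le> CP"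
    and R: "R > 0"
  shows "\<exists>M\<ge>1. \<exists>C5\<ge>1. \<exists>\<mu>2>0. \<forall>y0. norm y0 < R \<longrightarrow>
    solution_decays \<iota> A Arc N (feedback \<iota> A e Arc N (S M) (U M) (A_shift \<iota> A lam)) C5 \<mu>2 y0"
proof -
  define c where "c = 8 * (lam * (1 + CP) * norm \<iota>) + 4"
  have c: "4 \<le> c" using lam CP by (simp add: c_def)
  \<comment> \<open>Covers \<open>2 * r\<close> for every admissible datum, as
    \<open>r = c * norm y0\<close>; the value at least 1 is what \<open>K_contraction\<close> asks
    for.\<close>
  define \<rho> where "\<rho> = max 1 (2 * (c * R))"
  obtain \<beta> where \<beta>: "evl 0 + 1 \<le> \<beta>" and contr: "\<And>u1 u2 \<delta>. 0 \<le> \<delta> \<Longrightarrow> bnd \<beta> \<rho> u1 \<Longrightarrow> bnd \<beta> \<rho> u2 \<Longrightarrow>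
    bnd \<beta> \<delta> (\<lambda>t. u1 t - u2 t) \<Longrightarrow> bndF \<beta> (1 / (8 * (1 + CP)) * \<delta>) (\<lambda>s. K u1 s - K u2 s)"
  proof -
    have "1 \<le> \<rho>" "0 < 1 / (8 * (1 + CP))" using CP by (auto simp: \<rho>_def)
    from K_contraction[OF this] show ?thesis using that by blast
  qed
  have "\<forall>\<^sub>F M in sequentially. 2 * \<beta> \<le> alpha_plus \<alpha> (S M)"
    using lim unfolding filterlim_at_top by blast
  then have "\<forall>\<^sub>F M in sequentially. 2 * \<beta> \<le> alpha_plus \<alpha> (S M) \<and> 1 \<le> M"
    using eventually_ge_at_top by (rule eventually_conj)
  then obtain M where M: "2 * \<beta> \<le> alpha_plus \<alpha> (S M)" "1 \<le> M"
    by (auto dest: eventually_happens)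
  interpret fs: feedback_setting \<iota> A \<alpha> e Arc N Crc CN n \<zeta>1 \<zeta>2 \<delta>1 \<delta>2 "S M" "U M" lam
    using adm[OF M(2)] by unfold_locales simp
  have Pb: "norm (fs.P h) \<le> CP * norm h" for h
    by (rule order_trans[OF onorm[OF fs.bounded_linear_P]]) (intro mult_right_mono bound M, simp)
  have gap: "2 * \<beta> \<le> evl i" if "i \<notin> fs.J" for i
  proof -
    have "bdd_below (\<alpha> ` ({1..} - S M))"
      unfolding bdd_below_def
      by (rule exI[of _ "\<alpha> 1"]) (auto intro!: mono_onD[OF eigenvalues_mono])
    then have "alpha_plus \<alpha> (S M) \<le> \<alpha> (Suc i)"
      unfolding alpha_plus_def using that by (intro cInf_lower) (auto simp: fs.J_def)
    then show ?thesis using M(1) by (simp add: evl_def)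
  qed
  \<comment> \<open>The constants are those of \<open>y_decay\<close> squared: \<open>2 * r\<close>
    becomes \<open>(2 * c)^2 * (norm y0)^2\<close>, and the square of \<open>decay\<close> has rate
    \<open>evl 0\<close>.\<close>
  have "solution_decays \<iota> A Arc N (feedback \<iota> A e Arc N (S M) (U M) (A_shift \<iota> A lam)) ((2 * c)^2) (evl 0) y0"
    if y0: "norm y0 < R" for y0
  proof -
    have rad: "2 * (c * norm y0) \<le> \<rho>"
    proof -
      have "c * norm y0 \<le> c * R" using y0 c by (intro mult_left_mono) auto
      then show ?thesis by (simp add: \<rho>_def)
    qed
    \<comment> \<open>One instance for each datum: only \<open>r\<close> varies with
      \<open>y0\<close>, while \<open>M\<close>, \<open>\<beta>\<close> and \<open>\<rho>\<close>
      are already fixed.\<close>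
    interpret pc: picard \<iota> A \<alpha> e Arc N Crc CN n \<zeta>1 \<zeta>2 \<delta>1 \<delta>2 "S M" "U M" lam CP \<beta> \<rho> "c * norm y0" y0
      by unfold_locales (use lam CP Pb gap \<beta> contr rad in \<open>simp_all add: c_def\<close>)
    show ?thesis
      unfolding solution_decays_def
    proof (intro exI[of _ pc.y] conjI allI impI ballI)
      show "strong_solution \<iota> A Arc N (feedback \<iota> A e Arc N (S M) (U M) (A_shift \<iota> A lam)) y0 T pc.y" if "0 < T" for T
        using that by (rule pc.y_strong)
      show "z t = pc.y t"
        if "0 < T" "strong_solution \<iota> A Arc N (feedback \<iota> A e Arc N (S M) (U M) (A_shift \<iota> A lam)) y0 T z" "t \<in> {0..T}"
        for T z t
        by (rule fs.strong_solution_unique[OF pc.y_strong[OF that(1)] that(2,3)])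
      fix t :: real assume t: "0 \<le> t"
      have "(norm (pc.y t))^2 \<le> (2 * (c * norm y0) * decay t)^2"
        by (intro power_mono pc.y_decay t) simp
      also have "\<dots> = (2 * c)^2 * (decay t)^2 * (norm y0)^2"
        by (simp add: power_mult_distrib)
      also have "(decay t)^2 = exp (- evl 0 * t)"
        unfolding exp_double[symmetric] by simp
      finally show "(norm (pc.y t))^2 \<le> (2 * c)^2 * exp (- evl 0 * t) * (norm y0)^2" .
    qed
  qed
  moreover have "1 \<le> (2 * c)^2" using c by (intro one_le_power) simp
  ultimately show ?thesis using M(2) evl_pos[of 0] by blast
qed

theorem theorem2p5:
  fixes \<iota> :: "'v::{real_inner, banach, second_countable_topology} \<Rightarrow>\<^sub>L
                'h::{real_inner, banach, second_countable_topology}"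
    and A :: "'v \<Rightarrow>\<^sub>L ('v \<Rightarrow>\<^sub>L real)"
    and \<alpha> :: "nat \<Rightarrow> real"
    and e :: "nat \<Rightarrow> 'v"
    and Arc :: "real \<Rightarrow> 'v \<Rightarrow>\<^sub>L 'h"
    and N :: "real \<Rightarrow> 'v \<Rightarrow> 'h"
    and Crc CN :: real
    and n :: nat
    and \<zeta>1 \<zeta>2 \<delta>1 \<delta>2 :: "nat \<Rightarrow> real"
    and lam CP \<Lambda> :: real
    and S :: "nat \<Rightarrow> nat set"
    and U :: "nat \<Rightarrow> 'h set"
  assumes "state_operator \<iota> A \<alpha> e Arc N Crc CN n \<zeta>1 \<zeta>2 \<delta>1 \<delta>2"
    and "lam > 0"
    and "\<And>M. M \<ge> 1 \<Longrightarrow> S M \<noteq> {} \<and> admissible_pair \<iota> e (S M) (U M)"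
    and "filterlim (\<lambda>M. alpha_plus \<alpha> (S M)) at_top sequentially"
    and "CP > 0"
    and "\<And>M. M \<ge> 1 \<Longrightarrow> onorm (oblique_proj (U M) (orthogonal_comp (Esp \<iota> e (S M)))) \<le> CP"
    and "\<Lambda> > 0"
    and "\<And>M. M \<ge> 1 \<Longrightarrow> alpha_max \<alpha> (S M) / alpha_plus \<alpha> (S M) \<le> \<Lambda>"
  shows "(\<forall>R>0. \<exists>M\<ge>1. \<exists>C5\<ge>1. \<exists>\<mu>2>0. \<forall>y0. norm y0 < R \<longrightarrow>
            solution_decays \<iota> A Arc N
              (feedback \<iota> A e Arc N (S M) (U M) (A_shift \<iota> A lam)) C5 \<mu>2 y0)
         \<and> semiglobally_exp_stable \<iota> A Arc N (feedback_class \<iota> A e Arc N)"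
proof -
  interpret state_operator \<iota> A \<alpha> e Arc N Crc CN n \<zeta>1 \<zeta>2 \<delta>1 \<delta>2 by fact
  have first: "\<exists>M\<ge>1. \<exists>C5\<ge>1. \<exists>\<mu>2>0. \<forall>y0. norm y0 < R \<longrightarrow>
      solution_decays \<iota> A Arc N (feedback \<iota> A e Arc N (S M) (U M) (A_shift \<iota> A lam)) C5 \<mu>2 y0"
    if "R > 0" for R
    using assms(2-6) that by (intro feedback_stabilizes[of lam CP]) auto
  have mem: "feedback \<iota> A e Arc N (S M) (U M) (A_shift \<iota> A lam) \<in> feedback_class \<iota> A e Arc N" if "M \<ge> 1" for M
  proof -
    interpret feedback_setting \<iota> A \<alpha> e Arc N Crc CN n \<zeta>1 \<zeta>2 \<delta>1 \<delta>2 "S M" "U M" lam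
      using assms(3)[OF that] by unfold_locales simp
    show ?thesis by (rule feedback_in_class)
  qed
  have "semiglobally_exp_stable \<iota> A Arc N (feedback_class \<iota> A e Arc N)"
    unfolding semiglobally_exp_stable_def
  proof (intro allI impI)
    fix R :: real assume "R > 0"
    from first[OF this] mem
    show "\<exists>F\<in>feedback_class \<iota> A e Arc N. \<exists>K\<ge>1. \<exists>l>0. \<forall>y0. norm y0 < R \<longrightarrow> solution_decays \<iota> A Arc N F K l y0"
      by blast
  qed
  with first show ?thesis by blast
qed

end
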